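(* Let $X$ be a compact locally linearly connected (LLC) metric space and let $f : X \to \mathbb{R}$ be a continuous function. Then $$\mathcal{L}(f) = \overline{\dim}\, T_f \le \mathcal{H}(f)\,\overline{\dim}\, X ,$$ where $$\mathcal{H}(f) := \inf\left\{\frac{1}{\alpha} \;\Big|\; \exists \lambda\in \mathrm{Homeo}(X),\ \|f\circ\lambda\|_{C^\alpha} < \infty\right\}.$$
   Context: $\overline{\dim}$ is the upper-box dimension; $\mathrm{Homeo}(X)$ is the group of homeomorphisms of $X$; $\|\cdot\|_{C^\alpha}$ is the $\alpha$-Hölder norm ($0<\alpha\le 1$); the infimum of the empty set is $+\infty$ (in which case the inequality is vacuous). LLC: a metric space $(X,d)$ is locally linearly connected if it is connected and, for all $r>0$, all $z\in X$ and all $x,y\in B(z,r)$, there is an arc connecting $x$ and $y$ whose diameter is linear in $d(x,y)$ (i.e. at most $C\,d(x,y)$ for a constant $C$ depending only on $X$). The tree $T_f$: $d_f(x,y) := f(x)+f(y) - 2\sup_{\gamma : x\mapsto y}\inf_{t\in[0,1]} f(\gamma(t))$, the supremum being over continuous paths in $X$ from $x$ to $y$, is a pseudo-distance on $X$, and $T_f := X/\{d_f=0\}$ with the induced distance $d_f$ is an $\mathbb{R}$-tree. Persistence index: $\mathcal{L}(f) := \inf\{p\ge 1 : \mathrm{Pers}_p(H_0(X,f)) < \infty\}$, where $\mathrm{Pers}_p(H_0(X,f)) := \left(\sum_{b} \ell(b\cap[\inf f,\sup f])^p\right)^{1/p}$, the sum being over the bars $b$ of the $H_0$-barcode of the superlevel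 filtration $X_r=\{f\ge r\}$ (Čech homology with coefficients in a field), and $\ell$ denoting length.
   Formalization: The equality L(f) = dim T_f is stated only for nonconstant f: for constant f one has L(f) = 1 (since p ≥ 1) while T_f is a point of dimension 0; the inequality dim T_f ≤ H(f) dim X is stated for all f. *)

theory Defs
  imports "HOL-Analysis.Analysis"
begin

section \<open>Locally linearly connected spaces\<close>

text \<open>An arc joining a point to itself is a degenerate arc (a point, of diameter 0), whereas
  \<^const>\<open>arc\<close> demands an injective path; hence the restriction to distinct points.\<close>

definition LLC :: "'a::metric_space set \<Rightarrow> bool" where
  "LLC X \<longleftrightarrow> connected X \<and>
     (\<exists>C::real. \<forall>r>0. \<forall>z\<in>X. \<forall>x\<in>X \<inter> ball z r. \<forall>y\<in>X \<inter> ball z r. x \<noteq> y \<longrightarrow>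
        (\<exists>g. arc g \<and> path_image g \<subseteq> X \<and> pathstart g = x \<and> pathfinish g = y \<and>
             diameter (path_image g) \<le> C * dist x y))"


section \<open>Upper box dimension\<close>

text \<open>The carrier and the distance are passed explicitly, because the tree of a function is not
  the universe of a metric type.\<close>

definition covering_number :: "'b set \<Rightarrow> ('b \<Rightarrow> 'b \<Rightarrow> real) \<Rightarrow> real \<Rightarrow> enat" where
  "covering_number S d \<epsilon> =
     Inf {enat (card C) | C. finite C \<and> C \<subseteq> S \<and> S \<subseteq> (\<Union>c\<in>C. {y. d c y \<le> \<epsilon>})}"

definition upper_box_dim :: "'b set \<Rightarrow> ('b \<Rightarrow> 'b \<Rightarrow> real) \<Rightarrow> ereal" where
  "upper_box_dim S d =
     Limsup (at_right 0)
       (\<lambda>\<epsilon>. case covering_number S d \<epsilon> of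
               enat n \<Rightarrow> ereal (ln (real n) / ln (1 / \<epsilon>))
             | \<infinity> \<Rightarrow> \<infinity>)"


section \<open>The tree of a function\<close>

definition tree_pdist :: "('a::topological_space \<Rightarrow> real) \<Rightarrow> 'a \<Rightarrow> 'a \<Rightarrow> real" where
  "tree_pdist f x y =
     f x + f y
       - 2 * (SUP \<gamma>\<in>{\<gamma>. path \<gamma> \<and> pathstart \<gamma> = x \<and> pathfinish \<gamma> = y}. INF t\<in>{0..1}. f (\<gamma> t))"

definition tree :: "('a::topological_space \<Rightarrow> real) \<Rightarrow> 'a set set" where
  "tree f = UNIV // {(x, y). tree_pdist f x y = 0}"

definition tree_dist :: "('a::topological_space \<Rightarrow> real) \<Rightarrow> 'a set \<Rightarrow> 'a set \<Rightarrow> real" where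
  "tree_dist f A B = tree_pdist f (SOME x. x \<in> A) (SOME y. y \<in> B)"


section \<open>Cech homology in degree 0 with coefficients in a field\<close>

text \<open>A finite open cover of a subspace \<open>K\<close> is given by a finite set of open sets \<open>U\<close> of the
  ambient space, which stand for their traces \<open>U \<inter> K\<close>; all incidences in the nerve are tested
  inside \<open>K\<close>. In this way a cover of \<open>L\<close> is also a cover of every \<open>K \<subseteq> L\<close>.\<close>

definition open_covers :: "'a::topological_space set \<Rightarrow> 'a set set set" where
  "open_covers K = {\<U>. finite \<U> \<and> (\<forall>U\<in>\<U>. open U) \<and> K \<subseteq> \<Union>\<U>}"

definition nerve_chains0 :: "'a set \<Rightarrow> 'a set set \<Rightarrow> ('a set \<Rightarrow> 'k::field) set" where
  "nerve_chains0 K \<U> = {c. \<forall>U. c U \<noteq> 0 \<longrightarrow> U \<in> \<U> \<and> U \<inter> K \<noteq> {}}"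

definition nerve_chains1 :: "'a set \<Rightarrow> 'a set set \<Rightarrow> ('a set \<times> 'a set \<Rightarrow> 'k::field) set" where
  "nerve_chains1 K \<U> = {e. \<forall>U V. e (U, V) \<noteq> 0 \<longrightarrow> U \<in> \<U> \<and> V \<in> \<U> \<and> U \<inter> V \<inter> K \<noteq> {}}"

text \<open>Ordered simplicial chains: the boundary of the edge \<open>(U, V)\<close> is \<open>V - U\<close>.\<close>

definition nerve_boundary ::
    "'a set set \<Rightarrow> ('a set \<times> 'a set \<Rightarrow> 'k::field) \<Rightarrow> ('a set \<Rightarrow> 'k)" where
  "nerve_boundary \<U> e = (\<lambda>V. \<Sum>U\<in>\<U>. e (U, V) - e (V, U))"

definition nerve_homologous :: "'a set \<Rightarrow> 'a set set \<Rightarrow> (('a set \<Rightarrow> 'k::field) \<times> ('a set \<Rightarrow> 'k)) set" where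
  "nerve_homologous K \<U> =
     {(c, c'). c \<in> nerve_chains0 K \<U> \<and> c' \<in> nerve_chains0 K \<U> \<and>
               (\<exists>e\<in>nerve_chains1 K \<U>. \<forall>U. c' U = c U + nerve_boundary \<U> e U)}"

definition nerve_H0 :: "'a set \<Rightarrow> 'a set set \<Rightarrow> ('a set \<Rightarrow> 'k::field) set set" where
  "nerve_H0 K \<U> = nerve_chains0 K \<U> // nerve_homologous K \<U>"

definition refinement_map :: "'a set \<Rightarrow> 'a set set \<Rightarrow> 'a set set \<Rightarrow> ('a set \<Rightarrow> 'a set) \<Rightarrow> bool" where
  "refinement_map K \<V> \<U> p \<longleftrightarrow> (\<forall>V\<in>\<V>. V \<inter> K \<noteq> {} \<longrightarrow> p V \<in> \<U> \<and> V \<inter> K \<subseteq> p V)"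

definition push_chain :: "'a set set \<Rightarrow> ('a set \<Rightarrow> 'a set) \<Rightarrow> ('a set \<Rightarrow> 'k::field) \<Rightarrow> ('a set \<Rightarrow> 'k)" where
  "push_chain \<V> p c = (\<lambda>U. \<Sum>V | V \<in> \<V> \<and> p V = U. c V)"

text \<open>The inverse limit of the groups \<^const>\<open>nerve_H0\<close> over all finite open covers, directed by
  refinement. An element is a compatible family of homology classes (cosets of chains); it takes
  the dummy value \<open>{}\<close> on arguments that are not covers.\<close>

type_synonym ('a, 'k) cech_class = "'a set set \<Rightarrow> ('a set \<Rightarrow> 'k) set"

definition cech_H0 :: "'a::topological_space set \<Rightarrow> ('a, 'k::field) cech_class set" where
  "cech_H0 K =
     {z. (\<forall>\<U>\<in>open_covers K. z \<U> \<in> nerve_H0 K \<U>) \<and>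
         (\<forall>\<U>. \<U> \<notin> open_covers K \<longrightarrow> z \<U> = {}) \<and>
         (\<forall>\<U>\<in>open_covers K. \<forall>\<V>\<in>open_covers K. \<forall>p.
            refinement_map K \<V> \<U> p \<longrightarrow> push_chain \<V> p ` z \<V> \<subseteq> z \<U>)}"

text \<open>The vector space structure, as the single operation \<open>a z + w\<close>: the sum of the cosets
  \<open>a z\<^sub>\<U>\<close> and \<open>w\<^sub>\<U>\<close> is again a full coset, also for \<open>a = 0\<close>.\<close>

definition cech_comb ::
    "'k::field \<Rightarrow> ('a, 'k) cech_class \<Rightarrow> ('a, 'k) cech_class \<Rightarrow> ('a, 'k) cech_class" where
  "cech_comb a z w = (\<lambda>\<U>. {(\<lambda>U. a * c U + c' U) | c c'. c \<in> z \<U> \<and> c' \<in> w \<U>})"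

text \<open>The map induced by an inclusion \<open>K \<subseteq> L\<close>; the source \<open>K\<close> need not be mentioned.\<close>

definition cech_incl ::
    "'a::topological_space set \<Rightarrow> ('a, 'k::field) cech_class \<Rightarrow> ('a, 'k) cech_class" where
  "cech_incl L z = (\<lambda>\<U>. if \<U> \<in> open_covers L then nerve_homologous L \<U> `` z \<U> else {})"


section \<open>The barcode of the superlevel filtration\<close>

definition superlevel :: "('a \<Rightarrow> real) \<Rightarrow> real \<Rightarrow> 'a set" where
  "superlevel f r = {x. f x \<ge> r}"

text \<open>A bar is an interval together with a label; labels distinguish repeated intervals, so that a
  set of bars is a multiset of intervals.\<close>

type_synonym bar = "real set \<times> nat"

text \<open>The product of the interval modules of the bars in \<open>B\<close>: its space at level \<open>r\<close>, and its
  structure map into level \<open>r\<close> from any level \<open>s \<ge> r\<close>.\<close>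

definition interval_product :: "bar set \<Rightarrow> real \<Rightarrow> (bar \<Rightarrow> 'k::field) set" where
  "interval_product B r = {v. \<forall>\<beta>. v \<beta> \<noteq> 0 \<longrightarrow> \<beta> \<in> B \<and> r \<in> fst \<beta>}"

definition interval_map :: "real \<Rightarrow> (bar \<Rightarrow> 'k::field) \<Rightarrow> (bar \<Rightarrow> 'k)" where
  "interval_map r v = (\<lambda>\<beta>. if r \<in> fst \<beta> then v \<beta> else 0)"

text \<open>\<open>B\<close> is a barcode of the persistence module \<open>r \<mapsto> H\<^sub>0({f \<ge> r})\<close> if this module is isomorphic to
  the product of the interval modules of \<open>B\<close>. The product agrees with the direct sum when the spaces
  are finite-dimensional, and it is the form of the decomposition theorem for the upper
  semi-continuous q-tame modules arising here. A direct sum need not exist: if \<open>f\<close> is minus the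
  distance to a Cantor set in an interval, then \<open>H\<^sub>0({f \<ge> 0})\<close> has uncountable dimension and embeds
  into the inverse limit of the finite-dimensional spaces at the levels below 0.\<close>

definition is_H0_barcode :: "'k::field itself \<Rightarrow> ('a::topological_space \<Rightarrow> real) \<Rightarrow> bar set \<Rightarrow> bool" where
  "is_H0_barcode _ f B \<longleftrightarrow>
     (\<forall>\<beta>\<in>B. is_interval (fst \<beta>) \<and> fst \<beta> \<noteq> {}) \<and>
     (\<exists>\<phi> :: real \<Rightarrow> ('a, 'k) cech_class \<Rightarrow> (bar \<Rightarrow> 'k).
        (\<forall>r. bij_betw (\<phi> r) (cech_H0 (superlevel f r)) (interval_product B r)) \<and>
        (\<forall>r a. \<forall>z\<in>cech_H0 (superlevel f r). \<forall>w\<in>cech_H0 (superlevel f r).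
           \<phi> r (cech_comb a z w) = (\<lambda>\<beta>. a * \<phi> r z \<beta> + \<phi> r w \<beta>)) \<and>
        (\<forall>r s. r \<le> s \<longrightarrow> (\<forall>z\<in>cech_H0 (superlevel f s).
           \<phi> r (cech_incl (superlevel f r) z) = interval_map r (\<phi> s z))))"

text \<open>Barcodes are unique up to relabelling and bars that are single points, so the choice does not
  affect the lengths summed below.\<close>

definition H0_barcode :: "'k::field itself \<Rightarrow> ('a::topological_space \<Rightarrow> real) \<Rightarrow> bar set" where
  "H0_barcode k f = (SOME B. is_H0_barcode k f B)"


section \<open>Persistence index\<close>

definition Pers :: "'k::field itself \<Rightarrow> real \<Rightarrow> ('a::topological_space \<Rightarrow> real) \<Rightarrow> ennreal" where
  "Pers k p f =
     (let S = (\<Sum>\<^sub>\<infinity>\<beta>\<in>H0_barcode k f.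
                 ennreal (measure lborel (fst \<beta> \<inter> {Inf (range f)..Sup (range f)}) powr p))
      in if S = \<infinity> then \<infinity> else ennreal (enn2real S powr (1 / p)))"

text \<open>Because of \<open>p \<ge> 1\<close> the index is at least 1. For constant \<open>f\<close> it equals 1, although the tree of
  \<open>f\<close> is then a single point, of dimension 0.\<close>

definition persistence_index :: "'k::field itself \<Rightarrow> ('a::topological_space \<Rightarrow> real) \<Rightarrow> ereal" where
  "persistence_index k f = Inf {ereal p | p. p \<ge> 1 \<and> Pers k p f < \<infinity>}"


section \<open>Hoelder regularity up to homeomorphism\<close>

definition holder_norm :: "real \<Rightarrow> ('a::metric_space \<Rightarrow> real) \<Rightarrow> ennreal" where
  "holder_norm \<alpha> g =
     (SUP x. ennreal \<bar>g x\<bar>) +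
     (SUP (x, y)\<in>{(x, y). x \<noteq> y}. ennreal (\<bar>g x - g y\<bar> / dist x y powr \<alpha>))"

definition holder_index :: "('a::metric_space \<Rightarrow> real) \<Rightarrow> ereal" where
  "holder_index f =
     Inf {ereal (1 / \<alpha>) | \<alpha>. 0 < \<alpha> \<and> \<alpha> \<le> 1 \<and>
            (\<exists>h h' :: 'a \<Rightarrow> 'a. homeomorphism UNIV UNIV h h' \<and> holder_norm \<alpha> (f \<circ> h) < \<infinity>)}"

end

(* Relatively clopen subsets of K carry all the information of the Cech group H_0(K): it is the
   space of finitely additive field-valued measures on them. For the superlevel sets K_r, write
   m(x, y) for the largest level at which x and y are still connected. Ordering the points by height,
   with ties broken by a well-order, every point x has a largest connected set realm(x) in which it is
   eldest, and the indicator functions of the sets realm(x) Int K_r form a basis of the locally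
   constant functions on K_r. Evaluating measures on them gives the barcode, one bar per point.
   The number of bars containing two given levels is the rank of a structure map, hence the same for
   all barcodes. Counting bars across the cells of a grid of mesh eps compares the number of long bars
   with covering numbers of the tree, which yields the equality. For the inequality, the tree distance
   of x and y is at most twice the oscillation of f along a short arc. *)

theory Submission
  imports Defs "HOL-Library.Function_Algebras" "HOL-Real_Asymp.Real_Asymp"
begin

section \<open>Cech classes as finitely additive measures on clopen sets\<close>

text \<open>A superlevel set can have infinitely many components, so H_0 at a single level may be
  infinite-dimensional. What saves the argument is a gap: a clopen subset of the closed set {f \<ge>
  r} is already a union of classes of {f > s} for some s < r, and only finitely many classes of {f >
  s} reach level r. All computations take place at such a pair s < r, where evaluation on realms is
  a finite triangular system, and the results for different s are compatible. The same gap explains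
  the grid. Counts of bars through two distinct levels are finite and independent of the barcode, so
  bars are never matched one by one; each is counted once per grid cell that it crosses. A bar
  crossing n \<ge> 1 cells of mesh \<epsilon> has n \<le> (length / \<epsilon>) ^ p for p \<ge> 1,
  and a bar of length 3 \<epsilon> crosses at least one cell, so the counts bound sums of p-th
  powers and are bounded by them. The index is at least 1 by definition. So is the dimension of the
  tree when f is not constant, because f is 1-Lipschitz on it with an interval as image.\<close>

definition separated :: "'a set \<Rightarrow> 'a set set \<Rightarrow> 'a set set \<Rightarrow> bool" where
  "separated K \<U> T \<longleftrightarrow> T \<subseteq> \<U> \<and> (\<forall>U\<in>T. \<forall>V\<in>\<U> - T. U \<inter> V \<inter> K = {})"

lemma separated_mem_iff:
  assumes "separated K \<U> T" "U \<in> \<U>" "x \<in> U" "x \<in> K"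
  shows "U \<in> T \<longleftrightarrow> x \<in> \<Union>T \<inter> K"
  using assms unfolding separated_def by blast

text \<open>A separated family is a 0-cocycle: its indicator function is constant along the edges of
  the nerve. So an edge that meets T lies inside T, and the boundary terms cancel in pairs over T x
  T.\<close>

lemma sum_nerve_boundary_separated:
  assumes "finite \<U>" "separated K \<U> T" "e \<in> nerve_chains1 K \<U>"
  shows "(\<Sum>V\<in>T. nerve_boundary \<U> e V) = 0"
proof -
  have T: "T \<subseteq> \<U>" "finite T"
    using assms by (auto simp: separated_def finite_subset)
  have inside: "(\<Sum>U\<in>\<U>. e (U, V) - e (V, U)) = (\<Sum>U\<in>T. e (U, V) - e (V, U))" if "V \<in> T" for V
  proof (rule sum.mono_neutral_right)
    show "\<forall>U\<in>\<U> - T. e (U, V) - e (V, U) = 0"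
    proof
      fix U assume U: "U \<in> \<U> - T"
      have "V \<inter> U \<inter> K = {}" "U \<inter> V \<inter> K = {}"
        using assms(2) U that unfolding separated_def by blast+
      then show "e (U, V) - e (V, U) = 0"
        using assms(3) unfolding nerve_chains1_def mem_Collect_eq by (metis diff_zero)
    qed
  qed (use assms T in auto)
  have "(\<Sum>V\<in>T. nerve_boundary \<U> e V) = (\<Sum>V\<in>T. \<Sum>U\<in>T. e (U, V) - e (V, U))"
    unfolding nerve_boundary_def by (rule sum.cong[OF refl inside])
  also have "\<dots> = (\<Sum>V\<in>T. \<Sum>U\<in>T. e (U, V)) - (\<Sum>V\<in>T. \<Sum>U\<in>T. e (V, U))"
    by (simp add: sum_subtractf)
  also have "(\<Sum>V\<in>T. \<Sum>U\<in>T. e (U, V)) = (\<Sum>V\<in>T. \<Sum>U\<in>T. e (V, U))"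
    by (rule sum.swap)
  finally show ?thesis by simp
qed

definition nerve_rel :: "'a set \<Rightarrow> 'a set set \<Rightarrow> ('a set \<times> 'a set) set" where
  "nerve_rel K \<U> = {(U, V). U \<in> \<U> \<and> V \<in> \<U> \<and> U \<inter> V \<inter> K \<noteq> {}}"

text \<open>A representative of a component of the nerve. The choice depends only on the set of
  vertices reachable from U, which makes it constant on components.\<close>

definition nerve_root :: "'a set \<Rightarrow> 'a set set \<Rightarrow> 'a set \<Rightarrow> 'a set" where
  "nerve_root K \<U> U = (SOME V. (U, V) \<in> (nerve_rel K \<U>)\<^sup>*)"

lemma nerve_root_rel: "(U, nerve_root K \<U> U) \<in> (nerve_rel K \<U>)\<^sup>*"
  unfolding nerve_root_def by (rule someI[of _ U]) simp

lemma nerve_root_cong: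
  assumes "(U, V) \<in> nerve_rel K \<U>"
  shows "nerve_root K \<U> U = nerve_root K \<U> V"
proof -
  have "sym ((nerve_rel K \<U>)\<^sup>*)"
    by (intro sym_rtrancl symI) (auto simp: nerve_rel_def)
  then have "(U, W) \<in> (nerve_rel K \<U>)\<^sup>* \<longleftrightarrow> (V, W) \<in> (nerve_rel K \<U>)\<^sup>*" for W
    using assms by (meson converse_rtrancl_into_rtrancl r_into_rtrancl rtrancl_trans symE)
  then show ?thesis
    unfolding nerve_root_def by simp
qed

lemma separated_root:
  "separated K \<U> {U\<in>\<U>. P (nerve_root K \<U> U)}"
proof -
  have "U \<inter> V \<inter> K = {}"
    if "U \<in> \<U>" "V \<in> \<U>" "P (nerve_root K \<U> U)" "\<not> P (nerve_root K \<U> V)" for U V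
  proof (rule ccontr)
    assume "U \<inter> V \<inter> K \<noteq> {}"
    then have "(U, V) \<in> nerve_rel K \<U>"
      using that by (simp add: nerve_rel_def)
    then show False
      using nerve_root_cong that by metis
  qed
  then show ?thesis
    unfolding separated_def by blast
qed

lemma separated_rtrancl:
  assumes "separated K \<U> T" "(U, V) \<in> (nerve_rel K \<U>)\<^sup>*" "U \<in> T"
  shows "V \<in> T"
  using assms(2,3)
proof (induction rule: rtrancl_induct)
  case (step V W)
  then show ?case
    using assms(1) unfolding separated_def nerve_rel_def by blast
qed auto

lemma separated_root_iff:
  assumes "separated K \<U> T" "U \<in> \<U>"
  shows "nerve_root K \<U> U \<in> T \<longleftrightarrow> U \<in> T"
proof
  have "sym ((nerve_rel K \<U>)\<^sup>*)"
    by (intro sym_rtrancl symI) (auto simp: nerve_rel_def)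
  then have "(nerve_root K \<U> U, U) \<in> (nerve_rel K \<U>)\<^sup>*"
    using nerve_root_rel by (meson symE)
  then show "nerve_root K \<U> U \<in> T \<Longrightarrow> U \<in> T"
    using separated_rtrancl[OF assms(1)] by blast
  show "U \<in> T \<Longrightarrow> nerve_root K \<U> U \<in> T"
    using separated_rtrancl[OF assms(1) nerve_root_rel] by blast
qed

lemma nerve_boundary_path:
  assumes "(U, V) \<in> (nerve_rel K \<U>)\<^sup>*" "finite \<U>"
  shows "\<exists>e\<in>nerve_chains1 K \<U>. \<forall>W. nerve_boundary \<U> e W =
           (if W = U then 1 else 0) - (if W = V then (1::'k::field) else 0)"
  using assms(1)
proof (induction rule: rtrancl_induct)
  case base
  show ?case
    by (rule bexI[of _ "\<lambda>_. 0"]) (auto simp: nerve_chains1_def nerve_boundary_def)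
next
  case (step V W)
  then obtain e where e: "e \<in> nerve_chains1 K \<U>"
    "\<And>Z. nerve_boundary \<U> e Z = (if Z = U then 1 else 0) - (if Z = V then (1::'k) else 0)"
    by blast
  have VW: "V \<in> \<U>" "W \<in> \<U>" "V \<inter> W \<inter> K \<noteq> {}" "W \<inter> V \<inter> K \<noteq> {}"
    using step(2) by (auto simp: nerve_rel_def)
  \<comment> \<open>The edge (W, V) has boundary V - W, which turns U - V into U - W.\<close>
  define e' where "e' = (\<lambda>p. e p + (if p = (W, V) then 1 else 0))"
  have "e' \<in> nerve_chains1 K \<U>"
    using e(1) VW by (auto simp: nerve_chains1_def e'_def split: if_splits)
  moreover have "nerve_boundary \<U> e' Z = (if Z = U then 1 else 0) - (if Z = W then (1::'k) else 0)" for Z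
  proof -
    have "nerve_boundary \<U> e' Z = nerve_boundary \<U> e Z +
        (\<Sum>U\<in>\<U>. (if U = W then if Z = V then 1 else 0 else 0)) -
        (\<Sum>U\<in>\<U>. (if U = V then if Z = W then 1 else 0 else 0))"
      unfolding nerve_boundary_def e'_def sum.distrib[symmetric] sum_subtractf[symmetric]
      by (intro sum.cong) auto
    then show ?thesis
      using VW assms(2) by (simp add: e(2))
  qed
  ultimately show ?case by blast
qed

text \<open>The coefficient of every U is moved along a path to the root of its component, so the
  difference of two chains is a boundary as soon as its total over each component vanishes. From
  here on classes are compared by such totals, without edges.\<close>

lemma nerve_homologous_iff:
  assumes "finite \<U>"
  shows "(c, c') \<in> nerve_homologous K \<U> \<longleftrightarrow>
    c \<in> nerve_chains0 K \<U> \<and> c' \<in> nerve_chains0 K \<U> \<and>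
    (\<forall>T. separated K \<U> T \<longrightarrow> sum c T = sum (c' :: _ \<Rightarrow> 'k::field) T)" (is "?L \<longleftrightarrow> ?R")
proof
  assume ?L
  then obtain e where e: "c \<in> nerve_chains0 K \<U>" "c' \<in> nerve_chains0 K \<U>"
    "e \<in> nerve_chains1 K \<U>" "\<And>U. c' U = c U + nerve_boundary \<U> e U"
    by (auto simp: nerve_homologous_def)
  then show ?R
    using sum_nerve_boundary_separated[OF assms _ e(3)] by (auto simp: sum.distrib)
next
  assume R: ?R
  let ?\<rho> = "nerve_root K \<U>"
  define d where "d U = c' U - c U" for U
  have "\<forall>U. \<exists>e. e \<in> nerve_chains1 K \<U> \<and> (\<forall>W. nerve_boundary \<U> e W =
           (if W = U then 1 else 0) - (if W = ?\<rho> U then (1::'k::field) else 0))"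
    using nerve_boundary_path[OF nerve_root_rel assms] by blast
  then obtain E where E: "\<And>U. E U \<in> nerve_chains1 K \<U>"
    "\<And>U W. nerve_boundary \<U> (E U) W =
           (if W = U then 1 else 0) - (if W = ?\<rho> U then (1::'k::field) else 0)"
    by metis
  define e where "e p = (\<Sum>U\<in>\<U>. d U * E U p)" for p
  have "e \<in> nerve_chains1 K \<U>"
    unfolding nerve_chains1_def mem_Collect_eq
  proof (intro allI impI)
    fix A B assume "e (A, B) \<noteq> 0"
    then obtain U where "E U (A, B) \<noteq> 0"
      unfolding e_def by (metis (no_types, lifting) mult_zero_right sum.neutral)
    then show "A \<in> \<U> \<and> B \<in> \<U> \<and> A \<inter> B \<inter> K \<noteq> {}"
      using E(1)[of U] by (auto simp: nerve_chains1_def)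
  qed
  moreover have "c' W = c W + nerve_boundary \<U> e W" for W
  proof -
    have "nerve_boundary \<U> e W = (\<Sum>V\<in>\<U>. \<Sum>U\<in>\<U>. d U * (E U (V, W) - E U (W, V)))"
      unfolding nerve_boundary_def e_def by (simp add: sum_subtractf right_diff_distrib)
    also have "\<dots> = (\<Sum>U\<in>\<U>. d U * nerve_boundary \<U> (E U) W)"
      unfolding nerve_boundary_def by (subst sum.swap) (simp add: sum_distrib_left)
    also have "\<dots> = (\<Sum>U\<in>\<U>. (if U = W then d U else 0) - (if ?\<rho> U = W then d U else 0))"
      by (intro sum.cong) (auto simp: E)
    also have "\<dots> = (if W \<in> \<U> then d W else 0) - (\<Sum>U\<in>\<U>. if ?\<rho> U = W then d U else 0)"
      using assms by (simp add: sum_subtractf)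
    also have "(\<Sum>U\<in>\<U>. if ?\<rho> U = W then d U else 0) = (\<Sum>U\<in>{U\<in>\<U>. ?\<rho> U = W}. d U)"
      using assms by (simp add: sum.inter_filter)
    also have "\<dots> = 0"
      using R separated_root[of K \<U> "\<lambda>V. V = W"] by (simp add: d_def sum_subtractf)
    also have "(if W \<in> \<U> then d W else 0) = d W"
    proof (cases "W \<in> \<U>")
      case False
      then have "c W = 0" "c' W = 0" using R unfolding nerve_chains0_def by blast+
      then show ?thesis by (simp add: d_def)
    qed simp
    finally show ?thesis by (simp add: d_def)
  qed
  ultimately show ?L
    using R by (auto simp: nerve_homologous_def)
qed

lemma nerve_H0_class:
  assumes "finite \<U>" "Z \<in> nerve_H0 K \<U>"
  obtains c where "c \<in> nerve_chains0 K \<U>" "c \<in> Z"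
    "Z = {c'\<in>nerve_chains0 K \<U>. \<forall>T. separated K \<U> T \<longrightarrow> sum c' T = sum c T}"
proof -
  obtain c where c: "c \<in> nerve_chains0 K \<U>" "Z = nerve_homologous K \<U> `` {c}"
    using assms(2) by (auto simp: nerve_H0_def quotient_def)
  show ?thesis
    by (rule that[OF c(1)]) (use c in \<open>auto simp: nerve_homologous_iff[OF assms(1)]\<close>)
qed

lemma nerve_H0_I:
  assumes "finite \<U>" "c \<in> nerve_chains0 K \<U>"
    "Z = {c'\<in>nerve_chains0 K \<U>. \<forall>T. separated K \<U> T \<longrightarrow> sum c' T = sum c T}"
  shows "Z \<in> nerve_H0 K \<U>"
proof -
  have "Z = nerve_homologous K \<U> `` {c}"
    using assms by (auto simp: nerve_homologous_iff[OF assms(1)])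
  then show ?thesis
    using assms(2) by (auto simp: nerve_H0_def quotient_def)
qed

section \<open>Relatively clopen sets and additive functions on them\<close>

definition rel_clopen :: "'a::topological_space set \<Rightarrow> 'a set set" where
  "rel_clopen K = {G. \<exists>U V. open U \<and> open V \<and> G = U \<inter> K \<and> K - G = V \<inter> K}"

text \<open>The value 0 off the clopen sets makes each measure a unique function, so that it can
  correspond bijectively to a Cech class.\<close>

definition clopen_measures :: "'a::topological_space set \<Rightarrow> ('a set \<Rightarrow> 'k::field) set" where
  "clopen_measures K = {\<mu>. (\<forall>G. G \<notin> rel_clopen K \<longrightarrow> \<mu> G = 0) \<and>
     (\<forall>G\<in>rel_clopen K. \<forall>H\<in>rel_clopen K. G \<inter> H = {} \<longrightarrow> \<mu> (G \<union> H) = \<mu> G + \<mu> H)}"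

lemma rel_clopen_empty: "{} \<in> rel_clopen K"
  unfolding rel_clopen_def mem_Collect_eq by (intro exI[of _ "{}"] exI[of _ UNIV]) auto

lemma rel_clopen_Un:
  assumes "G \<in> rel_clopen K" "H \<in> rel_clopen K"
  shows "G \<union> H \<in> rel_clopen K"
proof -
  obtain U V U' V' where "open U" "open V" "G = U \<inter> K" "K - G = V \<inter> K"
    "open U'" "open V'" "H = U' \<inter> K" "K - H = V' \<inter> K"
    using assms by (auto simp: rel_clopen_def)
  then show ?thesis
    unfolding rel_clopen_def mem_Collect_eq
    by (intro exI[of _ "U \<union> U'"] exI[of _ "V \<inter> V'"]) auto
qed

lemma rel_clopen_UN:
  assumes "finite J" "\<And>j. j \<in> J \<Longrightarrow> G j \<in> rel_clopen K"
  shows "(\<Union>j\<in>J. G j) \<in> rel_clopen K"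
  using assms by (induction J) (auto simp: rel_clopen_empty rel_clopen_Un)

lemma rel_clopen_Int_subset:
  assumes "G \<in> rel_clopen L" "K \<subseteq> L"
  shows "G \<inter> K \<in> rel_clopen K"
proof -
  obtain U V where "open U" "open V" "G = U \<inter> L" "L - G = V \<inter> L"
    using assms by (auto simp: rel_clopen_def)
  then show ?thesis
    unfolding rel_clopen_def mem_Collect_eq using assms(2)
    by (intro exI[of _ U] exI[of _ V]) auto
qed

lemma clopen_measure_empty: "\<mu> \<in> clopen_measures K \<Longrightarrow> \<mu> {} = 0"
  using rel_clopen_empty[of K] unfolding clopen_measures_def by fastforce

lemma clopen_measure_UN:
  assumes "\<mu> \<in> clopen_measures K" "finite J" "\<And>j. j \<in> J \<Longrightarrow> G j \<in> rel_clopen K"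
    and "\<And>i j. i \<in> J \<Longrightarrow> j \<in> J \<Longrightarrow> i \<noteq> j \<Longrightarrow> G i \<inter> G j = {}"
  shows "\<mu> (\<Union>j\<in>J. G j) = (\<Sum>j\<in>J. \<mu> (G j))"
  using assms(2-)
proof (induction J)
  case empty
  then show ?case using clopen_measure_empty[OF assms(1)] by simp
next
  case (insert i J)
  have "\<mu> (G i \<union> (\<Union>j\<in>J. G j)) = \<mu> (G i) + \<mu> (\<Union>j\<in>J. G j)"
  proof -
    have "G i \<in> rel_clopen K" "(\<Union>j\<in>J. G j) \<in> rel_clopen K"
      using insert rel_clopen_UN[OF insert(1), of G K] by auto
    moreover have "G i \<inter> (\<Union>j\<in>J. G j) = {}"
    proof -
      have "G i \<inter> G j = {}" if "j \<in> J" for j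
        using insert(5)[of i j] insert(2) that by auto
      then show ?thesis by blast
    qed
    ultimately show ?thesis
      using assms(1) unfolding clopen_measures_def by simp
  qed
  then show ?case
    using insert by simp
qed

text \<open>T and the rest of the cover trace out complementary open sets. Together with
  \<open>rel_clopen_separated\<close>, separated families over all covers realise exactly the clopen
  sets.\<close>

lemma separated_rel_clopen:
  assumes "\<U> \<in> open_covers K" "separated K \<U> T"
  shows "\<Union>T \<inter> K \<in> rel_clopen K"
proof -
  have "open (\<Union>T)" "open (\<Union>(\<U> - T))"
    using assms unfolding open_covers_def separated_def by (auto intro!: open_Union)
  moreover have "K - (\<Union>T \<inter> K) = \<Union>(\<U> - T) \<inter> K"
    using assms unfolding open_covers_def separated_def by blast
  ultimately show ?thesis
    unfolding rel_clopen_def by blast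
qed

lemma rel_clopen_separated:
  assumes "G \<in> rel_clopen K"
  obtains \<U> T where "\<U> \<in> open_covers K" "separated K \<U> T" "\<Union>T \<inter> K = G"
proof -
  obtain U V where UV: "open U" "open V" "G = U \<inter> K" "K - G = V \<inter> K"
    using assms by (auto simp: rel_clopen_def)
  show ?thesis
    by (rule that[of "{U, V}" "{U}"]) (use UV in \<open>auto simp: open_covers_def separated_def\<close>)
qed

section \<open>The correspondence between Cech classes and measures\<close>

definition cech_of :: "'a::topological_space set \<Rightarrow> ('a set \<Rightarrow> 'k::field) \<Rightarrow> ('a, 'k) cech_class" where
  "cech_of K \<mu> \<U> = (if \<U> \<in> open_covers K
     then {c\<in>nerve_chains0 K \<U>. \<forall>T. separated K \<U> T \<longrightarrow> sum c T = \<mu> (\<Union>T \<inter> K)} else {})"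

text \<open>The whole measure of a component of the nerve is placed on its root. A vertex that is
  not a root has an empty family \<open>cl V\<close> and hence coefficient 0.\<close>

lemma cech_of_witness:
  fixes \<mu> :: "'a::topological_space set \<Rightarrow> 'k::field"
  assumes "\<mu> \<in> clopen_measures K" "\<U> \<in> open_covers K"
  shows "\<exists>c. c \<in> cech_of K \<mu> \<U>"
proof -
  let ?\<rho> = "nerve_root K \<U>"
  have fin: "finite \<U>" using assms by (auto simp: open_covers_def)
  define cl :: "'a set \<Rightarrow> 'a set set" where "cl V = {U\<in>\<U>. ?\<rho> U = V}" for V
  have sep: "separated K \<U> (cl V)" for V :: "'a set"
    unfolding cl_def by (rule separated_root)
  \<comment> \<open>The last factor enforces membership in \<open>nerve_chains0\<close> and loses
    nothing: a member missing K has no neighbours in the nerve, so the family with this root covers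
    no point of K.\<close>
  define c where "c V = \<mu> (\<Union>(cl V) \<inter> K) * (if V \<in> \<U> \<and> V \<inter> K \<noteq> {} then 1 else 0)" for V
  have "c \<in> nerve_chains0 K \<U>"
    unfolding c_def nerve_chains0_def by (auto split: if_splits)
  moreover have "sum c T = \<mu> (\<Union>T \<inter> K)" if T: "separated K \<U> T" for T :: "'a set set"
  proof -
    have fT: "finite T" "T \<subseteq> \<U>" using T fin by (auto simp: separated_def finite_subset)
    have "\<Union>T \<inter> K = (\<Union>V\<in>T. \<Union>(cl V) \<inter> K)"
      using separated_root_iff[OF T] fT unfolding cl_def by blast
    also have "\<mu> \<dots> = (\<Sum>V\<in>T. \<mu> (\<Union>(cl V) \<inter> K))"
    proof (rule clopen_measure_UN[OF assms(1) fT(1)])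
      fix V V' :: "'a set" assume "V \<noteq> V'"
      then have "cl V \<inter> cl V' = {}" by (auto simp: cl_def)
      then show "\<Union>(cl V) \<inter> K \<inter> (\<Union>(cl V') \<inter> K) = {}"
        using sep[of V] unfolding separated_def cl_def by blast
    qed (rule separated_rel_clopen[OF assms(2) sep])
    also have "\<dots> = sum c T"
    proof (rule sum.cong)
      fix V assume V: "V \<in> T"
      show "\<mu> (\<Union>(cl V) \<inter> K) = c V"
      proof (cases "V \<inter> K = {}")
        case True
        have "U \<inter> K = {}" if U: "U \<in> cl V" for U
        proof -
          have "(U, V) \<in> (nerve_rel K \<U>)\<^sup>*"
            using U nerve_root_rel[of U K \<U>] by (auto simp: cl_def)
          then show ?thesis
            using True by (cases rule: rtranclE) (auto simp: nerve_rel_def)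
        qed
        then have "\<Union>(cl V) \<inter> K = {}" by blast
        then show ?thesis
          using clopen_measure_empty[OF assms(1)] by (simp add: c_def)
      qed (use V fT in \<open>auto simp: c_def\<close>)
    qed simp
    finally show ?thesis by simp
  qed
  ultimately show ?thesis
    using assms(2) by (auto simp: cech_of_def)
qed

lemma cech_of_class:
  assumes "c \<in> cech_of K \<mu> \<U>"
  shows "cech_of K \<mu> \<U> = {c'\<in>nerve_chains0 K \<U>. \<forall>T. separated K \<U> T \<longrightarrow> sum c' T = sum c T}"
  using assms unfolding cech_of_def by (auto split: if_splits)

lemma sum_push_chain:
  assumes "finite \<V>" "finite T"
  shows "sum (push_chain \<V> p c) T = sum c {V\<in>\<V>. p V \<in> T}"
proof -
  have "sum c {V\<in>\<V>. p V \<in> T} = (\<Sum>U\<in>T. sum c {V\<in>{V\<in>\<V>. p V \<in> T}. p V = U})"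
    by (rule sum.group[symmetric]) (use assms in auto)
  also have "\<dots> = sum (push_chain \<V> p c) T"
    unfolding push_chain_def by (intro sum.cong arg_cong2[where f=sum]) auto
  finally show ?thesis by simp
qed

lemma push_chain_chains0:
  assumes "refinement_map K \<V> \<U> p" "c \<in> nerve_chains0 K \<V>"
  shows "push_chain \<V> p c \<in> nerve_chains0 K \<U>"
  unfolding nerve_chains0_def mem_Collect_eq
proof (intro allI impI)
  fix U assume "push_chain \<V> p c U \<noteq> 0"
  then obtain V where "V \<in> \<V>" "p V = U" "c V \<noteq> 0"
    unfolding push_chain_def by (metis (mono_tags, lifting) mem_Collect_eq sum.neutral)
  then show "U \<in> \<U> \<and> U \<inter> K \<noteq> {}"
    using assms unfolding refinement_map_def nerve_chains0_def by blast
qed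

text \<open>Members of \<V> that miss K are left out of the preimage because a refinement map is
  unconstrained on them. Every point of K lies in a member that is kept, so the covered clopen set
  does not change.\<close>

lemma separated_pullback:
  assumes "refinement_map K \<V> \<U> p" "separated K \<U> T" "\<V> \<in> open_covers K"
  defines "T' \<equiv> {V\<in>\<V>. V \<inter> K \<noteq> {} \<and> p V \<in> T}"
  shows "separated K \<V> T'" "\<Union>T' \<inter> K = \<Union>T \<inter> K"
proof -
  show "separated K \<V> T'"
    using assms(1,2) unfolding separated_def refinement_map_def T'_def by blast
  show "\<Union>T' \<inter> K = \<Union>T \<inter> K"
  proof
    show "\<Union>T' \<inter> K \<subseteq> \<Union>T \<inter> K"
      using assms(1) unfolding T'_def refinement_map_def by blast
    show "\<Union>T \<inter> K \<subseteq> \<Union>T' \<inter> K"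
    proof
      fix x assume x: "x \<in> \<Union>T \<inter> K"
      then obtain V where V: "V \<in> \<V>" "x \<in> V" "x \<in> K"
        using assms(3) by (auto simp: open_covers_def)
      then have "p V \<in> \<U>" "x \<in> p V"
        using assms(1) by (auto simp: refinement_map_def)
      moreover obtain U where "U \<in> T" "x \<in> U" using x by blast
      ultimately have "p V \<in> T"
        using assms(2) V unfolding separated_def by blast
      then show "x \<in> \<Union>T' \<inter> K"
        using V by (auto simp: T'_def)
    qed
  qed
qed

lemma sum_push_chain_separated:
  assumes "refinement_map K \<V> \<U> p" "separated K \<U> T" "\<V> \<in> open_covers K" "\<U> \<in> open_covers K"
    "c \<in> nerve_chains0 K \<V>"
  shows "sum (push_chain \<V> p c) T = sum c {V\<in>\<V>. V \<inter> K \<noteq> {} \<and> p V \<in> T}"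
proof -
  have "finite \<V>" "finite T"
    using assms by (auto simp: open_covers_def separated_def finite_subset)
  then show ?thesis
    unfolding sum_push_chain[OF \<open>finite \<V>\<close> \<open>finite T\<close>]
    by (intro sum.mono_neutral_right) (use assms(5) in \<open>auto simp: nerve_chains0_def\<close>)
qed

lemma cech_of_cech_H0:
  assumes "\<mu> \<in> clopen_measures K"
  shows "cech_of K \<mu> \<in> cech_H0 K"
  unfolding cech_H0_def mem_Collect_eq
proof (intro conjI ballI allI impI)
  fix \<U> assume \<U>: "\<U> \<in> open_covers K"
  then obtain c where c: "c \<in> cech_of K \<mu> \<U>"
    using cech_of_witness[OF assms] by blast
  show "cech_of K \<mu> \<U> \<in> nerve_H0 K \<U>"
    by (rule nerve_H0_I[OF _ _ cech_of_class[OF c]])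
       (use c \<U> in \<open>auto simp: cech_of_def open_covers_def\<close>)
next
  fix \<U> \<V> p assume *: "\<U> \<in> open_covers K" "\<V> \<in> open_covers K" "refinement_map K \<V> \<U> p"
  show "push_chain \<V> p ` cech_of K \<mu> \<V> \<subseteq> cech_of K \<mu> \<U>"
  proof
    fix d assume "d \<in> push_chain \<V> p ` cech_of K \<mu> \<V>"
    then obtain c where c: "c \<in> nerve_chains0 K \<V>"
      "\<And>T. separated K \<V> T \<Longrightarrow> sum c T = \<mu> (\<Union>T \<inter> K)" "d = push_chain \<V> p c"
      using * by (auto simp: cech_of_def)
    have "sum d T = \<mu> (\<Union>T \<inter> K)" if "separated K \<U> T" for T
      unfolding c(3) sum_push_chain_separated[OF *(3) that *(2,1) c(1)]
      using c(2)[OF separated_pullback(1)[OF *(3) that *(2)]] separated_pullback(2)[OF *(3) that *(2)]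
      by simp
    moreover have "d \<in> nerve_chains0 K \<U>"
      unfolding c(3) by (rule push_chain_chains0[OF *(3) c(1)])
    ultimately show "d \<in> cech_of K \<mu> \<U>"
      using * by (auto simp: cech_of_def)
  qed
qed (auto simp: cech_of_def)

text \<open>Kept as a relation because cover, family and chain are all chosen; independence of these
  choices is \<open>cech_value_unique\<close>.\<close>

definition cech_value :: "'a::topological_space set \<Rightarrow> ('a, 'k::field) cech_class \<Rightarrow> 'a set \<Rightarrow> 'k \<Rightarrow> bool" where
  "cech_value K z G a \<longleftrightarrow> (\<exists>\<U>\<in>open_covers K. \<exists>T. separated K \<U> T \<and> \<Union>T \<inter> K = G \<and> (\<exists>c\<in>z \<U>. a = sum c T))"

definition cech_measure :: "'a::topological_space set \<Rightarrow> ('a, 'k::field) cech_class \<Rightarrow> 'a set \<Rightarrow> 'k" where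
  "cech_measure K z G = (if G \<in> rel_clopen K then THE a. cech_value K z G a else 0)"

lemma cech_H0_class:
  assumes "z \<in> cech_H0 K" "\<U> \<in> open_covers K"
  obtains c where "c \<in> nerve_chains0 K \<U>" "c \<in> z \<U>"
    "z \<U> = {c'\<in>nerve_chains0 K \<U>. \<forall>T. separated K \<U> T \<longrightarrow> sum c' T = sum c T}"
  by (rule nerve_H0_class[of \<U> "z \<U>" K]) (use assms in \<open>auto simp: cech_H0_def open_covers_def\<close>)

lemma cech_H0_sum_eq:
  assumes "z \<in> cech_H0 K" "\<U> \<in> open_covers K" "c \<in> z \<U>" "c' \<in> z \<U>" "separated K \<U> T"
  shows "sum c T = sum c' T"
proof -
  obtain d where "z \<U> = {c'\<in>nerve_chains0 K \<U>. \<forall>T. separated K \<U> T \<longrightarrow> sum c' T = sum d T}"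
    using cech_H0_class[OF assms(1,2)] .
  then show ?thesis
    using assms(3-5) by auto
qed

text \<open>Two covers are compared through their common refinement by pairwise intersections.\<close>

lemma cech_value_unique:
  assumes z: "z \<in> cech_H0 K" and a: "cech_value K z G a" and b: "cech_value K z G b"
  shows "a = b"
proof -
  obtain \<U> T c where U: "\<U> \<in> open_covers K" "separated K \<U> T" "\<Union>T \<inter> K = G" "c \<in> z \<U>" "a = sum c T"
    using a unfolding cech_value_def by blast
  obtain \<U>' T' c' where U': "\<U>' \<in> open_covers K" "separated K \<U>' T'" "\<Union>T' \<inter> K = G" "c' \<in> z \<U>'" "b = sum c' T'"
    using b unfolding cech_value_def by blast
  define \<W> where "\<W> = (\<lambda>(U, V). U \<inter> V) ` (\<U> \<times> \<U>')"
  have W: "\<W> \<in> open_covers K"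
  proof -
    have "K \<subseteq> \<Union>\<W>"
    proof
      fix x assume "x \<in> K"
      moreover have "K \<subseteq> \<Union>\<U>" "K \<subseteq> \<Union>\<U>'"
        using U(1) U'(1) by (auto simp: open_covers_def)
      ultimately obtain U V where "U \<in> \<U>" "x \<in> U" "V \<in> \<U>'" "x \<in> V"
        by blast
      then show "x \<in> \<Union>\<W>" unfolding \<W>_def by blast
    qed
    moreover have "finite \<W>" using U U' by (auto simp: \<W>_def open_covers_def)
    moreover have "open W" if "W \<in> \<W>" for W
      using that U(1) U'(1) unfolding \<W>_def open_covers_def by auto
    ultimately show ?thesis by (auto simp: open_covers_def)
  qed
  have "\<forall>W. \<exists>U V. W \<in> \<W> \<longrightarrow> U \<in> \<U> \<and> V \<in> \<U>' \<and> W \<subseteq> U \<and> W \<subseteq> V"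
    unfolding \<W>_def by blast
  then obtain p q where pq: "\<And>W. W \<in> \<W> \<Longrightarrow> p W \<in> \<U> \<and> q W \<in> \<U>' \<and> W \<subseteq> p W \<and> W \<subseteq> q W"
    by metis
  have p: "refinement_map K \<W> \<U> p" and q: "refinement_map K \<W> \<U>' q"
    using pq unfolding refinement_map_def by blast+
  obtain d where d: "d \<in> nerve_chains0 K \<W>" "d \<in> z \<W>"
    using cech_H0_class[OF z W] by blast
  have pd: "push_chain \<W> p d \<in> z \<U>" and qd: "push_chain \<W> q d \<in> z \<U>'"
  proof -
    have "push_chain \<W> p ` z \<W> \<subseteq> z \<U>" "push_chain \<W> q ` z \<W> \<subseteq> z \<U>'"
      using z p q U(1) U'(1) W unfolding cech_H0_def by simp_all
    then show "push_chain \<W> p d \<in> z \<U>" "push_chain \<W> q d \<in> z \<U>'"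
      using d(2) by auto
  qed
  have "a = sum (push_chain \<W> p d) T"
    using cech_H0_sum_eq[OF z U(1,4) pd U(2)] U(5) by simp
  also have "\<dots> = sum d {V\<in>\<W>. V \<inter> K \<noteq> {} \<and> p V \<in> T}"
    by (rule sum_push_chain_separated[OF p U(2) W U(1) d(1)])
  \<comment> \<open>Both families consist of the members of \<W> with nonempty trace inside G: a
    single point of the trace decides on either side.\<close>
  also have "{V\<in>\<W>. V \<inter> K \<noteq> {} \<and> p V \<in> T} = {V\<in>\<W>. V \<inter> K \<noteq> {} \<and> q V \<in> T'}"
  proof -
    have "p V \<in> T \<longleftrightarrow> q V \<in> T'" if V: "V \<in> \<W>" "V \<inter> K \<noteq> {}" for V
    proof -
      obtain x where x: "x \<in> V" "x \<in> K" using V by blast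
      then have "x \<in> p V" "x \<in> q V" "p V \<in> \<U>" "q V \<in> \<U>'" using pq V by blast+
      then have "p V \<in> T \<longleftrightarrow> x \<in> G" "q V \<in> T' \<longleftrightarrow> x \<in> G"
        using separated_mem_iff[OF U(2), of "p V" x] separated_mem_iff[OF U'(2), of "q V" x] U(3) U'(3) x
        by simp_all
      then show ?thesis by blast
    qed
    then show ?thesis by blast
  qed
  also have "sum d \<dots> = sum (push_chain \<W> q d) T'"
    by (rule sum_push_chain_separated[OF q U'(2) W U'(1) d(1), symmetric])
  also have "\<dots> = b"
    using cech_H0_sum_eq[OF z U'(1) qd U'(4,2)] U'(5) by simp
  finally show ?thesis .
qed

lemma cech_measure_eq:
  assumes "z \<in> cech_H0 K" "\<U> \<in> open_covers K" "separated K \<U> T" "c \<in> z \<U>"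
  shows "cech_measure K z (\<Union>T \<inter> K) = sum c T"
proof -
  have "cech_value K z (\<Union>T \<inter> K) (sum c T)"
    unfolding cech_value_def using assms by blast
  then have "(THE a. cech_value K z (\<Union>T \<inter> K) a) = sum c T"
    using cech_value_unique[OF assms(1)] by blast
  then show ?thesis
    using separated_rel_clopen[OF assms(2,3)] by (simp add: cech_measure_def)
qed

lemma cech_of_cech_measure:
  assumes "z \<in> cech_H0 K"
  shows "cech_of K (cech_measure K z) = z"
proof
  fix \<U>
  show "cech_of K (cech_measure K z) \<U> = z \<U>"
  proof (cases "\<U> \<in> open_covers K")
    case True
    obtain c where c: "c \<in> nerve_chains0 K \<U>" "c \<in> z \<U>"
      "z \<U> = {c'\<in>nerve_chains0 K \<U>. \<forall>T. separated K \<U> T \<longrightarrow> sum c' T = sum c T}"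
      using cech_H0_class[OF assms True] .
    have "cech_measure K z (\<Union>T \<inter> K) = sum c T" if "separated K \<U> T" for T
      by (rule cech_measure_eq[OF assms True that c(2)])
    then show ?thesis
      using True c by (auto simp: cech_of_def)
  next
    case False
    then show ?thesis
      using assms by (auto simp: cech_of_def cech_H0_def)
  qed
qed

lemma cech_measure_clopen_measures:
  assumes "z \<in> cech_H0 K"
  shows "cech_measure K z \<in> clopen_measures K"
  unfolding clopen_measures_def mem_Collect_eq
proof (intro conjI allI impI ballI)
  fix G H assume GH: "G \<in> rel_clopen K" "H \<in> rel_clopen K" "G \<inter> H = {}"
  obtain U V where UV: "open U" "open V" "G = U \<inter> K" "K - G = V \<inter> K"
    using GH by (auto simp: rel_clopen_def)
  obtain U' V' where UV': "open U'" "open V'" "H = U' \<inter> K" "K - H = V' \<inter> K"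
    using GH by (auto simp: rel_clopen_def)
  \<comment> \<open>One cover adapted to G, H and the rest of K at once, so that all three values
    are sums of the same chain.\<close>
  define A B C where "A = U \<inter> V'" and "B = U' \<inter> V" and "C = V \<inter> V'"
  have ABC: "A \<inter> K = G" "B \<inter> K = H" "C \<inter> K = K - (G \<union> H)"
    using UV UV' GH unfolding A_def B_def C_def by blast+
  have \<U>: "{A, B, C} \<in> open_covers K"
    using UV UV' ABC GH unfolding open_covers_def by (auto simp: A_def B_def C_def)
  obtain c where c: "c \<in> nerve_chains0 K {A, B, C}" "c \<in> z {A, B, C}"
    using cech_H0_class[OF assms \<U>] by blast
  have atom: "W \<inter> K \<subseteq> J \<or> W \<inter> K \<inter> J = {}"
    if "J = G \<or> J = H \<or> J = G \<union> H" "W \<in> {A, B, C}" for J W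
    using that(2)
  proof (elim insertE)
    show "W = A \<Longrightarrow> ?thesis" "W = B \<Longrightarrow> ?thesis" "W = C \<Longrightarrow> ?thesis"
      using ABC GH(3) that(1) by auto
  qed simp
  \<comment> \<open>Members are selected by their nonempty trace rather than by name: sets with
    empty trace may coincide, and the families for G and H must be disjoint.\<close>
  have sep: "separated K {A, B, C} {W\<in>{A, B, C}. W \<inter> K \<noteq> {} \<and> W \<inter> K \<subseteq> J}"
    if J: "J = G \<or> J = H \<or> J = G \<union> H" for J
    unfolding separated_def
  proof (intro conjI ballI)
    fix U V assume U: "U \<in> {W\<in>{A, B, C}. W \<inter> K \<noteq> {} \<and> W \<inter> K \<subseteq> J}"
      and V: "V \<in> {A, B, C} - {W\<in>{A, B, C}. W \<inter> K \<noteq> {} \<and> W \<inter> K \<subseteq> J}"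
    then have "V \<inter> K = {} \<or> V \<inter> K \<inter> J = {}"
      using atom[OF J, of V] by blast
    then show "U \<inter> V \<inter> K = {}"
      using U by blast
  qed blast
  have un: "\<Union>{W\<in>{A, B, C}. W \<inter> K \<noteq> {} \<and> W \<inter> K \<subseteq> J} \<inter> K = J"
    if J: "J = G \<or> J = H \<or> J = G \<union> H" for J
  proof (intro equalityI subsetI)
    fix x assume x: "x \<in> J"
    have "x \<in> A \<inter> K \<or> x \<in> B \<inter> K"
      using x J ABC(1,2) by blast
    then obtain W where "W \<in> {A, B, C}" "x \<in> W \<inter> K" by blast
    then show "x \<in> \<Union>{W\<in>{A, B, C}. W \<inter> K \<noteq> {} \<and> W \<inter> K \<subseteq> J} \<inter> K"
      using atom[OF J, of W] x by blast
  qed blast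
  have m: "cech_measure K z J = sum c {W\<in>{A, B, C}. W \<inter> K \<noteq> {} \<and> W \<inter> K \<subseteq> J}"
    if "J = G \<or> J = H \<or> J = G \<union> H" for J
    using cech_measure_eq[OF assms \<U> sep[OF that] c(2)] un[OF that] by simp
  have "{W\<in>{A, B, C}. W \<inter> K \<noteq> {} \<and> W \<inter> K \<subseteq> G \<union> H} =
      {W\<in>{A, B, C}. W \<inter> K \<noteq> {} \<and> W \<inter> K \<subseteq> G} \<union> {W\<in>{A, B, C}. W \<inter> K \<noteq> {} \<and> W \<inter> K \<subseteq> H}"
  proof -
    have "W \<inter> K \<noteq> {} \<and> W \<inter> K \<subseteq> G \<union> H \<longleftrightarrow> W \<inter> K \<noteq> {} \<and> W \<inter> K \<subseteq> G \<or> W \<inter> K \<noteq> {} \<and> W \<inter> K \<subseteq> H"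
      if "W \<in> {A, B, C}" for W
      using atom[of G W] atom[of H W] that by blast
    then show ?thesis by blast
  qed
  moreover have "{W\<in>{A, B, C}. W \<inter> K \<noteq> {} \<and> W \<inter> K \<subseteq> G} \<inter> {W\<in>{A, B, C}. W \<inter> K \<noteq> {} \<and> W \<inter> K \<subseteq> H} = {}"
    using GH(3) by blast
  ultimately show "cech_measure K z (G \<union> H) = cech_measure K z G + cech_measure K z H"
    using m[of G] m[of H] m[of "G \<union> H"] by (simp add: sum.union_disjoint)
qed (auto simp: cech_measure_def)

lemma cech_measure_cech_of:
  assumes "\<mu> \<in> clopen_measures K"
  shows "cech_measure K (cech_of K \<mu>) = \<mu>"
proof
  fix G
  show "cech_measure K (cech_of K \<mu>) G = \<mu> G"
  proof (cases "G \<in> rel_clopen K")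
    case True
    then obtain \<U> T where UT: "\<U> \<in> open_covers K" "separated K \<U> T" "\<Union>T \<inter> K = G"
      using rel_clopen_separated by blast
    obtain c where c: "c \<in> cech_of K \<mu> \<U>"
      using cech_of_witness[OF assms UT(1)] by blast
    show ?thesis
      unfolding UT(3)[symmetric] cech_measure_eq[OF cech_of_cech_H0[OF assms] UT(1,2) c]
      using c UT(1,2) by (auto simp: cech_of_def)
  qed (use assms in \<open>auto simp: cech_measure_def clopen_measures_def\<close>)
qed

lemma bij_betw_cech_measure: "bij_betw (cech_measure K) (cech_H0 K) (clopen_measures K)"
  by (rule bij_betwI[where g = "cech_of K"])
     (auto simp: cech_measure_clopen_measures cech_of_cech_H0 cech_of_cech_measure cech_measure_cech_of)

section \<open>Linear structure and inclusion maps in terms of measures\<close>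

lemma clopen_measures_comb:
  assumes "\<mu> \<in> clopen_measures K" "\<nu> \<in> clopen_measures K"
  shows "(\<lambda>G. a * \<mu> G + \<nu> G) \<in> clopen_measures K"
  using assms unfolding clopen_measures_def by (auto simp: algebra_simps)

lemma cech_comb_eq:
  assumes "z \<in> cech_H0 K" "w \<in> cech_H0 K"
  shows "cech_comb a z w = cech_of K (\<lambda>G. a * cech_measure K z G + cech_measure K w G)"
    (is "_ = cech_of K ?\<mu>")
proof
  fix \<U>
  have zw: "z \<U> = cech_of K (cech_measure K z) \<U>" "w \<U> = cech_of K (cech_measure K w) \<U>"
    using cech_of_cech_measure assms by metis+
  show "cech_comb a z w \<U> = cech_of K ?\<mu> \<U>"
  proof (cases "\<U> \<in> open_covers K")
    case True
    show ?thesis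
    proof (intro equalityI subsetI)
      fix d assume "d \<in> cech_comb a z w \<U>"
      then obtain c c' where c: "c \<in> cech_of K (cech_measure K z) \<U>"
        "c' \<in> cech_of K (cech_measure K w) \<U>" and d: "d = (\<lambda>U. a * c U + c' U)"
        unfolding cech_comb_def zw[symmetric] by blast
      have "sum d T = ?\<mu> (\<Union>T \<inter> K)" if "separated K \<U> T" for T
        using c that True by (simp add: d cech_of_def sum.distrib sum_distrib_left[symmetric])
      moreover have "U \<in> \<U> \<and> U \<inter> K \<noteq> {}" if "d U \<noteq> 0" for U
      proof -
        have "c U \<noteq> 0 \<or> c' U \<noteq> 0" using that by (auto simp: d)
        then show ?thesis
          using c True by (auto simp: cech_of_def nerve_chains0_def)
      qed
      ultimately show "d \<in> cech_of K ?\<mu> \<U>"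
        using True by (simp add: cech_of_def nerve_chains0_def)
    next
      fix d assume d: "d \<in> cech_of K ?\<mu> \<U>"
      obtain c where c: "c \<in> z \<U>"
        using cech_H0_class[OF assms(1) True] by blast
      \<comment> \<open>Subtracting a multiple of one representative of z leaves a representative of
        w. No division by a occurs, so a = 0 is included.\<close>
      define c' where "c' U = d U - a * c U" for U
      have "sum c' T = cech_measure K w (\<Union>T \<inter> K)" if "separated K \<U> T" for T
        using c d True that unfolding zw
        by (simp add: c'_def cech_of_def sum_subtractf sum_distrib_left[symmetric])
      moreover have "U \<in> \<U> \<and> U \<inter> K \<noteq> {}" if "c' U \<noteq> 0" for U
      proof -
        have "c U \<noteq> 0 \<or> d U \<noteq> 0" using that by (auto simp: c'_def)
        then show ?thesis
          using c d True unfolding zw by (auto simp: cech_of_def nerve_chains0_def)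
      qed
      ultimately have "c' \<in> w \<U>"
        unfolding zw using True by (simp add: cech_of_def nerve_chains0_def)
      then show "d \<in> cech_comb a z w \<U>"
        using c unfolding cech_comb_def mem_Collect_eq
        by (intro exI[of _ c] exI[of _ c']) (auto simp: c'_def)
    qed
  next
    case False
    then show ?thesis
      unfolding cech_comb_def zw by (simp add: cech_of_def)
  qed
qed

lemma cech_comb_cech_H0:
  assumes "z \<in> cech_H0 K" "w \<in> cech_H0 K"
  shows "cech_comb a z w \<in> cech_H0 K"
  unfolding cech_comb_eq[OF assms]
  by (intro cech_of_cech_H0 clopen_measures_comb cech_measure_clopen_measures assms)

lemma cech_measure_comb:
  assumes "z \<in> cech_H0 K" "w \<in> cech_H0 K"
  shows "cech_measure K (cech_comb a z w) = (\<lambda>G. a * cech_measure K z G + cech_measure K w G)"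
  unfolding cech_comb_eq[OF assms]
  by (intro cech_measure_cech_of clopen_measures_comb cech_measure_clopen_measures assms)

text \<open>The pushforward of \<mu> along the inclusion of K in L, cut off to satisfy the
  convention of \<open>clopen_measures\<close>.\<close>

definition extend_measure :: "'a::topological_space set \<Rightarrow> 'a set \<Rightarrow> ('a set \<Rightarrow> 'k::field) \<Rightarrow> ('a set \<Rightarrow> 'k)" where
  "extend_measure L K \<mu> G = (if G \<in> rel_clopen L then \<mu> (G \<inter> K) else 0)"

lemma extend_measure_clopen_measures:
  assumes "\<mu> \<in> clopen_measures K" "K \<subseteq> L"
  shows "extend_measure L K \<mu> \<in> clopen_measures L"
  unfolding clopen_measures_def mem_Collect_eq
proof (intro conjI allI impI ballI)
  fix G H assume GH: "G \<in> rel_clopen L" "H \<in> rel_clopen L" "G \<inter> H = {}"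
  have "G \<inter> K \<in> rel_clopen K" "H \<inter> K \<in> rel_clopen K" "(G \<inter> K) \<inter> (H \<inter> K) = {}"
    using rel_clopen_Int_subset[OF GH(1) assms(2)] rel_clopen_Int_subset[OF GH(2) assms(2)] GH(3) by auto
  then have "\<mu> ((G \<inter> K) \<union> (H \<inter> K)) = \<mu> (G \<inter> K) + \<mu> (H \<inter> K)"
    using assms(1) unfolding clopen_measures_def by simp
  then show "extend_measure L K \<mu> (G \<union> H) = extend_measure L K \<mu> G + extend_measure L K \<mu> H"
    using GH rel_clopen_Un[OF GH(1,2)] by (simp add: extend_measure_def Int_Un_distrib2)
qed (auto simp: extend_measure_def)

text \<open>A cover of L also covers K, and a family separated over L is separated over K. So one
  chain c representing z describes both sides: passing to L keeps c and asks for equal totals on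
  fewer families.\<close>

lemma cech_incl_eq:
  assumes "z \<in> cech_H0 K" "K \<subseteq> L"
  shows "cech_incl L z = cech_of L (extend_measure L K (cech_measure K z))"
proof
  fix \<U>
  show "cech_incl L z \<U> = cech_of L (extend_measure L K (cech_measure K z)) \<U>"
  proof (cases "\<U> \<in> open_covers L")
    case True
    have K: "\<U> \<in> open_covers K" and fin: "finite \<U>"
      using True assms(2) by (auto simp: open_covers_def)
    obtain c where c: "c \<in> nerve_chains0 K \<U>" "c \<in> z \<U>"
      "z \<U> = {c'\<in>nerve_chains0 K \<U>. \<forall>T. separated K \<U> T \<longrightarrow> sum c' T = sum c T}"
      using cech_H0_class[OF assms(1) K] .
    have sepK: "separated K \<U> T" if "separated L \<U> T" for T
      using that assms(2) unfolding separated_def by blast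
    have sub: "nerve_chains0 K \<U> \<subseteq> nerve_chains0 L \<U>"
      using assms(2) unfolding nerve_chains0_def by blast
    have ext: "extend_measure L K (cech_measure K z) (\<Union>T \<inter> L) = sum c T" if "separated L \<U> T" for T
    proof -
      have "\<Union>T \<inter> L \<inter> K = \<Union>T \<inter> K" using assms(2) by blast
      then show ?thesis
        using separated_rel_clopen[OF True that] cech_measure_eq[OF assms(1) K sepK[OF that] c(2)]
        by (simp add: extend_measure_def)
    qed
    show ?thesis
    proof (intro equalityI subsetI)
      fix d assume "d \<in> cech_incl L z \<U>"
      then obtain c' where "c' \<in> z \<U>" "(c', d) \<in> nerve_homologous L \<U>"
        using True by (auto simp: cech_incl_def)
      then have "d \<in> nerve_chains0 L \<U>" "\<forall>T. separated L \<U> T \<longrightarrow> sum d T = sum c T"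
        using c(3) sepK by (auto simp: nerve_homologous_iff[OF fin])
      then show "d \<in> cech_of L (extend_measure L K (cech_measure K z)) \<U>"
        using True ext by (auto simp: cech_of_def)
    next
      fix d assume "d \<in> cech_of L (extend_measure L K (cech_measure K z)) \<U>"
      then have "(c, d) \<in> nerve_homologous L \<U>"
        using c(1) sub ext by (auto simp: nerve_homologous_iff[OF fin] cech_of_def split: if_splits)
      then show "d \<in> cech_incl L z \<U>"
        using True c(2) by (auto simp: cech_incl_def)
    qed
  qed (auto simp: cech_incl_def cech_of_def)
qed

lemma cech_incl_cech_H0:
  assumes "z \<in> cech_H0 K" "K \<subseteq> L"
  shows "cech_incl L z \<in> cech_H0 L"
  unfolding cech_incl_eq[OF assms]
  by (intro cech_of_cech_H0 extend_measure_clopen_measures cech_measure_clopen_measures assms)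

lemma cech_measure_incl:
  assumes "z \<in> cech_H0 K" "K \<subseteq> L"
  shows "cech_measure L (cech_incl L z) = extend_measure L K (cech_measure K z)"
  unfolding cech_incl_eq[OF assms]
  by (intro cech_measure_cech_of extend_measure_clopen_measures cech_measure_clopen_measures assms)

section \<open>Merge levels\<close>

definition merge :: "('a::topological_space \<Rightarrow> real) \<Rightarrow> 'a \<Rightarrow> 'a \<Rightarrow> real" where
  "merge f x y = (SUP \<gamma>\<in>{\<gamma>. path \<gamma> \<and> pathstart \<gamma> = x \<and> pathfinish \<gamma> = y}. INF t\<in>{0..1}. f (\<gamma> t))"

lemma tree_pdist_merge: "tree_pdist f x y = f x + f y - 2 * merge f x y"
  by (simp add: tree_pdist_def merge_def)

text \<open>The properties of \<open>merge f\<close> on a compact LLC space from which the barcode is constructed.\<close>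

locale merge_tree =
  fixes f :: "'a::topological_space \<Rightarrow> real" and m :: "'a \<Rightarrow> 'a \<Rightarrow> real"
  assumes compact_space: "compact (UNIV :: 'a set)"
    and cont: "continuous_on UNIV f"
    and m_self: "m x x = f x"
    and m_sym: "m x y = m y x"
    and m_ultra: "min (m x y) (m y z) \<le> m x z"
    and m_open: "open {y. s < m x y}"
    and m_saturated: "G \<in> rel_clopen (superlevel f r) \<Longrightarrow>
           \<exists>s<r. \<forall>x\<in>G. \<forall>y\<in>superlevel f r. s < m x y \<longrightarrow> y \<in> G"
    and m_level: "f z \<le> l \<Longrightarrow> l \<le> f x \<Longrightarrow> \<exists>y. f y = l \<and> m x y = l"
    and m_lower: "(\<And>w. c \<le> f w) \<Longrightarrow> c \<le> m x y"

locale llc_function =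
  fixes f :: "'a::metric_space \<Rightarrow> real"
  assumes compact_space: "compact (UNIV :: 'a set)"
    and llc: "LLC (UNIV :: 'a set)"
    and cont: "continuous_on UNIV f"
begin

text \<open>LLC holds at all scales, so one linear constant serves all pairs. Replacing C by
  \<open>max C 1\<close> makes it positive, and a constant path covers x = y.\<close>

lemma small_path:
  obtains C where "C > 0" "\<And>x y::'a. \<exists>g. path g \<and> pathstart g = x \<and> pathfinish g = y \<and>
     (\<forall>u\<in>path_image g. \<forall>v\<in>path_image g. dist u v \<le> C * dist x y)"
proof -
  obtain C where C: "\<forall>r>0. \<forall>z\<in>UNIV. \<forall>x\<in>UNIV \<inter> ball z r. \<forall>y\<in>UNIV \<inter> ball z r. x \<noteq> (y::'a) \<longrightarrow>
    (\<exists>g. arc g \<and> path_image g \<subseteq> UNIV \<and> pathstart g = x \<and> pathfinish g = y \<and>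
      diameter (path_image g) \<le> C * dist x y)"
    using llc unfolding LLC_def by (elim conjE exE) (rule that)
  have "\<exists>g. path g \<and> pathstart g = x \<and> pathfinish g = y \<and>
     (\<forall>u\<in>path_image g. \<forall>v\<in>path_image g. dist u v \<le> max C 1 * dist x y)" for x y :: 'a
  proof (cases "x = y")
    case True
    then show ?thesis
      by (intro exI[of _ "\<lambda>_. x"]) (auto simp: pathstart_def pathfinish_def path_image_def path_def)
  next
    case False
    then obtain g where g: "arc g" "pathstart g = x" "pathfinish g = y"
      "diameter (path_image g) \<le> C * dist x y"
      using C[rule_format, of "dist x y + 1" x x y] by (auto simp: add_nonneg_pos)
    have "bounded (path_image g)"
      using g(1) by (intro compact_imp_bounded compact_path_image arc_imp_path)
    then have "dist u v \<le> C * dist x y" if "u \<in> path_image g" "v \<in> path_image g" for u v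
      using diameter_bounded_bound[OF _ that] g(4) by force
    moreover have "C * dist x y \<le> max C 1 * dist x y"
      by (intro mult_right_mono) auto
    ultimately show ?thesis
      using g arc_imp_path by (metis order_trans)
  qed
  then show ?thesis
    using that[of "max C 1"] by auto
qed

lemma path_exists: "\<exists>g. path g \<and> pathstart g = x \<and> pathfinish g = (y::'a)"
  using small_path by metis

lemma bounded_f: obtains c where "\<And>x. \<bar>f x\<bar> \<le> c"
proof -
  have "bounded (range f)"
    using compact_continuous_image[OF cont compact_space] by (rule compact_imp_bounded)
  then show ?thesis
    using that by (auto simp: bounded_iff)
qed

lemma bdd_below_f: "bdd_below ((\<lambda>t. f (g t)) ` A)"
proof -
  obtain c where "\<And>x. \<bar>f x\<bar> \<le> c" using bounded_f by blast
  then show ?thesis by (intro bdd_belowI2[of _ "-c"]) (metis abs_le_D2 minus_le_iff)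
qed

text \<open>The infimum of f along a path is a minimum by compactness, so a strict inequality passes
  from the points to the infimum.\<close>

lemma INF_path_gt_iff:
  assumes "path g"
  shows "s < (INF t\<in>{0..1}. f (g t)) \<longleftrightarrow> (\<forall>y\<in>path_image g. s < f y)"
proof
  assume s: "s < (INF t\<in>{0..1}. f (g t))"
  show "\<forall>y\<in>path_image g. s < f y"
  proof
    fix y assume "y \<in> path_image g"
    then obtain t where "t \<in> {0..1}" "y = g t" by (auto simp: path_image_def)
    then show "s < f y"
      using cINF_lower[OF bdd_below_f, of t "{0..1}" g] s by auto
  qed
next
  assume s: "\<forall>y\<in>path_image g. s < f y"
  have "compact (path_image g)" "path_image g \<noteq> {}"
    using assms by auto
  then obtain y where y: "y \<in> path_image g" "\<And>z. z \<in> path_image g \<Longrightarrow> f y \<le> f z"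
    using continuous_attains_inf[of "path_image g" f] cont continuous_on_subset by blast
  have "f y \<le> (INF t\<in>{0..1}. f (g t))"
    by (rule cINF_greatest) (auto intro!: y(2) simp: path_image_def)
  then show "s < (INF t\<in>{0..1}. f (g t))"
    using s y(1) by force
qed

text \<open>The supremum over paths need not be attained. All properties of \<open>merge\<close> are
  therefore derived from the levels strictly below it, at which an actual path exists.\<close>

lemma merge_gt_iff:
  "s < merge f x y \<longleftrightarrow> (\<exists>g. path g \<and> pathstart g = x \<and> pathfinish g = y \<and> (\<forall>z\<in>path_image g. s < f z))"
proof -
  obtain c where c: "\<And>x. \<bar>f x\<bar> \<le> c" using bounded_f by blast
  have "bdd_above ((\<lambda>\<gamma>. INF t\<in>{0..1}. f (\<gamma> t)) ` {\<gamma>. path \<gamma> \<and> pathstart \<gamma> = x \<and> pathfinish \<gamma> = y})"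
  proof (rule bdd_aboveI2)
    fix \<gamma> :: "real \<Rightarrow> 'a"
    have "(INF t\<in>{0..1}. f (\<gamma> t)) \<le> f (\<gamma> 0)"
      by (rule cINF_lower[OF bdd_below_f]) auto
    then show "(INF t\<in>{0..1}. f (\<gamma> t)) \<le> c"
      using c[of "\<gamma> 0"] by linarith
  qed
  then have "s < merge f x y \<longleftrightarrow>
      (\<exists>g\<in>{\<gamma>. path \<gamma> \<and> pathstart \<gamma> = x \<and> pathfinish \<gamma> = y}. s < (INF t\<in>{0..1}. f (g t)))"
    unfolding merge_def using path_exists by (intro less_cSUP_iff) auto
  then show ?thesis
    using INF_path_gt_iff by auto
qed

lemma merge_tree_merge: "merge_tree f (merge f)"
proof
  show "compact (UNIV :: 'a set)" "continuous_on UNIV f"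
    by (fact compact_space cont)+
next
  fix x
  have "s < merge f x x \<longleftrightarrow> s < f x" for s
  proof
    assume "s < merge f x x"
    then show "s < f x"
      unfolding merge_gt_iff using pathstart_in_path_image by blast
  next
    assume "s < f x"
    then show "s < merge f x x"
      unfolding merge_gt_iff
      by (intro exI[of _ "\<lambda>_. x"]) (auto simp: pathstart_def pathfinish_def path_image_def path_def)
  qed
  then show "merge f x x = f x"
    by (metis linorder_neq_iff)
next
  fix x y
  have "s < merge f x y \<Longrightarrow> s < merge f y x" for s x y
    unfolding merge_gt_iff
    by (metis path_image_reversepath path_reversepath pathfinish_reversepath pathstart_reversepath)
  then show "merge f x y = merge f y x"
    by (metis linorder_neq_iff)
next
  fix x y z
  have "s < merge f x z" if s: "s < min (merge f x y) (merge f y z)" for s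
  proof -
    obtain g h where "path g" "pathstart g = x" "pathfinish g = y" "\<forall>z\<in>path_image g. s < f z"
      "path h" "pathstart h = y" "pathfinish h = z" "\<forall>z\<in>path_image h. s < f z"
      using s unfolding min_less_iff_conj merge_gt_iff by blast
    then show ?thesis
      unfolding merge_gt_iff by (intro exI[of _ "g +++ h"]) (auto simp: path_image_join)
  qed
  then show "min (merge f x y) (merge f y z) \<le> merge f x z"
    by - (rule dense_le, rule less_imp_le, blast)
next
  fix x s
  obtain C where C: "C > 0" "\<And>x y::'a. \<exists>g. path g \<and> pathstart g = x \<and> pathfinish g = y \<and>
     (\<forall>u\<in>path_image g. \<forall>v\<in>path_image g. dist u v \<le> C * dist x y)"
    by (rule small_path) (rule that)
  show "open {y. s < merge f x y}"
    unfolding open_contains_ball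
  proof
    fix y assume "y \<in> {y. s < merge f x y}"
    then obtain g where g: "path g" "pathstart g = x" "pathfinish g = y" "\<forall>z\<in>path_image g. s < f z"
      unfolding merge_gt_iff by auto
    then have "s < f y"
      using pathfinish_in_path_image by blast
    moreover have "open {z. s < f z}"
      using cont by (intro open_Collect_less) auto
    ultimately obtain e where "e > 0" "ball y e \<subseteq> {z. s < f z}"
      unfolding open_contains_ball by blast
    then have e: "e > 0" "\<And>z. dist y z < e \<Longrightarrow> s < f z"
      by auto
    \<comment> \<open>A path from y to z given by the linear bound stays within distance e of y,
      where f > s.\<close>
    have "z \<in> {y. s < merge f x y}" if z: "z \<in> ball y (e / C)" for z
    proof -
      obtain h where h: "path h" "pathstart h = y" "pathfinish h = z"
        "\<And>u v. u \<in> path_image h \<Longrightarrow> v \<in> path_image h \<Longrightarrow> dist u v \<le> C * dist y z"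
        using C(2)[of y z] by blast
      have "s < f v" if "v \<in> path_image h" for v
      proof (rule e(2))
        have "dist y v \<le> C * dist y z"
          using h that pathstart_in_path_image by blast
        also have "\<dots> < e"
          using z C(1) by (simp add: field_simps)
        finally show "dist y v < e" .
      qed
      then show ?thesis
        unfolding mem_Collect_eq merge_gt_iff using g h
        by (intro exI[of _ "g +++ h"]) (auto simp: path_image_join)
    qed
    then show "\<exists>e>0. ball y e \<subseteq> {y. s < merge f x y}"
      using e(1) C(1) by (intro exI[of _ "e / C"]) auto
  qed
next
  fix G r
  let ?K = "superlevel f r"
  assume "G \<in> rel_clopen ?K"
  then obtain U V where UV: "open U" "open V" "G = U \<inter> ?K" "?K - G = V \<inter> ?K"
    by (auto simp: rel_clopen_def)
  define H where "H = ?K - G"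
  have clK: "closed ?K"
    unfolding superlevel_def using cont by (intro closed_Collect_le) auto
  have "G = ?K - V" "H = ?K - U"
    using UV by (auto simp: H_def)
  then have cl: "closed G" "closed H"
    using clK UV(1,2) by (metis closed_Diff)+
  show "\<exists>s<r. \<forall>x\<in>G. \<forall>y\<in>?K. s < merge f x y \<longrightarrow> y \<in> G"
  proof (cases "G = {} \<or> H = {}")
    case True
    then show ?thesis
      by (intro exI[of _ "r - 1"]) (auto simp: H_def)
  next
    case False
    \<comment> \<open>The zero set Z of h is compact and misses {f \<ge> r}, so f is at most some s
      < r on Z. A path from G to the rest of the superlevel set has to cross Z. The empty cases were
      split off because \<open>infdist\<close> to the empty set is 0.\<close>
    define h where "h x = infdist x H - infdist x G" for x
    have conth: "continuous_on S h" for S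
      unfolding h_def by (intro continuous_intros)
    have hG: "h x > 0" if "x \<in> G" for x
      using that False cl in_closed_iff_infdist_zero[of H x] infdist_nonneg[of x H]
      by (auto simp: h_def H_def)
    have hH: "h x < 0" if "x \<in> H" for x
      using that False cl in_closed_iff_infdist_zero[of G x] infdist_nonneg[of x G]
      by (auto simp: h_def H_def)
    define Z where "Z = {x. h x = 0}"
    have "closed Z"
      unfolding Z_def using conth by (intro closed_Collect_eq) auto
    then have "compact Z"
      using compact_space compact_Int_closed[of UNIV Z] by simp
    have Zr: "f x < r" if "x \<in> Z" for x
      using that hG[of x] hH[of x] by (cases "f x < r") (auto simp: Z_def H_def superlevel_def)
    obtain s where s: "s < r" "\<And>x. x \<in> Z \<Longrightarrow> f x \<le> s"
    proof (cases "Z = {}")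
      case False
      then obtain x where "x \<in> Z" "\<And>y. y \<in> Z \<Longrightarrow> f y \<le> f x"
        using continuous_attains_sup[OF \<open>compact Z\<close>, of f] cont continuous_on_subset by blast
      then show ?thesis using that[of "f x"] Zr by blast
    qed (use that[of "r - 1"] in auto)
    show ?thesis
    proof (intro exI[of _ s] conjI ballI impI, fact s(1), rule ccontr)
      fix x y assume x: "x \<in> G" and y: "y \<in> ?K" "s < merge f x y" "y \<notin> G"
      then obtain g where g: "path g" "pathstart g = x" "pathfinish g = y" "\<forall>z\<in>path_image g. s < f z"
        unfolding merge_gt_iff by auto
      have "\<exists>t\<ge>0. t \<le> 1 \<and> (h \<circ> g) t = 0"
      proof (rule IVT2')
        show "(h \<circ> g) 1 \<le> 0" using hH[of y] y g by (auto simp: H_def pathfinish_def)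
        show "0 \<le> (h \<circ> g) 0" using hG[of x] x g by (auto simp: pathstart_def)
        show "continuous_on {0..1} (h \<circ> g)"
          using g(1) conth by (intro continuous_on_compose) (auto simp: path_def)
      qed auto
      then obtain t where "0 \<le> t" "t \<le> 1" "g t \<in> Z" by (auto simp: Z_def)
      then show False
        using s(2)[of "g t"] g(4) by (force simp: path_image_def)
    qed
  qed
next
  fix z x l assume l: "f z \<le> l" "l \<le> f x"
  obtain g where g: "path g" "pathstart g = x" "pathfinish g = z"
    using path_exists by blast
  have contfg: "continuous_on S (f \<circ> g)" if "S \<subseteq> {0..1}" for S
    using g(1) cont that by (intro continuous_on_compose) (auto simp: path_def intro: continuous_on_subset)
  \<comment> \<open>The first time at which the path meets level l gives the point y: until then f
    stays \<ge> l, so y is joined to x at every level below l, and its own height excludes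
    more.\<close>
  define T where "T = {t\<in>{0..1}. (f \<circ> g) t = l}"
  have "\<exists>t\<ge>0. t \<le> 1 \<and> (f \<circ> g) t = l"
    by (rule IVT2') (use l g contfg in \<open>auto simp: pathstart_def pathfinish_def\<close>)
  then have "T \<noteq> {}" by (auto simp: T_def)
  moreover have "compact T"
  proof -
    have "closed T"
      unfolding T_def using continuous_closed_preimage_constant[OF contfg[OF order_refl], of l] by simp
    then have "compact ({0..1} \<inter> T)"
      by (intro compact_Int_closed) auto
    moreover have "{0..1} \<inter> T = T" by (auto simp: T_def)
    ultimately show ?thesis by simp
  qed
  ultimately have "\<exists>t0\<in>T. \<forall>t\<in>T. t0 \<le> t"
    by (rule compact_attains_inf[rotated])
  then obtain t0 where t0: "t0 \<in> T" "\<And>t. t \<in> T \<Longrightarrow> t0 \<le> t"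
    by blast
  have ge: "l \<le> f (g t)" if t: "0 \<le> t" "t \<le> t0" for t
  proof (rule ccontr)
    assume "\<not> l \<le> f (g t)"
    have "\<exists>u\<ge>0. u \<le> t \<and> (f \<circ> g) u = l"
    proof (rule IVT2')
      show "continuous_on {0..t} (f \<circ> g)"
        using t t0 by (intro contfg) (auto simp: T_def)
    qed (use \<open>\<not> l \<le> f (g t)\<close> t l g in \<open>auto simp: pathstart_def\<close>)
    then obtain u where "0 \<le> u" "u \<le> t" "f (g u) = l" by auto
    then have "u = t0" using t t0 by (force simp: T_def)
    then show False
      using \<open>f (g u) = l\<close> \<open>u \<le> t\<close> t \<open>\<not> l \<le> f (g t)\<close> by simp
  qed
  have t0': "t0 \<in> {0..1}" "f (g t0) = l" using t0 by (auto simp: T_def)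
  have "s < merge f x (g t0)" if "s < l" for s
    unfolding merge_gt_iff
  proof (intro exI[of _ "g \<circ> (\<lambda>u. t0 * u)"] conjI ballI)
    have sub: "(\<lambda>u. t0 * u) ` {0..1} \<subseteq> {0..t0}"
      using t0' by (auto simp: mult_left_le)
    have "continuous_on {0..t0} g"
      using g(1) t0' by (auto simp: path_def intro: continuous_on_subset)
    then show "path (g \<circ> (\<lambda>u. t0 * u))"
      unfolding path_def
      by (intro continuous_on_compose continuous_intros) (rule continuous_on_subset[OF _ sub])
    show "pathstart (g \<circ> (\<lambda>u. t0 * u)) = x" using g by (simp add: pathstart_def)
    show "pathfinish (g \<circ> (\<lambda>u. t0 * u)) = g t0" by (simp add: pathfinish_def)
    fix w assume "w \<in> path_image (g \<circ> (\<lambda>u. t0 * u))"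
    then obtain u where u: "u \<in> {0..1}" "w = g (t0 * u)"
      by (auto simp: path_image_def)
    define t where "t = t0 * u"
    have "0 \<le> t" "t \<le> t0" "w = g t"
      using u t0' by (auto simp: t_def mult_left_le)
    then show "s < f w" using ge that by force
  qed
  moreover have "\<not> l < merge f x (g t0)"
    unfolding merge_gt_iff using t0'(2) pathfinish_in_path_image by (metis less_irrefl)
  ultimately have "merge f x (g t0) = l"
    by (metis linorder_neq_iff)
  then show "\<exists>y. f y = l \<and> merge f x y = l"
    using t0' by blast
next
  fix c x y assume c: "\<And>w. c \<le> f w"
  have "s < merge f x y" if "s < c" for s
  proof -
    have "s < f w" for w using c that by (rule less_le_trans[rotated])
    then show ?thesis
      unfolding merge_gt_iff using path_exists[of x y] by auto
  qed
  then show "c \<le> merge f x y"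
    by - (rule dense_le, rule less_imp_le, blast)
qed

end

section \<open>The elder rule and the barcode\<close>

text \<open>Induction by removing the E-first index x. No other equation contains the unknown
  \<open>w x\<close>, since P z x would put z before x; so the smaller system is solved first and
  \<open>w x\<close> is read off the equation of x.\<close>

lemma triangular_system_solvable:
  fixes v :: "'b \<Rightarrow> 'k::ring_1"
  assumes "finite F" and refl: "\<And>x. x \<in> F \<Longrightarrow> P x x"
    and eld: "\<And>x y. x \<in> F \<Longrightarrow> y \<in> F \<Longrightarrow> P x y \<Longrightarrow> E x y"
    and anti: "\<And>x y. E x y \<Longrightarrow> E y x \<Longrightarrow> x = y"
    and trans: "\<And>x y z. E x y \<Longrightarrow> E y z \<Longrightarrow> E x z"
    and total: "\<And>x y. E x y \<or> E y x"
  shows "\<exists>w. \<forall>x\<in>F. (\<Sum>y | y \<in> F \<and> P x y. w y) = v x"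
  using assms(1-3)
proof (induction "card F" arbitrary: F)
  case (Suc n)
  have "\<exists>x\<in>F. \<forall>y\<in>F. E x y"
  proof -
    have "F \<noteq> {}" using Suc(2) by auto
    with \<open>finite F\<close> show ?thesis
    proof (induction F rule: finite_ne_induct)
      case (singleton x)
      then show ?case using total by blast
    next
      case (insert x F)
      then obtain z where "z \<in> F" "\<forall>y\<in>F. E z y" by blast
      then show ?case
      proof (cases "E x z")
        case True
        then have "\<forall>y\<in>insert x F. E x y"
          using \<open>\<forall>y\<in>F. E z y\<close> total[of x x] trans[OF True] by blast
        then show ?thesis by blast
      next
        case False
        then show ?thesis
          using \<open>z \<in> F\<close> \<open>\<forall>y\<in>F. E z y\<close> total[of x z] by blast
      qed
    qed
  qed
  then obtain x where x: "x \<in> F" "\<And>y. y \<in> F \<Longrightarrow> E x y" by blast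
  define F' where "F' = F - {x}"
  have F': "n = card F'" "finite F'" "F = insert x F'" "x \<notin> F'"
    using Suc(2,3) x(1) by (auto simp: F'_def)
  have "\<exists>w. \<forall>z\<in>F'. (\<Sum>y | y \<in> F' \<and> P z y. w y) = v z"
    using Suc(4,5) F'(3) by (intro Suc(1)[OF F'(1,2)]) auto
  then obtain w where w: "\<And>z. z \<in> F' \<Longrightarrow> (\<Sum>y | y \<in> F' \<and> P z y. w y) = v z"
    by metis
  define w' where "w' = w(x := v x - (\<Sum>y | y \<in> F' \<and> P x y. w y))"
  have "(\<Sum>y | y \<in> F \<and> P z y. w' y) = v z" if "z \<in> F" for z
  proof (cases "z = x")
    case True
    have "{y. y \<in> F \<and> P z y} = insert x {y. y \<in> F' \<and> P x y}"
      using Suc(4)[OF x(1)] F'(3) True by auto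
    moreover have "(\<Sum>y | y \<in> F' \<and> P x y. w' y) = (\<Sum>y | y \<in> F' \<and> P x y. w y)"
      using F'(4) by (intro sum.cong) (auto simp: w'_def)
    ultimately show ?thesis
      using F' True by (simp add: w'_def)
  next
    case False
    have "\<not> P z x"
      using Suc(5)[OF that x(1)] x(2)[OF that] anti False by blast
    then have "{y. y \<in> F \<and> P z y} = {y. y \<in> F' \<and> P z y}"
      using F'(3) by auto
    moreover have "(\<Sum>y | y \<in> F' \<and> P z y. w' y) = (\<Sum>y | y \<in> F' \<and> P z y. w y)"
      using F'(4) by (intro sum.cong) (auto simp: w'_def)
    ultimately show ?thesis
      using w[of z] that False F'(3) by simp
  qed
  then show ?case by blast
qed simp

text \<open>Induction on the number of indices that E places after x: the other unknowns in the
  equation of x are strictly later and already agree.\<close>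

lemma triangular_system_unique:
  fixes w w' :: "'b \<Rightarrow> 'k::ring_1"
  assumes "finite F" and refl: "\<And>x. x \<in> F \<Longrightarrow> P x x"
    and eld: "\<And>x y. x \<in> F \<Longrightarrow> y \<in> F \<Longrightarrow> P x y \<Longrightarrow> E x y"
    and anti: "\<And>x y. E x y \<Longrightarrow> E y x \<Longrightarrow> x = y"
    and trans: "\<And>x y z. E x y \<Longrightarrow> E y z \<Longrightarrow> E x z"
    and eq: "\<And>x. x \<in> F \<Longrightarrow> (\<Sum>y | y \<in> F \<and> P x y. w y) = (\<Sum>y | y \<in> F \<and> P x y. w' y)"
    and "x \<in> F"
  shows "w x = w' x"
  using assms(7)
proof (induction "card {y\<in>F. E x y}" arbitrary: x rule: less_induct)
  case less
  have IH: "w y = w' y" if "y \<in> F" "P x y" "y \<noteq> x" for y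
  proof (rule less(1)[OF psubset_card_mono])
    have "E x y" "\<not> E y x"
      using eld[OF less(2) that(1,2)] anti[of x y] that(3) by auto
    then show "{z\<in>F. E y z} \<subset> {z\<in>F. E x z}"
      using trans eld[OF less(2,2) refl[OF less(2)]] less(2) by blast
  qed (use assms(1) that in auto)
  have split: "{y. y \<in> F \<and> P x y} = insert x {y. y \<in> F \<and> P x y \<and> y \<noteq> x}"
    using refl less(2) by auto
  have "w x + (\<Sum>y | y \<in> F \<and> P x y \<and> y \<noteq> x. w y) = w' x + (\<Sum>y | y \<in> F \<and> P x y \<and> y \<noteq> x. w' y)"
    using eq[OF less(2)] assms(1) unfolding split by simp
  moreover have "(\<Sum>y | y \<in> F \<and> P x y \<and> y \<noteq> x. w y) = (\<Sum>y | y \<in> F \<and> P x y \<and> y \<noteq> x. w' y)"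
    using IH by (intro sum.cong) auto
  ultimately show ?case by simp
qed

text \<open>A well-order rather than a mere linear order: f may attain its maximum on a class at
  infinitely many points, and an eldest one among them has to exist.\<close>

definition tie_break :: "'a rel" where
  "tie_break = (SOME W. well_order W)"

lemma tie_break:
  shows "refl (tie_break :: 'a rel)" "trans (tie_break :: 'a rel)" "antisym (tie_break :: 'a rel)"
    "total (tie_break :: 'a rel)" "wf (tie_break - Id :: 'a rel)"
proof -
  have "well_order (tie_break :: 'a rel)"
    unfolding tie_break_def by (rule someI_ex[OF well_order_on])
  then show "refl (tie_break :: 'a rel)" "trans (tie_break :: 'a rel)" "antisym (tie_break :: 'a rel)"
    "total (tie_break :: 'a rel)" "wf (tie_break - Id :: 'a rel)"
    unfolding well_order_on_def linear_order_on_def partial_order_on_def preorder_on_def by blast+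
qed

lemma tie_break_total: "(x, y) \<in> tie_break \<or> (y, x) \<in> tie_break"
  using tie_break(1,4) by (cases "x = y") (auto simp: refl_on_def total_on_def)

section \<open>The elder order, reigns and realms\<close>

context merge_tree
begin

lemma m_le: "m x y \<le> f x" "m x y \<le> f y"
  using m_ultra[of x y x] m_ultra[of y x y] by (auto simp: m_sym m_self min_def split: if_splits)

lemma m_trans: "s < m x y \<Longrightarrow> s < m y z \<Longrightarrow> s < m x z"
  using m_ultra[of x y z] by linarith

definition elder :: "'a \<Rightarrow> 'a \<Rightarrow> bool" where
  "elder x y \<longleftrightarrow> f y < f x \<or> f x = f y \<and> (x, y) \<in> tie_break"

lemma elder_total: "elder x y \<or> elder y x"
  using tie_break_total[of x y] unfolding elder_def by linarith

lemma elder_antisym: "elder x y \<Longrightarrow> elder y x \<Longrightarrow> x = y"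
  using antisymD[OF tie_break(3)] unfolding elder_def by auto

lemma elder_trans: "elder x y \<Longrightarrow> elder y z \<Longrightarrow> elder x z"
  using transD[OF tie_break(2)] unfolding elder_def by auto

lemma elder_le: "elder x y \<Longrightarrow> f y \<le> f x"
  by (auto simp: elder_def)

text \<open>The class A of y at level s is open but need not be closed, so f is maximised on its
  closure. The maximiser x has f x > s, hence its own class is an open neighbourhood of x that meets
  A, and x lies in A. The well-order selects one of the maximisers.\<close>

lemma eldest_exists:
  assumes "s < f y"
  shows "\<exists>x. s < m y x \<and> (\<forall>z. s < m y z \<longrightarrow> elder x z)"
proof -
  define A where "A = {z. s < m y z}"
  have yA: "y \<in> A" using assms by (simp add: A_def m_self)
  have "\<exists>x\<in>A. \<forall>z\<in>A. f z \<le> f x"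
  proof -
    let ?K = "closure A"
    have "compact ?K"
      using compact_Int_closed[OF compact_space closed_closure[of A]] by simp
    moreover have "?K \<noteq> {}" using yA by auto
    ultimately obtain x where x: "x \<in> ?K" "\<And>z. z \<in> ?K \<Longrightarrow> f z \<le> f x"
      using continuous_attains_sup[of ?K f] cont continuous_on_subset by blast
    have "s < f x"
      using x(2)[of y] yA closure_subset[of A] assms by force
    then have "x \<in> {z. s < m x z}" by (simp add: m_self)
    then obtain z where "z \<in> A" "s < m x z"
      using x(1) m_open[of s x] unfolding closure_iff_nhds_not_empty by blast
    then have "x \<in> A"
      using m_trans[of s y z x] m_sym by (auto simp: A_def)
    then show ?thesis
      using x(2) closure_subset[of A] by blast
  qed
  then obtain x0 where x0: "x0 \<in> A" "\<And>z. z \<in> A \<Longrightarrow> f z \<le> f x0" by blast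
  define M where "M = {x\<in>A. f x = f x0}"
  have "x0 \<in> M" using x0 by (simp add: M_def)
  then obtain x where x: "x \<in> M" "\<And>z. (z, x) \<in> tie_break - Id \<Longrightarrow> z \<notin> M"
    using wfE_min[OF tie_break(5)] by metis
  have min: "(x, z) \<in> tie_break" if "z \<in> M" for z
    using x(2)[of z] that tie_break_total[of x z] by auto
  have "elder x z" if "z \<in> A" for z
  proof (cases "f z = f x0")
    case True
    then show ?thesis
      using min[of z] x(1) that by (simp add: elder_def M_def)
  next
    case False
    then show ?thesis
      using x0(2)[OF that] x(1) by (simp add: elder_def M_def)
  qed
  then show ?thesis
    using x(1) by (auto simp: M_def A_def)
qed

text \<open>\<open>reign x\<close> consists of the levels \<open>s\<close> such that \<open>x\<close> is the eldest point of its component of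
  \<open>{f > s}\<close>. It contains its infimum (if finite) but not \<open>f x\<close>; the bar of \<open>x\<close> is half-open the
  other way round, because the filtration is by the closed sets \<open>{f \<ge> r}\<close>.\<close>

definition reign :: "'a \<Rightarrow> real set" where
  "reign x = {s. s < f x \<and> (\<forall>y. s < m x y \<longrightarrow> elder x y)}"

definition bar_at :: "'a \<Rightarrow> real set" where
  "bar_at x = {r. r \<le> f x \<and> (\<exists>s\<in>reign x. s < r)}"

definition realm :: "'a \<Rightarrow> 'a set" where
  "realm x = {y. \<exists>s\<in>reign x. s < m x y}"

text \<open>For s < r this is one point, the eldest, for each class of {f > s} that reaches level
  r.\<close>

definition elders :: "real \<Rightarrow> real \<Rightarrow> 'a set" where
  "elders s r = {x. r \<le> f x \<and> s \<in> reign x}"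

lemma reign_mono: "s \<in> reign x \<Longrightarrow> s \<le> s' \<Longrightarrow> s' < f x \<Longrightarrow> s' \<in> reign x"
  by (auto simp: reign_def)

lemma reign_unique:
  assumes "s \<in> reign x" "s \<in> reign y" "s < m x y"
  shows "x = y"
  using assms m_sym[of x y] elder_antisym by (auto simp: reign_def)

lemma bar_at_interval: "is_interval (bar_at x)"
  unfolding is_interval_1 bar_at_def by (blast intro: less_le_trans order_trans)

lemma realm_elder: "y \<in> realm x \<Longrightarrow> elder x y"
  by (auto simp: realm_def reign_def)

lemma self_in_realm: "reign x \<noteq> {} \<Longrightarrow> x \<in> realm x"
  by (auto simp: realm_def reign_def m_self)

lemma elder_of_exists:
  assumes "s < r" "r \<le> f y"
  obtains x where "x \<in> elders s r" "s < m x y"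
proof -
  obtain x where x: "s < m y x" "\<And>z. s < m y z \<Longrightarrow> elder x z"
    using eldest_exists[of s y] assms by auto
  have "elder x y"
    using x(2)[of y] assms by (simp add: m_self)
  then have "r \<le> f x"
    using elder_le assms by fastforce
  moreover have "s \<in> reign x"
    using x m_trans[of s y x] \<open>r \<le> f x\<close> assms by (auto simp: reign_def)
  ultimately show ?thesis
    using that[of x] x(1) m_sym by (auto simp: elders_def)
qed

lemma elders_unique: "x \<in> elders s r \<Longrightarrow> x' \<in> elders s r \<Longrightarrow> s < m x y \<Longrightarrow> s < m x' y \<Longrightarrow> x = x'"
  using reign_unique[of s x x'] m_trans[of s x y x'] m_sym by (auto simp: elders_def)

lemma compact_superlevel: "compact (superlevel f r)"
proof -
  have "closed (superlevel f r)"
    unfolding superlevel_def using cont by (intro closed_Collect_le) auto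
  then show ?thesis
    using compact_Int_closed[OF compact_space, of "superlevel f r"] by simp
qed

text \<open>This is the q-tameness of the filtration. The open classes at level s cover the compact
  set {f \<ge> r}, so finitely many suffice, and each contains at most one member of
  \<open>elders s r\<close>.\<close>

lemma finite_elders:
  assumes "s < r"
  shows "finite (elders s r)"
proof -
  let ?U = "\<lambda>x. {y. s < m x y}"
  have "superlevel f r \<subseteq> (\<Union>x\<in>superlevel f r. ?U x)"
  proof
    fix x assume "x \<in> superlevel f r"
    then show "x \<in> (\<Union>x\<in>superlevel f r. ?U x)"
      using assms by (intro UN_I[of x]) (auto simp: superlevel_def m_self)
  qed
  then obtain C where C: "C \<subseteq> superlevel f r" "finite C" "superlevel f r \<subseteq> (\<Union>x\<in>C. ?U x)"
    using compactE_image[OF compact_superlevel, of "superlevel f r" ?U r] m_open by metis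
  have "\<forall>x\<in>elders s r. \<exists>c. c \<in> C \<and> s < m c x"
    using C(3) by (auto simp: elders_def superlevel_def)
  then obtain c where c: "\<And>x. x \<in> elders s r \<Longrightarrow> c x \<in> C \<and> s < m (c x) x"
    by metis
  have "inj_on c (elders s r)"
  proof (rule inj_onI)
    fix x x' assume "x \<in> elders s r" "x' \<in> elders s r" "c x = c x'"
    then show "x = x'"
      using c[of x] c[of x'] elders_unique[of x s r x' "c x"] m_sym by metis
  qed
  moreover have "finite (c ` elders s r)"
    using c C(2) by (auto intro: finite_subset)
  ultimately show ?thesis
    using finite_imageD by blast
qed

section \<open>Clopen sets as finite unions of cells\<close>

definition saturated :: "real \<Rightarrow> real \<Rightarrow> 'a set \<Rightarrow> bool" where
  "saturated s r G \<longleftrightarrow> (\<forall>x\<in>G. \<forall>y\<in>superlevel f r. s < m x y \<longrightarrow> y \<in> G)"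

text \<open>The classes at level s are open, so a saturated set and its complement are both traces
  of open unions. The converse \<open>rel_clopen_saturated\<close> supplies an s < r for every
  clopen set.\<close>

lemma saturated_rel_clopen:
  assumes "G \<subseteq> superlevel f r" "s < r" "saturated s r G"
  shows "G \<in> rel_clopen (superlevel f r)"
proof -
  let ?K = "superlevel f r"
  define U where "U H = (\<Union>x\<in>H. {y. s < m x y})" for H
  have "open (U H)" for H
    unfolding U_def using m_open by auto
  moreover have "H \<subseteq> U H" if "H \<subseteq> ?K" for H
  proof
    fix x assume "x \<in> H"
    moreover have "s < m x x"
      using \<open>x \<in> H\<close> that assms(2) by (auto simp: superlevel_def m_self)
    ultimately show "x \<in> U H" by (auto simp: U_def)
  qed
  moreover have "U G \<inter> ?K \<subseteq> G"
    using assms(3) by (auto simp: U_def saturated_def)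
  moreover have "U (?K - G) \<inter> ?K \<subseteq> ?K - G"
    using assms(3) m_sym by (auto simp: U_def saturated_def)
  ultimately have "open (U G)" "open (U (?K - G))" "G = U G \<inter> ?K" "?K - G = U (?K - G) \<inter> ?K"
    using assms(1) Diff_subset[of ?K G] by (meson Int_greatest subset_antisym)+
  then show ?thesis
    unfolding rel_clopen_def by blast
qed

lemma rel_clopen_saturated:
  assumes "G \<in> rel_clopen (superlevel f r)"
  obtains s where "s < r" "saturated s r G"
  using m_saturated[OF assms] by (auto simp: saturated_def)

lemma saturated_mono: "saturated s r G \<Longrightarrow> s \<le> s' \<Longrightarrow> saturated s' r G"
  by (auto simp: saturated_def)

text \<open>The smaller of two levels of \<open>reign x\<close> again belongs to
  \<open>reign x\<close>, so the union defining the realm absorbs every connection above s.\<close>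

lemma saturated_realm:
  assumes "s \<in> reign x"
  shows "saturated s r (realm x \<inter> superlevel f r)"
  unfolding saturated_def
proof (intro ballI impI)
  fix u v assume uv: "u \<in> realm x \<inter> superlevel f r" "v \<in> superlevel f r" "s < m u v"
  then obtain s' where s': "s' \<in> reign x" "s' < m x u" by (auto simp: realm_def)
  have "min s s' \<in> reign x"
    using assms s'(1) by (auto simp: min_def)
  moreover have "min s s' < m x v"
    using m_trans[of "min s s'" x u v] s'(2) uv(3) by auto
  ultimately show "v \<in> realm x \<inter> superlevel f r"
    using uv(2) by (auto simp: realm_def)
qed

lemma realm_rel_clopen:
  assumes "r \<in> bar_at x"
  shows "realm x \<inter> superlevel f r \<in> rel_clopen (superlevel f r)"
  using assms saturated_rel_clopen[OF Int_lower2 _ saturated_realm] by (auto simp: bar_at_def)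

definition cell :: "real \<Rightarrow> real \<Rightarrow> 'a \<Rightarrow> 'a set" where
  "cell s r x = {y. s < m x y} \<inter> superlevel f r"

lemma saturated_cell: "saturated s r (cell s r x)"
  unfolding saturated_def cell_def using m_trans by blast

lemma cell_rel_clopen: "s < r \<Longrightarrow> cell s r x \<in> rel_clopen (superlevel f r)"
  by (rule saturated_rel_clopen[OF _ _ saturated_cell]) (auto simp: cell_def)

lemma saturated_decomp:
  assumes "G \<subseteq> superlevel f r" "s < r" "saturated s r G"
  shows "G = (\<Union>x\<in>elders s r \<inter> G. cell s r x)"
proof (intro equalityI subsetI)
  fix y assume y: "y \<in> G"
  then have "r \<le> f y" using assms(1) by (auto simp: superlevel_def)
  then obtain x where x: "x \<in> elders s r" "s < m x y"
    using elder_of_exists[OF assms(2)] by blast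
  have "x \<in> G"
    using assms(3) y x m_sym unfolding saturated_def elders_def superlevel_def by auto
  then show "y \<in> (\<Union>x\<in>elders s r \<inter> G. cell s r x)"
    using x y assms(1) by (auto simp: cell_def)
next
  fix y assume "y \<in> (\<Union>x\<in>elders s r \<inter> G. cell s r x)"
  then show "y \<in> G"
    using assms(3) by (auto simp: saturated_def cell_def)
qed

lemma measure_decomp:
  assumes "\<mu> \<in> clopen_measures (superlevel f r)" "G \<subseteq> superlevel f r" "s < r" "saturated s r G"
  shows "\<mu> G = (\<Sum>x\<in>elders s r \<inter> G. \<mu> (cell s r x))"
proof -
  have "\<mu> (\<Union>x\<in>elders s r \<inter> G. cell s r x) = (\<Sum>x\<in>elders s r \<inter> G. \<mu> (cell s r x))"
  proof (rule clopen_measure_UN[OF assms(1)])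
    fix x x' assume "x \<in> elders s r \<inter> G" "x' \<in> elders s r \<inter> G" "x \<noteq> x'"
    then show "cell s r x \<inter> cell s r x' = {}"
      using elders_unique[of x s r x'] unfolding cell_def by blast
  qed (use finite_elders cell_rel_clopen assms(3) in auto)
  then show ?thesis
    using saturated_decomp[OF assms(2-4)] by simp
qed

section \<open>Bars as coordinates on the space of measures\<close>

definition bar_values :: "real \<Rightarrow> ('a set \<Rightarrow> 'k::field) \<Rightarrow> 'a \<Rightarrow> 'k" where
  "bar_values r \<mu> x = (if r \<in> bar_at x then \<mu> (realm x \<inter> superlevel f r) else 0)"

lemma elders_in_bar_at: "s < r \<Longrightarrow> x \<in> elders s r \<Longrightarrow> r \<in> bar_at x"
  by (auto simp: elders_def bar_at_def)

lemma elders_Int_realm: "elders s r \<inter> (realm x \<inter> superlevel f r) = {y. y \<in> elders s r \<and> y \<in> realm x}"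
  by (auto simp: elders_def superlevel_def)

lemma elders_in_realm: "x \<in> elders s r \<Longrightarrow> x \<in> realm x"
  by (intro self_in_realm) (auto simp: elders_def)

text \<open>At a level s at which G is saturated, the values on realms are sums of finitely many
  cell masses, triangular for the elder order. They determine the cell masses and with them the
  value on G.\<close>

lemma bar_values_inj: "inj_on (bar_values r) (clopen_measures (superlevel f r))"
proof (rule inj_onI)
  fix \<mu> \<nu> :: "'a set \<Rightarrow> 'k::field"
  assume \<mu>: "\<mu> \<in> clopen_measures (superlevel f r)" and \<nu>: "\<nu> \<in> clopen_measures (superlevel f r)"
    and eq: "bar_values r \<mu> = bar_values r \<nu>"
  show "\<mu> = \<nu>"
  proof
    fix G
    show "\<mu> G = \<nu> G"
    proof (cases "G \<in> rel_clopen (superlevel f r)")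
      case True
      then obtain s where s: "s < r" "saturated s r G"
        using rel_clopen_saturated by blast
      have G: "G \<subseteq> superlevel f r" using True by (auto simp: rel_clopen_def)
      have "\<mu> (cell s r x) = \<nu> (cell s r x)" if "x \<in> elders s r" for x
      proof (rule triangular_system_unique[OF finite_elders[OF s(1)], where E = elder and P = "\<lambda>x y. y \<in> realm x"])
        fix x assume x: "x \<in> elders s r"
        then have "\<mu> (realm x \<inter> superlevel f r) = \<nu> (realm x \<inter> superlevel f r)"
          using fun_cong[OF eq, of x] elders_in_bar_at[OF s(1)] by (simp add: bar_values_def)
        moreover have "s \<in> reign x" using x by (simp add: elders_def)
        ultimately show "(\<Sum>y | y \<in> elders s r \<and> y \<in> realm x. \<mu> (cell s r y)) =
            (\<Sum>y | y \<in> elders s r \<and> y \<in> realm x. \<nu> (cell s r y))"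
          using measure_decomp[OF \<mu> _ s(1) saturated_realm] measure_decomp[OF \<nu> _ s(1) saturated_realm]
          unfolding elders_Int_realm[symmetric] by simp
      qed (use that elders_in_realm realm_elder elder_antisym elder_trans in auto)
      then show ?thesis
        unfolding measure_decomp[OF \<mu> G s] measure_decomp[OF \<nu> G s] by simp
    qed (use \<mu> \<nu> in \<open>auto simp: clopen_measures_def\<close>)
  qed
qed

text \<open>A family of values on the bars is realised level by level: at each \<open>s < r\<close> the masses of the
  cells solve a triangular system, and the solutions are compatible as \<open>s\<close> increases to \<open>r\<close>.\<close>

lemma bar_values_surj:
  fixes v :: "'a \<Rightarrow> 'k::field"
  assumes v: "\<And>x. v x \<noteq> 0 \<Longrightarrow> r \<in> bar_at x"
  shows "\<exists>\<mu>\<in>clopen_measures (superlevel f r). bar_values r \<mu> = v"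
proof -
  let ?K = "superlevel f r"
  have "\<forall>s. \<exists>w. s < r \<longrightarrow> (\<forall>x\<in>elders s r. (\<Sum>y | y \<in> elders s r \<and> y \<in> realm x. w y) = v x)"
  proof
    fix s
    show "\<exists>w. s < r \<longrightarrow> (\<forall>x\<in>elders s r. (\<Sum>y | y \<in> elders s r \<and> y \<in> realm x. w y) = v x)"
    proof (cases "s < r")
      case True
      have "\<exists>w. \<forall>x\<in>elders s r. (\<Sum>y | y \<in> elders s r \<and> y \<in> realm x. w y) = v x"
        by (rule triangular_system_solvable[OF finite_elders[OF True], where E = elder])
           (use elders_in_realm realm_elder elder_antisym elder_trans elder_total in auto)
      then show ?thesis by blast
    qed simp
  qed
  then obtain w where w: "\<And>s x. s < r \<Longrightarrow> x \<in> elders s r \<Longrightarrow>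
      (\<Sum>y | y \<in> elders s r \<and> y \<in> realm x. w s y) = v x"
    by metis
  \<comment> \<open>A cell at s is cut into the cells at s' of the elders at s' inside it. Both
    sides solve the same triangular system at s, because the right-hand side v does not depend on
    the level.\<close>
  have compat: "w s x = (\<Sum>y | y \<in> elders s' r \<and> s < m x y. w s' y)"
    if s: "s \<le> s'" "s' < r" "x \<in> elders s r" for s s' x
  proof (rule triangular_system_unique[OF finite_elders, where E = elder and P = "\<lambda>x y. y \<in> realm x"])
    fix x assume x: "x \<in> elders s r"
    have fin: "finite (elders s r)" "finite (elders s' r)"
      using finite_elders s by auto
    have x': "x \<in> elders s' r"
      using x s reign_mono[of s x s'] by (auto simp: elders_def)
    have "s \<in> reign x" using x by (simp add: elders_def)
    have "(\<Sum>y | y \<in> elders s r \<and> y \<in> realm x. w s y) = v x"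
      using w x s by auto
    also have "\<dots> = (\<Sum>z | z \<in> elders s' r \<and> z \<in> realm x. w s' z)"
      using w[OF s(2) x'] by simp
    also have "{z. z \<in> elders s' r \<and> z \<in> realm x} =
        (\<Union>y\<in>{y. y \<in> elders s r \<and> y \<in> realm x}. {z. z \<in> elders s' r \<and> s < m y z})"
    proof (intro equalityI subsetI)
      fix z assume z: "z \<in> {z. z \<in> elders s' r \<and> z \<in> realm x}"
      then have "r \<le> f z" by (simp add: elders_def)
      then obtain y where y: "y \<in> elders s r" "s < m y z"
        using elder_of_exists[of s r z] s by auto
      have "y \<in> realm x"
        using saturated_realm[OF \<open>s \<in> reign x\<close>, of r] y z m_sym
        unfolding saturated_def elders_def superlevel_def by auto
      then show "z \<in> (\<Union>y\<in>{y. y \<in> elders s r \<and> y \<in> realm x}. {z. z \<in> elders s' r \<and> s < m y z})"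
        using y z by blast
    next
      fix z assume "z \<in> (\<Union>y\<in>{y. y \<in> elders s r \<and> y \<in> realm x}. {z. z \<in> elders s' r \<and> s < m y z})"
      then show "z \<in> {z. z \<in> elders s' r \<and> z \<in> realm x}"
        using saturated_realm[OF \<open>s \<in> reign x\<close>, of r]
        unfolding saturated_def elders_def superlevel_def by auto
    qed
    also have "(\<Sum>z\<in>\<dots>. w s' z) =
        (\<Sum>y | y \<in> elders s r \<and> y \<in> realm x. \<Sum>z | z \<in> elders s' r \<and> s < m y z. w s' z)"
    proof (rule sum.UNION_disjoint)
      show "\<forall>y\<in>{y. y \<in> elders s r \<and> y \<in> realm x}. \<forall>y'\<in>{y. y \<in> elders s r \<and> y \<in> realm x}. y \<noteq> y' \<longrightarrow>
          {z. z \<in> elders s' r \<and> s < m y z} \<inter> {z. z \<in> elders s' r \<and> s < m y' z} = {}"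
        using elders_unique[of _ s r] by blast
    qed (use fin in auto)
    finally show "(\<Sum>y | y \<in> elders s r \<and> y \<in> realm x. w s y) =
        (\<Sum>y | y \<in> elders s r \<and> y \<in> realm x. \<Sum>z | z \<in> elders s' r \<and> s < m y z. w s' z)" .
  qed (use s elders_in_realm realm_elder elder_antisym elder_trans in auto)
  have mass: "(\<Sum>x\<in>elders s r \<inter> G. w s x) = (\<Sum>x\<in>elders s' r \<inter> G. w s' x)"
    if s: "s \<le> s'" "s' < r" and G: "G \<subseteq> ?K" "saturated s r G" for s s' G
  proof -
    have fin: "finite (elders s r)" "finite (elders s' r)"
      using finite_elders s by auto
    have "elders s' r \<inter> G = (\<Union>y\<in>elders s r \<inter> G. {z. z \<in> elders s' r \<and> s < m y z})"
    proof (intro equalityI subsetI)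
      fix z assume z: "z \<in> elders s' r \<inter> G"
      then obtain y where "y \<in> elders s r \<inter> G" "z \<in> cell s r y"
        using saturated_decomp[OF G(1) _ G(2)] s by auto
      then show "z \<in> (\<Union>y\<in>elders s r \<inter> G. {z. z \<in> elders s' r \<and> s < m y z})"
        using z by (auto simp: cell_def)
    next
      fix z assume "z \<in> (\<Union>y\<in>elders s r \<inter> G. {z. z \<in> elders s' r \<and> s < m y z})"
      then show "z \<in> elders s' r \<inter> G"
        using G(2) unfolding saturated_def elders_def superlevel_def by auto
    qed
    also have "(\<Sum>z\<in>\<dots>. w s' z) = (\<Sum>y\<in>elders s r \<inter> G. \<Sum>z | z \<in> elders s' r \<and> s < m y z. w s' z)"
    proof (rule sum.UNION_disjoint)
      show "\<forall>y\<in>elders s r \<inter> G. \<forall>y'\<in>elders s r \<inter> G. y \<noteq> y' \<longrightarrow>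
          {z. z \<in> elders s' r \<and> s < m y z} \<inter> {z. z \<in> elders s' r \<and> s < m y' z} = {}"
        using elders_unique[of _ s r] by blast
    qed (use fin in auto)
    also have "\<dots> = (\<Sum>y\<in>elders s r \<inter> G. w s y)"
      using compat[OF s] by (intro sum.cong) auto
    finally show ?thesis by simp
  qed
  \<comment> \<open>An arbitrary admissible level. By \<open>mass\<close> the result is the same for
    all of them, so additivity can be checked at a level common to both sets.\<close>
  define lev where "lev G = (SOME s. s < r \<and> saturated s r G)" for G
  define \<mu> where "\<mu> G = (if G \<in> rel_clopen ?K then \<Sum>x\<in>elders (lev G) r \<inter> G. w (lev G) x else 0)" for G
  have \<mu>: "\<mu> G = (\<Sum>x\<in>elders s r \<inter> G. w s x)" if G: "G \<subseteq> ?K" "s < r" "saturated s r G" for s G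
  proof -
    have "lev G < r \<and> saturated (lev G) r G"
      unfolding lev_def by (rule someI[of _ s]) (use G in simp)
    then have lev: "lev G < r" "saturated (lev G) r G" by simp_all
    have "(\<Sum>x\<in>elders (lev G) r \<inter> G. w (lev G) x) = (\<Sum>x\<in>elders s r \<inter> G. w s x)"
    proof (cases "s \<le> lev G")
      case True
      show ?thesis by (rule mass[OF True lev(1) G(1,3), symmetric])
    next
      case False
      then show ?thesis by (intro mass[OF _ G(2,1) lev(2)]) simp
    qed
    then show ?thesis
      using saturated_rel_clopen[OF G] by (simp add: \<mu>_def)
  qed
  have "\<mu> \<in> clopen_measures ?K"
    unfolding clopen_measures_def mem_Collect_eq
  proof (intro conjI allI impI ballI)
    fix G H assume GH: "G \<in> rel_clopen ?K" "H \<in> rel_clopen ?K" "G \<inter> H = {}"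
    obtain s1 s2 where "s1 < r" "saturated s1 r G" "s2 < r" "saturated s2 r H"
      using GH rel_clopen_saturated by metis
    then have s: "max s1 s2 < r" "saturated (max s1 s2) r G" "saturated (max s1 s2) r H"
      using saturated_mono[of s1 r G "max s1 s2"] saturated_mono[of s2 r H "max s1 s2"] by auto
    then have sU: "saturated (max s1 s2) r (G \<union> H)"
      by (auto simp: saturated_def)
    have sub: "G \<subseteq> ?K" "H \<subseteq> ?K" using GH by (auto simp: rel_clopen_def)
    have "(elders (max s1 s2) r \<inter> G) \<inter> (elders (max s1 s2) r \<inter> H) = {}" using GH by blast
    then show "\<mu> (G \<union> H) = \<mu> G + \<mu> H"
      using \<mu>[OF sub(1) s(1,2)] \<mu>[OF sub(2) s(1,3)] \<mu>[OF _ s(1) sU] sub finite_elders[OF s(1)]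
      by (simp add: Int_Un_distrib sum.union_disjoint)
  qed (simp add: \<mu>_def)
  moreover have "bar_values r \<mu> x = v x" for x
  proof (cases "r \<in> bar_at x")
    case True
    then obtain s where s: "s \<in> reign x" "s < r" "r \<le> f x" by (auto simp: bar_at_def)
    have "\<mu> (realm x \<inter> ?K) = (\<Sum>y\<in>elders s r \<inter> (realm x \<inter> ?K). w s y)"
      by (rule \<mu>[OF _ s(2) saturated_realm[OF s(1)]]) auto
    also have "\<dots> = v x"
      unfolding elders_Int_realm using w[OF s(2)] s by (simp add: elders_def)
    finally show ?thesis
      using True by (simp add: bar_values_def)
  next
    case False
    then show ?thesis using v[of x] by (auto simp: bar_values_def)
  qed
  ultimately show ?thesis by blast
qed

lemma bij_betw_bar_values:
  "bij_betw (bar_values r) (clopen_measures (superlevel f r))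
     {v :: 'a \<Rightarrow> 'k::field. \<forall>x. v x \<noteq> 0 \<longrightarrow> r \<in> bar_at x}"
  unfolding bij_betw_def
proof (intro conjI bar_values_inj equalityI subsetI)
  fix v :: "'a \<Rightarrow> 'k" assume "v \<in> {v. \<forall>x. v x \<noteq> 0 \<longrightarrow> r \<in> bar_at x}"
  then show "v \<in> bar_values r ` clopen_measures (superlevel f r)"
    using bar_values_surj[of v r] by blast
qed (auto simp: bar_values_def split: if_splits)

text \<open>Naturality in the level. The only case beyond the definitions is a bar that contains r
  but not s: then x lies below s, and so does its whole realm, since x is eldest there.\<close>

lemma bar_values_extend:
  assumes "\<mu> \<in> clopen_measures (superlevel f s)" "r \<le> s"
  shows "bar_values r (extend_measure (superlevel f r) (superlevel f s) \<mu>) x =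
    (if r \<in> bar_at x then bar_values s \<mu> x else 0)"
proof (cases "r \<in> bar_at x")
  case True
  have "realm x \<inter> superlevel f r \<inter> superlevel f s = realm x \<inter> superlevel f s"
    using assms(2) by (auto simp: superlevel_def)
  moreover have "realm x \<inter> superlevel f s = {}" if "s \<notin> bar_at x"
  proof -
    have "f x < s" using that True assms(2) by (force simp: bar_at_def)
    then show ?thesis
      using realm_elder elder_le by (fastforce simp: superlevel_def)
  qed
  ultimately show ?thesis
    using True realm_rel_clopen[OF True] clopen_measure_empty[OF assms(1)]
    by (auto simp: bar_values_def extend_measure_def)
qed (simp add: bar_values_def)

text \<open>Only finitely many points share a given bar, so that natural numbers suffice as labels.\<close>

definition bar_of :: "'a \<Rightarrow> bar" where
  "bar_of x = (bar_at x, to_nat_on {y. bar_at y = bar_at x} x)"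

lemma countable_same_bar:
  assumes "bar_at x \<noteq> {}"
  shows "countable {y. bar_at y = bar_at x}"
proof -
  obtain r s where rs: "s \<in> reign x" "s < r" "r \<le> f x"
    using assms by (auto simp: bar_at_def)
  \<comment> \<open>\<open>finite_elders\<close> needs two distinct levels; t supplies one strictly
    below r that still belongs to the bar.\<close>
  define t where "t = (s + r) / 2"
  have t: "s < t" "t < r" using rs by (auto simp: t_def)
  have "t \<in> bar_at x" "r \<in> bar_at x"
    using rs t by (auto simp: bar_at_def intro!: bexI[OF _ rs(1)])
  have "{y. bar_at y = bar_at x} \<subseteq> elders t r"
  proof
    fix y assume "y \<in> {y. bar_at y = bar_at x}"
    then have "t \<in> bar_at y" "r \<in> bar_at y"
      using \<open>t \<in> bar_at x\<close> \<open>r \<in> bar_at x\<close> by auto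
    then show "y \<in> elders t r"
      using t(2) by (auto simp: bar_at_def elders_def intro: reign_mono)
  qed
  then show ?thesis
    using finite_elders[OF t(2)] finite_subset countable_finite by blast
qed

lemma inj_on_bar_of: "inj_on bar_of {x. bar_at x \<noteq> {}}"
proof (rule inj_onI)
  fix x y assume xy: "x \<in> {x. bar_at x \<noteq> {}}" "y \<in> {x. bar_at x \<noteq> {}}" "bar_of x = bar_of y"
  let ?A = "{z. bar_at z = bar_at x}"
  have "bar_at x = bar_at y" "to_nat_on ?A x = to_nat_on ?A y"
    using xy(3) by (auto simp: bar_of_def)
  moreover have "inj_on (to_nat_on ?A) ?A"
    using countable_same_bar[of x] xy(1) by (intro inj_on_to_nat_on) auto
  ultimately show "x = y"
    by (auto dest: inj_onD)
qed

definition elder_barcode :: "bar set" where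
  "elder_barcode = bar_of ` {x. bar_at x \<noteq> {}}"

text \<open>The isomorphism is the composite of the passage to measures, the evaluation on realms
  and the relabelling of points by bars, with \<open>pt\<close> undoing the labels. Points with an
  empty bar carry no coordinate at any level.\<close>

lemma is_H0_barcode_elder: "is_H0_barcode TYPE('k::field) f elder_barcode"
  unfolding is_H0_barcode_def
proof (intro conjI exI allI impI ballI)
  fix \<beta> assume "\<beta> \<in> elder_barcode"
  then show "is_interval (fst \<beta>)" "fst \<beta> \<noteq> {}"
    by (auto simp: elder_barcode_def bar_of_def bar_at_interval)
next
  define pt where "pt = inv_into {x. bar_at x \<noteq> {}} bar_of"
  have pt: "bar_at (pt \<beta>) \<noteq> {}" "bar_of (pt \<beta>) = \<beta>" "bar_at (pt \<beta>) = fst \<beta>" if "\<beta> \<in> elder_barcode" for \<beta>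
  proof -
    show "bar_at (pt \<beta>) \<noteq> {}" and *: "bar_of (pt \<beta>) = \<beta>"
      using inv_into_into[OF that[unfolded elder_barcode_def]]
        f_inv_into_f[OF that[unfolded elder_barcode_def]]
      unfolding pt_def by simp_all
    show "bar_at (pt \<beta>) = fst \<beta>"
      using * by (metis bar_of_def fst_conv)
  qed
  have pt_bar_of: "pt (bar_of x) = x" if "bar_at x \<noteq> {}" for x
    unfolding pt_def using that inj_on_bar_of by (intro inv_into_f_f) auto
  define \<psi> :: "real \<Rightarrow> ('a \<Rightarrow> 'k) \<Rightarrow> bar \<Rightarrow> 'k" where
    "\<psi> r v \<beta> = (if \<beta> \<in> elder_barcode then v (pt \<beta>) else 0)" for r v \<beta>
  define \<phi> :: "real \<Rightarrow> ('a, 'k) cech_class \<Rightarrow> bar \<Rightarrow> 'k" where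
    "\<phi> r z = \<psi> r (bar_values r (cech_measure (superlevel f r) z))" for r z
  {
    fix r :: real
    have "bij_betw (\<psi> r) {v. \<forall>x. v x \<noteq> 0 \<longrightarrow> r \<in> bar_at x} (interval_product elder_barcode r)"
    proof (rule bij_betwI[where g = "\<lambda>u x. if bar_at x \<noteq> {} then u (bar_of x) else 0"])
      show "\<psi> r \<in> {v. \<forall>x. v x \<noteq> 0 \<longrightarrow> r \<in> bar_at x} \<rightarrow> interval_product elder_barcode r"
        using pt(3) by (auto simp: \<psi>_def interval_product_def split: if_splits)
      show "(\<lambda>u x. if bar_at x \<noteq> {} then u (bar_of x) else 0)
          \<in> interval_product elder_barcode r \<rightarrow> {v :: 'a \<Rightarrow> 'k. \<forall>x. v x \<noteq> 0 \<longrightarrow> r \<in> bar_at x}"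
        by (auto simp: interval_product_def bar_of_def)
      fix v :: "'a \<Rightarrow> 'k" assume v: "v \<in> {v. \<forall>x. v x \<noteq> 0 \<longrightarrow> r \<in> bar_at x}"
      show "(\<lambda>x. if bar_at x \<noteq> {} then \<psi> r v (bar_of x) else 0) = v"
        using v pt_bar_of by (auto simp: \<psi>_def elder_barcode_def fun_eq_iff)
    next
      fix u :: "bar \<Rightarrow> 'k" assume "u \<in> interval_product elder_barcode r"
      then show "\<psi> r (\<lambda>x. if bar_at x \<noteq> {} then u (bar_of x) else 0) = u"
        using pt by (auto simp: \<psi>_def interval_product_def fun_eq_iff)
    qed
    then have "bij_betw (\<psi> r \<circ> (bar_values r \<circ> cech_measure (superlevel f r)))
        (cech_H0 (superlevel f r)) (interval_product elder_barcode r)"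
      using bij_betw_trans[OF bij_betw_trans[OF bij_betw_cech_measure bij_betw_bar_values]] by blast
    moreover have "\<psi> r \<circ> (bar_values r \<circ> cech_measure (superlevel f r)) = \<phi> r"
      by (auto simp: \<phi>_def)
    ultimately show "bij_betw (\<phi> r) (cech_H0 (superlevel f r)) (interval_product elder_barcode r)"
      by simp
  next
    fix r a and z w :: "('a, 'k) cech_class"
    assume "z \<in> cech_H0 (superlevel f r)" "w \<in> cech_H0 (superlevel f r)"
    then show "\<phi> r (cech_comb a z w) = (\<lambda>\<beta>. a * \<phi> r z \<beta> + \<phi> r w \<beta>)"
      by (auto simp: \<phi>_def \<psi>_def cech_measure_comb bar_values_def)
  next
    fix r s :: real and z :: "('a, 'k) cech_class"
    assume rs: "r \<le> s" and z: "z \<in> cech_H0 (superlevel f s)"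
    have "superlevel f s \<subseteq> superlevel f r" using rs by (auto simp: superlevel_def)
    then show "\<phi> r (cech_incl (superlevel f r) z) = interval_map r (\<phi> s z)"
      using z rs pt(3)
      by (auto simp: \<phi>_def \<psi>_def cech_measure_incl interval_map_def bar_values_extend cech_measure_clopen_measures fun_eq_iff)
  }
qed

end

section \<open>Uniqueness of bar counts\<close>

text \<open>The images of the unit vectors of A span the unit vectors of A', and the latter are
  independent. A' may be infinite a priori, so its finiteness is part of the conclusion.\<close>

lemma card_le_linear_surj:
  fixes L :: "('b \<Rightarrow> 'k::field) \<Rightarrow> ('c \<Rightarrow> 'k)"
  assumes fin: "finite A"
    and lin: "\<And>a u v. (\<And>b. u b \<noteq> 0 \<Longrightarrow> b \<in> A) \<Longrightarrow> (\<And>b. v b \<noteq> 0 \<Longrightarrow> b \<in> A) \<Longrightarrow>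
        L (\<lambda>b. a * u b + v b) = (\<lambda>c. a * L u c + L v c)"
    and surj: "\<And>w. (\<And>c. w c \<noteq> 0 \<Longrightarrow> c \<in> A') \<Longrightarrow> \<exists>u. (\<forall>b. u b \<noteq> 0 \<longrightarrow> b \<in> A) \<and> L u = w"
  shows "finite A' \<and> card A' \<le> card A"
proof -
  interpret vector_space "\<lambda>(a::'k) (v::'c \<Rightarrow> 'k) c. a * v c"
    by unfold_locales (auto simp: fun_eq_iff algebra_simps)
  define \<delta> where "\<delta> b = (\<lambda>b'. if b' = b then (1::'k) else 0)" for b :: 'b
  define \<delta>' where "\<delta>' c = (\<lambda>c'. if c' = c then (1::'k) else 0)" for c :: 'c
  let ?T = "(\<lambda>b. L (\<delta> b)) ` A"
  have L_span: "L u \<in> span ?T" if "\<forall>b. u b \<noteq> 0 \<longrightarrow> b \<in> F" "F \<subseteq> A" "finite F" for u F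
    using that(3,1,2)
  proof (induction F arbitrary: u rule: finite_induct)
    case empty
    then have u: "u = (\<lambda>_. 0)" by auto
    \<comment> \<open>Linearity with a = -1 reads L 0 = - L 0 + L 0.\<close>
    have "L u c = 0" for c
      using lin[of u u "- 1"] unfolding u by (simp add: fun_eq_iff)
    then have "L u = 0"
      by (simp add: fun_eq_iff)
    then show ?case
      using span_zero[of ?T] by metis
  next
    case (insert b F)
    define u' where "u' = u(b := 0)"
    have u': "\<forall>x. u' x \<noteq> 0 \<longrightarrow> x \<in> F"
      using insert(4) by (auto simp: u'_def)
    have "L (\<lambda>x. u b * \<delta> b x + u' x) = (\<lambda>c. u b * L (\<delta> b) c + L u' c)"
      by (rule lin) (use insert(5) u' in \<open>auto simp: \<delta>_def split: if_splits\<close>)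
    moreover have "(\<lambda>x. u b * \<delta> b x + u' x) = u"
      by (auto simp: \<delta>_def u'_def)
    ultimately have "L u = (\<lambda>c. u b * L (\<delta> b) c) + L u'"
      by (simp add: fun_eq_iff)
    moreover have "L u' \<in> span ?T"
      using insert(3)[OF u'] insert(5) by auto
    moreover have "(\<lambda>c. u b * L (\<delta> b) c) \<in> span ?T"
      using insert(5) by (intro span_scale span_base) auto
    ultimately show ?case
      using span_add by metis
  qed
  have "\<delta>' ` A' \<subseteq> span ?T"
  proof
    fix w assume "w \<in> \<delta>' ` A'"
    then have "\<And>c. w c \<noteq> 0 \<Longrightarrow> c \<in> A'"
      by (auto simp: \<delta>'_def split: if_splits)
    then obtain u where "\<forall>b. u b \<noteq> 0 \<longrightarrow> b \<in> A" "L u = w"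
      using surj by metis
    then show "w \<in> span ?T"
      using L_span[of u A] fin by auto
  qed
  moreover have "independent (\<delta>' ` A')"
  proof
    assume "dependent (\<delta>' ` A')"
    then obtain t u v where t: "finite t" "t \<subseteq> \<delta>' ` A'" "(\<Sum>v\<in>t. (\<lambda>c. u v * v c)) = 0" "v \<in> t" "u v \<noteq> 0"
      unfolding dependent_explicit by blast
    obtain c where c: "v = \<delta>' c" using t by blast
    have "(\<Sum>v\<in>t. (\<lambda>c. u v * v c)) c = (\<Sum>v\<in>t. u v * v c)"
      using t(1) by (induction t rule: finite_induct) auto
    also have "\<dots> = (\<Sum>w\<in>t. if w = v then u v else 0)"
    proof (rule sum.cong)
      fix w assume "w \<in> t"
      then obtain c' where c': "w = \<delta>' c'" using t by blast
      have "v c = 1" "c' \<noteq> c \<Longrightarrow> w c = 0" "c' = c \<Longrightarrow> w = v"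
        unfolding c c' by (auto simp: \<delta>'_def)
      then show "u w * w c = (if w = v then u v else 0)"
        by (cases "c' = c") auto
    qed simp
    also have "\<dots> = u v"
      using t by simp
    finally show False
      using t by simp
  qed
  ultimately have *: "finite (\<delta>' ` A')" "card (\<delta>' ` A') \<le> card ?T"
    using independent_span_bound[of ?T "\<delta>' ` A'"] fin by auto
  have inj: "inj_on \<delta>' A'"
    by (rule inj_onI) (auto simp: \<delta>'_def fun_eq_iff split: if_splits)
  have "finite A'"
    using *(1) inj by (rule finite_imageD)
  moreover have "card A' \<le> card A"
    using *(2) card_image[OF inj] card_image_le[OF fin, of "\<lambda>b. L (\<delta> b)"] by simp
  ultimately show ?thesis by simp
qed

text \<open>A vector on the bars of B' through r and s comes from a class at level s. The image of
  this class at level r, read in the coordinates of B, is supported on the bars of B through r and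
  s. So the change of coordinates at r maps vectors on these bars onto all those of B'; exchanging
  the barcodes gives equality.\<close>

lemma barcode_count_le:
  assumes B: "is_H0_barcode TYPE('k::field) f B" and B': "is_H0_barcode TYPE('k) f B'"
    and "r \<le> s" and fin: "finite {\<beta>\<in>B. r \<in> fst \<beta> \<and> s \<in> fst \<beta>}"
  shows "finite {\<beta>\<in>B'. r \<in> fst \<beta> \<and> s \<in> fst \<beta>} \<and>
    card {\<beta>\<in>B'. r \<in> fst \<beta> \<and> s \<in> fst \<beta>} \<le> card {\<beta>\<in>B. r \<in> fst \<beta> \<and> s \<in> fst \<beta>}"
proof -
  let ?H = "\<lambda>r. cech_H0 (superlevel f r) :: ('a, 'k) cech_class set"
  obtain \<phi> where "\<forall>r. bij_betw (\<phi> r) (?H r) (interval_product B r)"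
    "\<forall>r a. \<forall>z\<in>?H r. \<forall>w\<in>?H r. \<phi> r (cech_comb a z w) = (\<lambda>\<beta>. a * \<phi> r z \<beta> + \<phi> r w \<beta>)"
    "\<forall>r s. r \<le> s \<longrightarrow> (\<forall>z\<in>?H s. \<phi> r (cech_incl (superlevel f r) z) = interval_map r (\<phi> s z))"
    using B unfolding is_H0_barcode_def by (elim conjE exE) (rule that)
  then have bij: "\<And>r. bij_betw (\<phi> r) (?H r) (interval_product B r)"
    and comb: "\<And>r a z w. z \<in> ?H r \<Longrightarrow> w \<in> ?H r \<Longrightarrow> \<phi> r (cech_comb a z w) = (\<lambda>\<beta>. a * \<phi> r z \<beta> + \<phi> r w \<beta>)"
    and incl: "\<And>r s z. r \<le> s \<Longrightarrow> z \<in> ?H s \<Longrightarrow> \<phi> r (cech_incl (superlevel f r) z) = interval_map r (\<phi> s z)"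
    by simp_all
  obtain \<phi>' where "\<forall>r. bij_betw (\<phi>' r) (?H r) (interval_product B' r)"
    "\<forall>r a. \<forall>z\<in>?H r. \<forall>w\<in>?H r. \<phi>' r (cech_comb a z w) = (\<lambda>\<beta>. a * \<phi>' r z \<beta> + \<phi>' r w \<beta>)"
    "\<forall>r s. r \<le> s \<longrightarrow> (\<forall>z\<in>?H s. \<phi>' r (cech_incl (superlevel f r) z) = interval_map r (\<phi>' s z))"
    using B' unfolding is_H0_barcode_def by (elim conjE exE) (rule that)
  then have bij': "\<And>r. bij_betw (\<phi>' r) (?H r) (interval_product B' r)"
    and comb': "\<And>r a z w. z \<in> ?H r \<Longrightarrow> w \<in> ?H r \<Longrightarrow> \<phi>' r (cech_comb a z w) = (\<lambda>\<beta>. a * \<phi>' r z \<beta> + \<phi>' r w \<beta>)"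
    and incl': "\<And>r s z. r \<le> s \<Longrightarrow> z \<in> ?H s \<Longrightarrow> \<phi>' r (cech_incl (superlevel f r) z) = interval_map r (\<phi>' s z)"
    by simp_all
  define G where "G = inv_into (?H r) (\<phi> r)"
  have G: "G u \<in> ?H r" "\<phi> r (G u) = u" if "u \<in> interval_product B r" for u
    using that bij[of r] unfolding G_def bij_betw_def
    by (metis inv_into_into, metis f_inv_into_f)
  have G_\<phi>: "G (\<phi> r z) = z" if "z \<in> ?H r" for z
    using that bij[of r] unfolding G_def bij_betw_def by (metis inv_into_f_f)
  have sub: "superlevel f s \<subseteq> superlevel f r"
    using \<open>r \<le> s\<close> by (auto simp: superlevel_def)
  show ?thesis
  proof (rule card_le_linear_surj[where L = "\<lambda>u. \<phi>' r (G u)", OF fin])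
    fix a :: 'k and u v :: "bar \<Rightarrow> 'k"
    assume "\<And>b. u b \<noteq> 0 \<Longrightarrow> b \<in> {\<beta>\<in>B. r \<in> fst \<beta> \<and> s \<in> fst \<beta>}"
      and "\<And>b. v b \<noteq> 0 \<Longrightarrow> b \<in> {\<beta>\<in>B. r \<in> fst \<beta> \<and> s \<in> fst \<beta>}"
    then have uv: "u \<in> interval_product B r" "v \<in> interval_product B r"
      unfolding interval_product_def by blast+
    have "G (\<lambda>b. a * u b + v b) = cech_comb a (G u) (G v)"
      using G_\<phi>[OF cech_comb_cech_H0[OF G(1)[OF uv(1)] G(1)[OF uv(2)]], of a] comb[of "G u" r "G v" a] G uv
      by simp
    then show "\<phi>' r (G (\<lambda>b. a * u b + v b)) = (\<lambda>c. a * \<phi>' r (G u) c + \<phi>' r (G v) c)"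
      using comb' G(1) uv by simp
  next
    fix w :: "bar \<Rightarrow> 'k" assume w: "\<And>c. w c \<noteq> 0 \<Longrightarrow> c \<in> {\<beta>\<in>B'. r \<in> fst \<beta> \<and> s \<in> fst \<beta>}"
    then have "w \<in> interval_product B' s"
      unfolding interval_product_def by auto
    then have "w \<in> \<phi>' s ` ?H s"
      using bij'[of s] by (simp add: bij_betw_def)
    then obtain z where z: "z \<in> ?H s" "\<phi>' s z = w"
      by (elim imageE) (rule that, simp_all)
    define u where "u = \<phi> r (cech_incl (superlevel f r) z)"
    have incl_z: "cech_incl (superlevel f r) z \<in> ?H r"
      by (rule cech_incl_cech_H0[OF z(1) sub])
    have "u = interval_map r (\<phi> s z)"
      unfolding u_def by (rule incl[OF \<open>r \<le> s\<close> z(1)])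
    moreover have "\<phi> s z \<in> interval_product B s"
      using bij[of s] z(1) unfolding bij_betw_def by blast
    ultimately have "\<forall>b. u b \<noteq> 0 \<longrightarrow> b \<in> {\<beta>\<in>B. r \<in> fst \<beta> \<and> s \<in> fst \<beta>}"
      by (auto simp: interval_map_def interval_product_def)
    moreover have "\<phi>' r (G u) = w"
    proof -
      have "\<phi>' r (G u) = interval_map r w"
        unfolding u_def G_\<phi>[OF incl_z] incl'[OF \<open>r \<le> s\<close> z(1)] z(2) by simp
      also have "\<dots> = w"
        using w by (force simp: interval_map_def fun_eq_iff)
      finally show ?thesis .
    qed
    ultimately show "\<exists>u. (\<forall>b. u b \<noteq> 0 \<longrightarrow> b \<in> {\<beta>\<in>B. r \<in> fst \<beta> \<and> s \<in> fst \<beta>}) \<and> \<phi>' r (G u) = w"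
      by blast
  qed
qed

lemma barcode_count_eq:
  assumes "is_H0_barcode TYPE('k::field) f B" "is_H0_barcode TYPE('k) f B'"
    and "r \<le> s" "finite {\<beta>\<in>B. r \<in> fst \<beta> \<and> s \<in> fst \<beta>}"
  shows "finite {\<beta>\<in>B'. r \<in> fst \<beta> \<and> s \<in> fst \<beta>}"
    "card {\<beta>\<in>B'. r \<in> fst \<beta> \<and> s \<in> fst \<beta>} = card {\<beta>\<in>B. r \<in> fst \<beta> \<and> s \<in> fst \<beta>}"
  using barcode_count_le[OF assms] barcode_count_le[OF assms(2,1,3)] by auto

context merge_tree
begin

definition alive :: "real \<Rightarrow> real \<Rightarrow> 'a set" where
  "alive r s = {x. r \<in> bar_at x \<and> s \<in> bar_at x}"

lemma finite_alive:
  assumes "r < s"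
  shows "finite (alive r s)"
proof (rule finite_subset[OF _ finite_elders[OF assms]])
  show "alive r s \<subseteq> elders r s"
    using assms by (auto simp: alive_def bar_at_def elders_def intro: reign_mono)
qed

lemma barcode_alive:
  assumes "is_H0_barcode TYPE('k::field) f B" "r < s"
  shows "finite {\<beta>\<in>B. r \<in> fst \<beta> \<and> s \<in> fst \<beta>}"
    "card {\<beta>\<in>B. r \<in> fst \<beta> \<and> s \<in> fst \<beta>} = card (alive r s)"
proof -
  have eq: "{\<beta>\<in>elder_barcode. r \<in> fst \<beta> \<and> s \<in> fst \<beta>} = bar_of ` alive r s"
    by (auto simp: elder_barcode_def alive_def bar_of_def)
  have "inj_on bar_of (alive r s)"
    by (rule inj_on_subset[OF inj_on_bar_of]) (auto simp: alive_def)
  then have card: "card {\<beta>\<in>elder_barcode. r \<in> fst \<beta> \<and> s \<in> fst \<beta>} = card (alive r s)"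
    unfolding eq by (rule card_image)
  have fin: "finite {\<beta>\<in>elder_barcode. r \<in> fst \<beta> \<and> s \<in> fst \<beta>}"
    unfolding eq using finite_alive[OF assms(2)] by simp
  show "finite {\<beta>\<in>B. r \<in> fst \<beta> \<and> s \<in> fst \<beta>}"
    "card {\<beta>\<in>B. r \<in> fst \<beta> \<and> s \<in> fst \<beta>} = card (alive r s)"
    using barcode_count_eq[OF is_H0_barcode_elder assms(1) _ fin] assms(2) card by auto
qed

end

section \<open>Covering numbers and box dimension\<close>

lemma covering_number_le:
  assumes "finite C" "C \<subseteq> S" "S \<subseteq> (\<Union>c\<in>C. {y. d c y \<le> \<epsilon>})"
  shows "covering_number S d \<epsilon> \<le> enat (card C)"
  unfolding covering_number_def using assms by (intro Inf_lower) blast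

lemma covering_number_attained:
  assumes "covering_number S d \<epsilon> = enat n"
  obtains C where "finite C" "C \<subseteq> S" "S \<subseteq> (\<Union>c\<in>C. {y. d c y \<le> \<epsilon>})" "card C = n"
proof -
  let ?A = "{enat (card C) | C. finite C \<and> C \<subseteq> S \<and> S \<subseteq> (\<Union>c\<in>C. {y. d c y \<le> \<epsilon>})}"
  have inf: "Inf ?A = enat n"
    using assms by (simp add: covering_number_def)
  then have "?A \<noteq> {}"
    by (metis (no_types) Inf_enat_def enat.distinct(1))
  then have "Inf ?A \<in> ?A"
    unfolding Inf_enat_def using LeastI_ex[of "\<lambda>x. x \<in> ?A"] by (simp only: if_False ex_in_conv simp_thms)
  then have "enat n \<in> ?A"
    by (simp only: inf)
  then show ?thesis
    using that by auto
qed

text \<open>Surjectivity is asked only up to distance, so that the lemma applies both to the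
  quotient map onto the tree and to a choice of representatives in the opposite direction.\<close>

lemma covering_number_mono_map:
  assumes "\<And>x. x \<in> S \<Longrightarrow> h x \<in> S'"
    and "\<And>y. y \<in> S' \<Longrightarrow> \<exists>x\<in>S. \<forall>c\<in>S. d' (h c) y = d c x"
  shows "covering_number S' d' \<epsilon> \<le> covering_number S d \<epsilon>"
proof (cases "covering_number S d \<epsilon>")
  case (enat n)
  then obtain C where C: "finite C" "C \<subseteq> S" "S \<subseteq> (\<Union>c\<in>C. {y. d c y \<le> \<epsilon>})" "card C = n"
    by (rule covering_number_attained)
  have "covering_number S' d' \<epsilon> \<le> enat (card (h ` C))"
  proof (rule covering_number_le)
    show "S' \<subseteq> (\<Union>c\<in>h ` C. {y. d' c y \<le> \<epsilon>})"
    proof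
      fix y assume "y \<in> S'"
      then obtain x where x: "x \<in> S" "\<And>c. c \<in> S \<Longrightarrow> d' (h c) y = d c x"
        using assms(2) by metis
      then obtain c where "c \<in> C" "d c x \<le> \<epsilon>"
        using C(3) by blast
      then show "y \<in> (\<Union>c\<in>h ` C. {y. d' c y \<le> \<epsilon>})"
        using x(2)[of c] C(2) by (intro UN_I[of "h c"]) auto
    qed
  qed (use C assms(1) in auto)
  also have "\<dots> \<le> enat n"
    using card_image_le[OF C(1), of h] C(4) by simp
  finally show ?thesis
    using enat by simp
qed simp

lemma upper_box_dim_nonneg: "0 \<le> upper_box_dim S d"
  unfolding upper_box_dim_def
proof (rule le_Limsup)
  have "eventually (\<lambda>\<epsilon>::real. \<epsilon> < 1) (at_right 0)"
    by real_asymp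
  moreover have "eventually (\<lambda>\<epsilon>::real. \<epsilon> > 0) (at_right 0)"
    by real_asymp
  ultimately show "\<forall>\<^sub>F \<epsilon> in at_right 0. 0 \<le>
      (case covering_number S d \<epsilon> of enat n \<Rightarrow> ereal (ln (real n) / ln (1 / \<epsilon>)) | \<infinity> \<Rightarrow> \<infinity>)"
  proof eventually_elim
    case (elim \<epsilon>)
    have "0 \<le> ln (real n)" for n :: nat
      by (cases "n = 0") auto
    moreover have "0 \<le> ln (1 / \<epsilon>)"
      using elim by simp
    ultimately show ?case
      by (auto split: enat.split)
  qed
qed simp

text \<open>The factor K contributes ln K / ln (1 / \<epsilon>), which tends to 0.\<close>

lemma upper_box_dim_le:
  assumes "0 \<le> q" "1 \<le> K" "0 < \<epsilon>0"
    and cover: "\<And>\<epsilon>. 0 < \<epsilon> \<Longrightarrow> \<epsilon> < \<epsilon>0 \<Longrightarrow> \<exists>C. finite C \<and> C \<subseteq> S \<and> S \<subseteq> (\<Union>c\<in>C. {y. d c y \<le> \<epsilon>}) \<and>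
          real (card C) \<le> K * \<epsilon> powr (- q)"
  shows "upper_box_dim S d \<le> ereal q"
proof -
  have lim: "((\<lambda>\<epsilon>. ln K / ln (1 / \<epsilon>) + q) \<longlongrightarrow> q) (at_right 0)"
    by real_asymp
  have small: "eventually (\<lambda>\<epsilon>::real. 0 < \<epsilon> \<and> \<epsilon> < min \<epsilon>0 1) (at_right 0)"
    using assms(3) by (auto simp: eventually_at_right_field intro: exI[of _ "min \<epsilon>0 1"])
  have "upper_box_dim S d \<le> Limsup (at_right 0) (\<lambda>\<epsilon>. ereal (ln K / ln (1 / \<epsilon>) + q))"
    unfolding upper_box_dim_def
  proof (rule Limsup_mono, rule eventually_mono[OF small])
    fix \<epsilon> :: real assume \<epsilon>: "0 < \<epsilon> \<and> \<epsilon> < min \<epsilon>0 1"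
    then obtain C where C: "finite C" "C \<subseteq> S" "S \<subseteq> (\<Union>c\<in>C. {y. d c y \<le> \<epsilon>})"
      "real (card C) \<le> K * \<epsilon> powr (- q)"
      using cover[of \<epsilon>] by auto
    then obtain n where n: "covering_number S d \<epsilon> = enat n" "n \<le> card C"
      using covering_number_le[OF C(1-3)] by (cases "covering_number S d \<epsilon>") auto
    have ln_pos: "0 < ln (1 / \<epsilon>)"
      using \<epsilon> by (intro ln_gt_zero) auto
    have lnr: "ln (K * \<epsilon> powr (- q)) = ln K + q * ln (1 / \<epsilon>)"
      using assms(2) \<epsilon> by (simp add: ln_mult ln_powr ln_div)
    have "ln (real n) \<le> ln K + q * ln (1 / \<epsilon>)"
    proof (cases "n = 0")
      case True
      then show ?thesis
        using assms(1,2) ln_pos by simp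
    next
      case False
      then have "ln (real n) \<le> ln (K * \<epsilon> powr (- q))"
        using n(2) C(4) by (intro ln_mono) auto
      then show ?thesis using lnr by simp
    qed
    then have "ln (real n) / ln (1 / \<epsilon>) \<le> ln K / ln (1 / \<epsilon>) + q"
      using ln_pos by (simp add: divide_simps)
    then show "(case covering_number S d \<epsilon> of enat n \<Rightarrow> ereal (ln (real n) / ln (1 / \<epsilon>)) | \<infinity> \<Rightarrow> \<infinity>)
        \<le> ereal (ln K / ln (1 / \<epsilon>) + q)"
      using n(1) by simp
  qed
  also have "\<dots> = ereal q"
    by (intro lim_imp_Limsup) (use lim in auto)
  finally show ?thesis .
qed

lemma upper_box_dim_less:
  assumes "upper_box_dim S d < ereal q"
  obtains \<epsilon>0 where "0 < \<epsilon>0" "\<And>\<epsilon>. 0 < \<epsilon> \<Longrightarrow> \<epsilon> < \<epsilon>0 \<Longrightarrow>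
     \<exists>C. finite C \<and> C \<subseteq> S \<and> S \<subseteq> (\<Union>c\<in>C. {y. d c y \<le> \<epsilon>}) \<and> real (card C) \<le> \<epsilon> powr (- q)"
proof -
  have "\<forall>\<^sub>F \<epsilon> in at_right 0.
      (case covering_number S d \<epsilon> of enat n \<Rightarrow> ereal (ln (real n) / ln (1 / \<epsilon>)) | \<infinity> \<Rightarrow> \<infinity>) < ereal q"
    using assms unfolding upper_box_dim_def by (rule Limsup_lessD)
  then obtain b where b: "b > 0" "\<And>\<epsilon>. 0 < \<epsilon> \<Longrightarrow> \<epsilon> < b \<Longrightarrow>
      (case covering_number S d \<epsilon> of enat n \<Rightarrow> ereal (ln (real n) / ln (1 / \<epsilon>)) | \<infinity> \<Rightarrow> \<infinity>) < ereal q"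
    by (auto simp: eventually_at_right_field)
  show ?thesis
  proof (rule that[of "min b 1"])
    fix \<epsilon> :: real assume \<epsilon>: "0 < \<epsilon>" "\<epsilon> < min b 1"
    have less: "(case covering_number S d \<epsilon> of enat n \<Rightarrow> ereal (ln (real n) / ln (1 / \<epsilon>)) | \<infinity> \<Rightarrow> \<infinity>) < ereal q"
      using b(2) \<epsilon> by auto
    then obtain n where n: "covering_number S d \<epsilon> = enat n"
      by (cases "covering_number S d \<epsilon>") auto
    then obtain C where C: "finite C" "C \<subseteq> S" "S \<subseteq> (\<Union>c\<in>C. {y. d c y \<le> \<epsilon>})" "card C = n"
      by (rule covering_number_attained)
    have "real n \<le> \<epsilon> powr (- q)"
    proof (cases "n = 0")
      case False
      have "0 < ln (1 / \<epsilon>)"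
        using \<epsilon> by (intro ln_gt_zero) auto
      then have "ln (real n) < q * ln (1 / \<epsilon>)"
        using less by (simp add: n divide_simps)
      also have "\<dots> = ln (\<epsilon> powr (- q))"
        using \<epsilon> by (simp add: ln_powr ln_div)
      finally have "real n < \<epsilon> powr (- q)"
        by (subst (asm) ln_less_cancel_iff) (use False \<epsilon> in auto)
      then show ?thesis by simp
    qed simp
    then show "\<exists>C. finite C \<and> C \<subseteq> S \<and> S \<subseteq> (\<Union>c\<in>C. {y. d c y \<le> \<epsilon>}) \<and> real (card C) \<le> \<epsilon> powr (- q)"
      using C by blast
  qed (use b(1) in auto)
qed

text \<open>A ball of radius \<epsilon> has its image under the 1-Lipschitz map g in an interval of
  length 2 \<epsilon>, so N balls can cover only if 2 N \<epsilon> \<ge> b - a. With N \<le>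
  \<epsilon> powr (- q) and q < 1 the left side tends to 0.\<close>

lemma upper_box_dim_ge_1:
  assumes lip: "\<And>x y. x \<in> S \<Longrightarrow> y \<in> S \<Longrightarrow> \<bar>g x - g y\<bar> \<le> d x y"
    and "a < b" "{a..b} \<subseteq> g ` S"
  shows "1 \<le> upper_box_dim S d"
proof (rule ccontr)
  assume "\<not> 1 \<le> upper_box_dim S d"
  then obtain q where q: "upper_box_dim S d < ereal q" "ereal q < 1"
    by (metis ereal_dense2 not_le)
  from upper_box_dim_less[OF q(1)] obtain \<epsilon>0 where \<epsilon>0: "0 < \<epsilon>0" "\<And>\<epsilon>. 0 < \<epsilon> \<Longrightarrow> \<epsilon> < \<epsilon>0 \<Longrightarrow>
     \<exists>C. finite C \<and> C \<subseteq> S \<and> S \<subseteq> (\<Union>c\<in>C. {y. d c y \<le> \<epsilon>}) \<and> real (card C) \<le> \<epsilon> powr (- q)"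
    by metis
  have le: "b - a \<le> 2 * \<epsilon> powr (1 - q)" if \<epsilon>: "0 < \<epsilon>" "\<epsilon> < \<epsilon>0" for \<epsilon>
  proof -
    obtain C where C: "finite C" "C \<subseteq> S" "S \<subseteq> (\<Union>c\<in>C. {y. d c y \<le> \<epsilon>})" "real (card C) \<le> \<epsilon> powr (- q)"
      using \<epsilon>0(2)[OF \<epsilon>] by blast
    have sub: "{a..b} \<subseteq> (\<Union>c\<in>C. {g c - \<epsilon>..g c + \<epsilon>})"
    proof
      fix t assume "t \<in> {a..b}"
      then obtain x where x: "x \<in> S" "t = g x" using assms(3) by blast
      then obtain c where c: "c \<in> C" "d c x \<le> \<epsilon>" using C(3) by blast
      then have "\<bar>g c - g x\<bar> \<le> \<epsilon>"
        using lip[of c x] x(1) C(2) by fastforce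
      then show "t \<in> (\<Union>c\<in>C. {g c - \<epsilon>..g c + \<epsilon>})"
        using c(1) x(2) by (intro UN_I[of c]) auto
    qed
    have "b - a = measure lborel {a..b}"
      using assms(2) by simp
    also have "\<dots> \<le> measure lborel (\<Union>c\<in>C. {g c - \<epsilon>..g c + \<epsilon>})"
      by (rule measure_mono_fmeasurable[OF sub _ fmeasurable_compact[OF compact_UN]]) (use C(1) in auto)
    also have "\<dots> \<le> (\<Sum>c\<in>C. measure lborel {g c - \<epsilon>..g c + \<epsilon>})"
      by (rule measure_UNION_le[OF C(1)]) auto
    also have "\<dots> = real (card C) * (2 * \<epsilon>)"
      using \<epsilon> by simp
    also have "\<dots> \<le> \<epsilon> powr (- q) * (2 * \<epsilon>)"
      using C(4) \<epsilon> by (intro mult_right_mono) auto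
    also have "\<dots> = 2 * \<epsilon> powr (1 - q)"
      using \<epsilon> powr_add[of \<epsilon> "- q" 1] by (simp add: add.commute)
    finally show ?thesis .
  qed
  have "0 < 1 - q" using q(2) by (simp add: one_ereal_def)
  then have "((\<lambda>\<epsilon>. 2 * \<epsilon> powr (1 - q)) \<longlongrightarrow> 2 * 0) (at_right 0)"
    by (intro tendsto_mult tendsto_const) real_asymp
  moreover have "eventually (\<lambda>\<epsilon>. b - a \<le> 2 * \<epsilon> powr (1 - q)) (at_right 0)"
    using le \<epsilon>0(1) by (auto simp: eventually_at_right_field)
  ultimately have "b - a \<le> 2 * 0"
    by (intro tendsto_lowerbound) auto
  then show False using assms(2) by simp
qed

text \<open>Dyadic slicing: the terms of size between \<open>h / 2 ^ Suc j\<close> and \<open>h / 2 ^ j\<close> contribute at most the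
  \<open>j\<close>-th term of a geometric series.\<close>

lemma sum_powr_bounded:
  fixes len :: "'b \<Rightarrow> real"
  assumes "0 \<le> q" "q < p" "0 < h"
    and len: "\<And>\<beta>. \<beta> \<in> B \<Longrightarrow> 0 \<le> len \<beta>" "\<And>\<beta>. \<beta> \<in> B \<Longrightarrow> len \<beta> \<le> M"
    and fin: "\<And>\<eta>. 0 < \<eta> \<Longrightarrow> \<eta> \<le> h \<Longrightarrow> finite {\<beta>\<in>B. \<eta> \<le> len \<beta>}"
    and count: "\<And>\<eta>. 0 < \<eta> \<Longrightarrow> \<eta> \<le> h \<Longrightarrow> real (card {\<beta>\<in>B. \<eta> \<le> len \<beta>}) \<le> K * \<eta> powr (- q)"
  obtains S where "\<And>F. finite F \<Longrightarrow> F \<subseteq> B \<Longrightarrow> (\<Sum>\<beta>\<in>F. len \<beta> powr p) \<le> S"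
proof -
  \<comment> \<open>Slice j has at most K (h / 2 ^ Suc j) powr (- q) members, each contributing at
    most (h / 2 ^ j) powr p. The product is T r ^ j, and r < 1 because q < p.\<close>
  define r where "r = 2 powr (q - p)"
  have r: "0 < r" "r < 1"
    using assms(2) unfolding r_def by (auto simp: powr_less_one)
  define T where "T = K * h powr (p - q) * 2 powr q"
  have K: "0 \<le> K"
  proof -
    have "0 \<le> K * h powr (- q)"
      using count[of h] assms(3) by (meson of_nat_0_le_iff order_refl order_trans)
    then show ?thesis
      using assms(3) by (simp add: zero_le_mult_iff)
  qed
  define A where "A j = {\<beta>\<in>B. h / 2 ^ Suc j \<le> len \<beta> \<and> len \<beta> < h / 2 ^ j}" for j :: nat
  have A: "finite (A j)" "(\<Sum>\<beta>\<in>A j. len \<beta> powr p) \<le> T * r ^ j" for j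
  proof -
    have \<eta>: "0 < h / 2 ^ Suc j" "h / 2 ^ Suc j \<le> h"
    proof -
      have "h / 2 ^ Suc j \<le> h / 1"
        using assms(3) by (intro divide_left_mono one_le_power) auto
      then show "0 < h / 2 ^ Suc j" "h / 2 ^ Suc j \<le> h"
        using assms(3) by simp_all
    qed
    have sub: "A j \<subseteq> {\<beta>\<in>B. h / 2 ^ Suc j \<le> len \<beta>}" by (auto simp: A_def)
    then show "finite (A j)"
      using fin[OF \<eta>] finite_subset by blast
    have "(\<Sum>\<beta>\<in>A j. len \<beta> powr p) \<le> (\<Sum>\<beta>\<in>A j. (h / 2 ^ j) powr p)"
      using assms(1,2) len(1) by (intro sum_mono powr_mono2) (auto simp: A_def)
    also have "\<dots> = real (card (A j)) * (h / 2 ^ j) powr p" by simp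
    also have "\<dots> \<le> (K * (h / 2 ^ Suc j) powr (- q)) * (h / 2 ^ j) powr p"
      using count[OF \<eta>] card_mono[OF fin[OF \<eta>] sub] by (intro mult_right_mono) (auto intro: order_trans[rotated])
    also have "\<dots> = T * r ^ j"
    proof -
      have hn: "(h / 2 ^ n) powr t = h powr t * 2 powr (- real n * t)" for n t
      proof -
        have "h / 2 ^ n = h * 2 powr (- real n)"
          by (simp add: powr_minus powr_realpow divide_inverse)
        then show ?thesis
          using assms(3) by (simp add: powr_mult powr_powr)
      qed
      have a: "r ^ j = 2 powr ((q - p) * real j)"
        by (simp add: r_def powr_powr powr_realpow[symmetric])
      have b: "(h / 2 ^ Suc j) powr (- q) = h powr (- q) * 2 powr (q * real (Suc j))"
        by (simp only: hn) (simp only: minus_mult_minus mult.commute)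
      have c: "(h / 2 ^ j) powr p = h powr p * 2 powr (- (p * real j))"
        by (simp add: hn mult.commute)
      have d: "h powr (- q) * h powr p = h powr (p - q)"
        by (simp add: powr_add[symmetric])
      have e: "2 powr (q * real (Suc j)) * 2 powr (- (p * real j)) = 2 powr q * 2 powr ((q - p) * real j)"
        by (simp add: powr_add[symmetric] algebra_simps)
      have "(K * (h / 2 ^ Suc j) powr (- q)) * (h / 2 ^ j) powr p =
          K * (h powr (- q) * h powr p) * (2 powr (q * real (Suc j)) * 2 powr (- (p * real j)))"
        unfolding b c by (simp only: ac_simps)
      also have "\<dots> = T * r ^ j"
        unfolding a d e T_def by (simp only: ac_simps)
      finally show ?thesis .
    qed
    finally show "(\<Sum>\<beta>\<in>A j. len \<beta> powr p) \<le> T * r ^ j" .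
  qed
  define L where "L = {\<beta>\<in>B. h \<le> len \<beta>}"
  have finL: "finite L" using fin[of h] assms(3) by (simp add: L_def)
  show ?thesis
  proof (rule that[of "(\<Sum>\<beta>\<in>L. len \<beta> powr p) + T / (1 - r)"])
    fix F assume F: "finite F" "F \<subseteq> B"
    \<comment> \<open>Terms of length 0 lie in no slice, but they contribute 0.\<close>
    define F' where "F' = {\<beta>\<in>F. 0 < len \<beta>}"
    have "\<exists>N. F' \<subseteq> L \<union> (\<Union>j<N. A j)"
    proof -
      have "\<exists>j. \<beta> \<in> L \<union> A j" if "\<beta> \<in> F'" for \<beta>
      proof (cases "h \<le> len \<beta>")
        case False
        have pos: "0 < len \<beta>" "\<beta> \<in> B" using that F by (auto simp: F'_def)
        define j where "j = (LEAST n. h / 2 ^ Suc n \<le> len \<beta>)"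
        have "\<exists>n. h / 2 ^ Suc n \<le> len \<beta>"
        proof -
          obtain n where "h / len \<beta> < 2 ^ n"
            using real_arch_pow[of 2 "h / len \<beta>"] by auto
          also have "(2::real) ^ n \<le> 2 ^ Suc n" by simp
          finally show ?thesis
            using pos by (intro exI[of _ n]) (simp add: field_simps)
        qed
        then have le: "h / 2 ^ Suc j \<le> len \<beta>"
          unfolding j_def by (rule LeastI_ex)
        have "len \<beta> < h / 2 ^ j"
        proof (cases j)
          case 0
          then show ?thesis using False by simp
        next
          case (Suc i)
          then have "\<not> h / 2 ^ Suc i \<le> len \<beta>"
            using not_less_Least[of i "\<lambda>n. h / 2 ^ Suc n \<le> len \<beta>"] by (simp add: j_def)
          then show ?thesis using Suc by simp
        qed
        then show ?thesis
          using le pos by (auto simp: A_def)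
      qed (use that F in \<open>auto simp: L_def F'_def\<close>)
      then obtain J where J: "\<And>\<beta>. \<beta> \<in> F' \<Longrightarrow> \<beta> \<in> L \<union> A (J \<beta>)" by metis
      have "finite F'" using F by (simp add: F'_def)
      then have "F' \<subseteq> L \<union> (\<Union>j<Suc (Max (insert 0 (J ` F'))). A j)"
        using J by (fastforce simp: less_Suc_eq_le)
      then show ?thesis by blast
    qed
    then obtain N where N: "F' \<subseteq> L \<union> (\<Union>j<N. A j)" by blast
    have "(\<Sum>\<beta>\<in>F. len \<beta> powr p) = (\<Sum>\<beta>\<in>F'. len \<beta> powr p)"
      using F len(1) by (intro sum.mono_neutral_right) (auto simp: F'_def less_le)
    also have "\<dots> \<le> (\<Sum>\<beta>\<in>L \<union> (\<Union>j<N. A j). len \<beta> powr p)"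
      using N finL A(1) by (intro sum_mono2) auto
    also have "\<dots> \<le> (\<Sum>\<beta>\<in>L. len \<beta> powr p) + (\<Sum>\<beta>\<in>(\<Union>j<N. A j). len \<beta> powr p)"
      using finL A(1) by (simp add: sum_Un sum_nonneg)
    also have "(\<Sum>\<beta>\<in>(\<Union>j<N. A j). len \<beta> powr p) \<le> (\<Sum>j<N. \<Sum>\<beta>\<in>A j. len \<beta> powr p)"
    proof (induction N)
      case (Suc N)
      have "(\<Sum>\<beta>\<in>(\<Union>j<Suc N. A j). len \<beta> powr p) = (\<Sum>\<beta>\<in>A N \<union> (\<Union>j<N. A j). len \<beta> powr p)"
        by (simp add: lessThan_Suc)
      also have "\<dots> \<le> (\<Sum>\<beta>\<in>A N. len \<beta> powr p) + (\<Sum>\<beta>\<in>(\<Union>j<N. A j). len \<beta> powr p)"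
        using A(1) by (simp add: sum_Un sum_nonneg)
      finally show ?case using Suc by simp
    qed simp
    also have "\<dots> \<le> (\<Sum>j<N. T * r ^ j)"
      by (intro sum_mono A(2))
    also have "\<dots> = T * (\<Sum>j<N. r ^ j)"
      by (simp add: sum_distrib_left)
    also have "\<dots> \<le> T * (1 / (1 - r))"
    proof (rule mult_left_mono)
      have "(\<Sum>j<N. r ^ j) \<le> (\<Sum>j. r ^ j)"
        using r by (intro sum_le_suminf summable_geometric) auto
      then show "(\<Sum>j<N. r ^ j) \<le> 1 / (1 - r)"
        using r by (simp add: suminf_geometric)
      show "0 \<le> T" using K by (simp add: T_def)
    qed
    finally show "(\<Sum>\<beta>\<in>F. len \<beta> powr p) \<le> (\<Sum>\<beta>\<in>L. len \<beta> powr p) + T / (1 - r)"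
      by simp
  qed
qed

section \<open>Counting bars on a grid\<close>

abbreviation (input) clipped_length :: "('a \<Rightarrow> real) \<Rightarrow> bar \<Rightarrow> real" where
  "clipped_length f \<beta> \<equiv> measure lborel (fst \<beta> \<inter> {Inf (range f)..Sup (range f)})"

lemma interval_Icc_subset:
  fixes J :: "real set"
  assumes "is_interval J" "a \<in> J" "b \<in> J"
  shows "{a..b} \<subseteq> J"
  using mem_is_interval_1_I[OF assms] by auto

lemma interval_Int_fmeasurable:
  fixes J :: "real set"
  assumes "is_interval J"
  shows "J \<inter> {a..b} \<in> fmeasurable lborel"
proof (rule fmeasurableI2[OF fmeasurable_compact[OF compact_Icc[of a b]]])
  show "J \<inter> {a..b} \<in> sets lborel"
    using real_interval_borel_measurable[OF assms] by auto
qed auto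

text \<open>The interval may miss its endpoints, so points are extracted indirectly: if all gaps
  were at most c, the set would lie in an interval of length c ending at its supremum.\<close>

lemma interval_long_gap:
  fixes J :: "real set"
  assumes "is_interval J" "c < measure lborel (J \<inter> {a..b})" "0 \<le> c"
  shows "\<exists>u\<in>J \<inter> {a..b}. \<exists>v\<in>J \<inter> {a..b}. c < v - u"
proof (rule ccontr)
  assume no: "\<not> ?thesis"
  let ?J = "J \<inter> {a..b}"
  have gap: "v - u \<le> c" if "u \<in> ?J" "v \<in> ?J" for u v
    using no that by (meson not_le)
  have ne: "?J \<noteq> {}" using assms(2,3) by (metis less_le_not_le measure_empty)
  have bdd: "bdd_above ?J" by (rule bdd_aboveI[of _ b]) auto
  have "?J \<subseteq> {Sup ?J - c..Sup ?J}"
  proof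
    fix u assume u: "u \<in> ?J"
    have "Sup ?J \<le> u + c"
      by (rule cSup_least[OF ne]) (use gap[OF u] in force)
    then show "u \<in> {Sup ?J - c..Sup ?J}"
      using cSup_upper[OF u bdd] by simp
  qed
  moreover have "?J \<in> sets lborel"
    by (rule fmeasurableD[OF interval_Int_fmeasurable[OF assms(1)]])
  ultimately have "measure lborel ?J \<le> measure lborel {Sup ?J - c..Sup ?J}"
    by (rule measure_mono_fmeasurable) (rule fmeasurable_compact[OF compact_Icc])
  then show False using assms(2,3) by simp
qed

context merge_tree
begin

section \<open>The tree distance and the grid of levels\<close>

definition merge_dist :: "'a \<Rightarrow> 'a \<Rightarrow> real" where
  "merge_dist x y = f x + f y - 2 * m x y"

lemma merge_dist_sym: "merge_dist x y = merge_dist y x"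
  by (simp add: merge_dist_def m_sym)

lemma merge_dist_lipschitz: "\<bar>f x - f y\<bar> \<le> merge_dist x y"
  using m_le[of x y] by (simp add: merge_dist_def abs_le_iff)

text \<open>Of m x y and m y z, the smaller is at most m x z and the larger at most f y; adding
  these two bounds gives the claim.\<close>

lemma merge_dist_triangle: "merge_dist x z \<le> merge_dist x y + merge_dist y z"
  using m_ultra[of x y z] m_le(2)[of x y] m_le(1)[of y z] by (simp add: merge_dist_def min_def split: if_splits)

lemma minimum_attained: obtains z where "f z = Inf (range f)" "\<And>x. f z \<le> f x"
proof -
  obtain z where z: "\<And>x. f z \<le> f x"
    using continuous_attains_inf[OF compact_space _ cont] by auto
  moreover have "f z = Inf (range f)"
    by (rule cInf_eq_minimum[symmetric]) (use z in auto)
  ultimately show ?thesis using that by blast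
qed

lemma Inf_le: "Inf (range f) \<le> f x"
  by (rule minimum_attained) metis

lemma le_Sup: "f x \<le> Sup (range f)"
  using compact_continuous_image[OF cont compact_space]
  by (intro cSup_upper) (auto intro: bounded_imp_bdd_above compact_imp_bounded)

definition grid :: "real \<Rightarrow> nat \<Rightarrow> real" where
  "grid \<epsilon> k = Inf (range f) + real k * \<epsilon>"

text \<open>A point occurs once for every grid cell that its bar crosses. Each cell count is the
  rank of a structure map, which is how other barcodes are compared with it.\<close>

definition grid_bars :: "real \<Rightarrow> (nat \<times> 'a) set" where
  "grid_bars \<epsilon> = (SIGMA k:UNIV. alive (grid \<epsilon> k) (grid \<epsilon> (Suc k)))"

lemma grid_less: "0 < \<epsilon> \<Longrightarrow> grid \<epsilon> k < grid \<epsilon> (Suc k)"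
  by (simp add: grid_def algebra_simps)

lemma grid_bounded:
  assumes "0 < \<epsilon>"
  obtains N where "\<And>k. k \<ge> N \<Longrightarrow> alive (grid \<epsilon> k) (grid \<epsilon> (Suc k)) = {}"
proof -
  obtain N where N: "(Sup (range f) - Inf (range f)) / \<epsilon> < real N"
    using reals_Archimedean2 by blast
  have "alive (grid \<epsilon> k) (grid \<epsilon> (Suc k)) = {}" if "k \<ge> N" for k
  proof (rule ccontr)
    assume "alive (grid \<epsilon> k) (grid \<epsilon> (Suc k)) \<noteq> {}"
    then obtain x where "grid \<epsilon> k \<le> f x"
      by (auto simp: alive_def bar_at_def)
    moreover have "real N * \<epsilon> \<le> real k * \<epsilon>"
      using that assms by (intro mult_right_mono) auto
    moreover have "Sup (range f) - Inf (range f) < real N * \<epsilon>"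
      using N assms by (simp add: divide_less_eq)
    ultimately show False
      using le_Sup[of x] by (simp add: grid_def)
  qed
  then show ?thesis using that by blast
qed

lemma finite_grid_bars:
  assumes "0 < \<epsilon>"
  shows "finite (grid_bars \<epsilon>)"
proof -
  obtain N where N: "\<And>k. k \<ge> N \<Longrightarrow> alive (grid \<epsilon> k) (grid \<epsilon> (Suc k)) = {}"
    by (rule grid_bounded[OF assms]) (rule that)
  have "grid_bars \<epsilon> \<subseteq> (SIGMA k:{..<N}. alive (grid \<epsilon> k) (grid \<epsilon> (Suc k)))"
  proof
    fix p assume "p \<in> grid_bars \<epsilon>"
    then obtain k x where "p = (k, x)" "x \<in> alive (grid \<epsilon> k) (grid \<epsilon> (Suc k))"
      by (auto simp: grid_bars_def)
    then show "p \<in> (SIGMA k:{..<N}. alive (grid \<epsilon> k) (grid \<epsilon> (Suc k)))"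
      using N[of k] by (cases "k < N") auto
  qed
  then show ?thesis
    by (rule finite_subset) (use finite_alive[OF grid_less[OF assms]] in auto)
qed

text \<open>Cutting each bar halfway between two consecutive grid levels gives a set of points that are
  pairwise at distance at least \<open>\<epsilon>\<close>.\<close>

lemma grid_bars_packing:
  assumes "0 < \<epsilon>" "finite C" "\<And>x. \<exists>c\<in>C. merge_dist c x \<le> \<epsilon> / 3"
  shows "card (grid_bars \<epsilon>) \<le> card C"
proof -
  have "\<exists>y. f y = grid \<epsilon> k + \<epsilon> / 2 \<and> m x y = f y" if "(k, x) \<in> grid_bars \<epsilon>" for k x
  proof -
    obtain z where z: "f z = Inf (range f)" using minimum_attained by metis
    have "f z \<le> grid \<epsilon> k + \<epsilon> / 2"
      using assms(1) by (simp add: z grid_def)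
    moreover have "grid \<epsilon> (Suc k) \<le> f x"
      using that by (auto simp: grid_bars_def alive_def bar_at_def)
    then have "grid \<epsilon> k + \<epsilon> / 2 \<le> f x"
      using assms(1) by (simp add: grid_def algebra_simps)
    ultimately show ?thesis
      using m_level[of z "grid \<epsilon> k + \<epsilon> / 2" x] by metis
  qed
  then obtain Y where Y: "\<And>k x. (k, x) \<in> grid_bars \<epsilon> \<Longrightarrow> f (Y k x) = grid \<epsilon> k + \<epsilon> / 2 \<and> m x (Y k x) = f (Y k x)"
    by metis
  obtain c where c: "\<And>x. c x \<in> C \<and> merge_dist (c x) x \<le> \<epsilon> / 3"
    using assms(3) by metis
  have "inj_on (\<lambda>(k, x). c (Y k x)) (grid_bars \<epsilon>)"
  proof (rule inj_onI, clarify)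
    fix k x k' x' assume p: "(k, x) \<in> grid_bars \<epsilon>" "(k', x') \<in> grid_bars \<epsilon>" and eq: "c (Y k x) = c (Y k' x')"
    \<comment> \<open>Sharing a centre of the \<epsilon> / 3 net puts the two points within 2
      \<epsilon> / 3, whereas midpoints of different cells differ by at least \<epsilon> in height.
      So k = k'.\<close>
    have near: "merge_dist (Y k x) (Y k' x') \<le> 2 * \<epsilon> / 3"
      using merge_dist_triangle[of "Y k x" "Y k' x'" "c (Y k x)"] c[of "Y k x"] c[of "Y k' x'"] eq
        merge_dist_sym[of "Y k x" "c (Y k x)"] by simp
    have "\<bar>real k - real k'\<bar> * \<epsilon> = \<bar>(real k - real k') * \<epsilon>\<bar>"
      using assms(1) by (simp add: abs_mult)
    also have "\<dots> = \<bar>f (Y k x) - f (Y k' x')\<bar>"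
      using Y[OF p(1)] Y[OF p(2)] by (simp add: grid_def algebra_simps)
    also have "\<dots> < 1 * \<epsilon>"
      using merge_dist_lipschitz[of "Y k x" "Y k' x'"] near assms(1) by linarith
    finally have "\<bar>real k - real k'\<bar> < 1"
      using assms(1) by (simp only: mult_less_cancel_right_pos)
    then have k: "k = k'" by linarith
    obtain s s' where s: "s \<in> reign x" "s < grid \<epsilon> k" "s' \<in> reign x'" "s' < grid \<epsilon> k"
      using p k by (auto simp: grid_bars_def alive_def bar_at_def)
    have le: "grid \<epsilon> k \<le> f x" "grid \<epsilon> k \<le> f x'"
      using p k by (auto simp: grid_bars_def alive_def bar_at_def)
    \<comment> \<open>A level below \<open>grid \<epsilon> k\<close> that lies in both reigns. Equal
      heights and distance at most 2 \<epsilon> / 3 connect the two points, and with them x and x',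
      above t.\<close>
    define t where "t = max s s'"
    have t: "t < grid \<epsilon> k" "t \<in> reign x" "t \<in> reign x'"
      using s le reign_mono[OF s(1), of t] reign_mono[OF s(3), of t] by (auto simp: t_def)
    have "t < m (Y k x) (Y k' x')"
      using near Y[OF p(1)] Y[OF p(2)] k t(1) assms(1) by (simp add: merge_dist_def)
    moreover have "t < m x (Y k x)" "t < m x' (Y k' x')"
      using Y[OF p(1)] Y[OF p(2)] k t(1) assms(1) by auto
    ultimately have "t < m x x'"
      using m_trans m_sym by metis
    then have "x = x'"
      using reign_unique[OF t(2,3)] by simp
    then show "k = k' \<and> x = x'" using k by simp
  qed
  moreover have "(\<lambda>(k, x). c (Y k x)) ` grid_bars \<epsilon> \<subseteq> C"
    using c by auto
  ultimately show ?thesis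
    using card_inj_on_le assms(2) by blast
qed

text \<open>A point at height between \<open>grid \<epsilon> (j + 2)\<close> and \<open>grid \<epsilon> (j + 3)\<close> is assigned to the bar of the
  eldest point of its component above \<open>grid \<epsilon> j\<close>; low points are all close to the minimum.\<close>

lemma grid_bars_cover:
  assumes "0 < \<epsilon>"
  obtains C where "finite C" "\<And>x. \<exists>c\<in>C. merge_dist c x \<le> 6 * \<epsilon>" "card C \<le> Suc (card (grid_bars \<epsilon>))"
proof -
  obtain z where z: "f z = Inf (range f)" "\<And>x. f z \<le> f x"
    by (rule minimum_attained) (rule that)
  define Y where "Y = {y. grid \<epsilon> 2 \<le> f y}"
  have "\<exists>j x. (Suc j, x) \<in> grid_bars \<epsilon> \<and> grid \<epsilon> j < m x y \<and> f y < grid \<epsilon> (j + 3)" if "y \<in> Y" for y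
  proof -
    define i where "i = nat \<lfloor>(f y - Inf (range f)) / \<epsilon>\<rfloor>"
    have q: "2 \<le> (f y - Inf (range f)) / \<epsilon>"
      using that assms by (simp add: Y_def grid_def le_divide_eq)
    then have i: "2 \<le> i" "real i \<le> (f y - Inf (range f)) / \<epsilon>" "(f y - Inf (range f)) / \<epsilon> < real i + 1"
      unfolding i_def by linarith+
    define j where "j = i - 2"
    have ij: "i = j + 2" using i(1) by (simp add: j_def)
    have lo: "grid \<epsilon> (j + 2) \<le> f y" and hi: "f y < grid \<epsilon> (j + 3)"
      using i(2,3) assms unfolding ij by (simp_all add: grid_def le_divide_eq divide_less_eq algebra_simps)
    have lt: "grid \<epsilon> j < grid \<epsilon> (Suc j)" "grid \<epsilon> (Suc j) < grid \<epsilon> (j + 2)"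
      using assms by (simp_all add: grid_def algebra_simps)
    obtain x where x: "x \<in> elders (grid \<epsilon> j) (grid \<epsilon> (j + 2))" "grid \<epsilon> j < m x y"
      using elder_of_exists[of "grid \<epsilon> j" "grid \<epsilon> (j + 2)" y] lt lo by auto
    \<comment> \<open>A bar is open at its lower end and may miss \<open>grid \<epsilon> j\<close>;
      hence the cell Suc j, and hence the treatment of points below \<open>grid \<epsilon> 2\<close>
      as low.\<close>
    have "x \<in> alive (grid \<epsilon> (Suc j)) (grid \<epsilon> (Suc (Suc j)))"
      using x(1) lt by (auto simp: elders_def alive_def bar_at_def intro!: bexI[of _ "grid \<epsilon> j"])
    then show ?thesis
      using x(2) hi by (auto simp: grid_bars_def)
  qed
  then have "\<exists>p. p \<in> grid_bars \<epsilon> \<and> (\<exists>j x. p = (Suc j, x) \<and> grid \<epsilon> j < m x y \<and> f y < grid \<epsilon> (j + 3))" if "y \<in> Y" for y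
    using that by blast
  then obtain P where P: "\<And>y. y \<in> Y \<Longrightarrow> P y \<in> grid_bars \<epsilon> \<and>
      (\<exists>j x. P y = (Suc j, x) \<and> grid \<epsilon> j < m x y \<and> f y < grid \<epsilon> (j + 3))"
    by metis
  have sub: "P ` Y \<subseteq> grid_bars \<epsilon>" using P by blast
  have fin: "finite (P ` Y)" by (rule finite_subset[OF sub finite_grid_bars[OF assms]])
  \<comment> \<open>One point of Y per label in use, and z for all low points; z accounts for the
    successor in the bound.\<close>
  define C where "C = insert z (inv_into Y P ` P ` Y)"
  show ?thesis
  proof (rule that[of C])
    show "finite C" using fin by (simp add: C_def)
    have "card (inv_into Y P ` P ` Y) \<le> card (P ` Y)"
      using fin by (rule card_image_le)
    also have "\<dots> \<le> card (grid_bars \<epsilon>)"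
      by (rule card_mono[OF finite_grid_bars[OF assms] sub])
    finally show "card C \<le> Suc (card (grid_bars \<epsilon>))"
      unfolding C_def using fin by (simp add: card_insert_if)
    fix y
    show "\<exists>c\<in>C. merge_dist c y \<le> 6 * \<epsilon>"
    proof (cases "y \<in> Y")
      case True
      define c where "c = inv_into Y P (P y)"
      have c: "c \<in> Y" "P c = P y" "c \<in> C"
        using True by (auto simp: c_def C_def inv_into_into f_inv_into_f)
      obtain j x where j: "P y = (Suc j, x)" "grid \<epsilon> j < m x y" "f y < grid \<epsilon> (j + 3)"
        using P[OF True] by blast
      have j': "grid \<epsilon> j < m x c" "f c < grid \<epsilon> (j + 3)"
        using P[OF c(1)] unfolding c(2) j(1) by auto
      have "grid \<epsilon> j < m c y"
        using m_trans[of "grid \<epsilon> j" c x y] j' j m_sym by simp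
      \<comment> \<open>Both heights are below level j + 3 and the merge level is above level j:
        twice three cells.\<close>
      then have "merge_dist c y \<le> 6 * \<epsilon>"
        using j j' by (simp add: merge_dist_def grid_def algebra_simps)
      then show ?thesis using c(3) by blast
    next
      case False
      have "f z \<le> m z y"
        using z(2) by (rule m_lower)
      then have "merge_dist z y \<le> 6 * \<epsilon>"
        using False assms by (simp add: merge_dist_def Y_def grid_def z(1))
      then show ?thesis by (auto simp: C_def)
    qed
  qed
qed

section \<open>Comparing grid counts with the lengths of bars\<close>

lemma barcode_interval: "is_H0_barcode TYPE('k::field) f B \<Longrightarrow> \<beta> \<in> B \<Longrightarrow> is_interval (fst \<beta>)"
  by (simp add: is_H0_barcode_def)

text \<open>Double counting of pairs of a bar and a cell that it crosses. A bar crossing n \<ge> 1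
  cells contains everything from the first to the last of them, so n \<le> length / \<epsilon>; as
  this quotient is at least 1, its p-th power is no smaller.\<close>

lemma grid_bars_le_sum:
  assumes B: "is_H0_barcode TYPE('k::field) f B" and "0 < \<epsilon>" "1 \<le> p"
  obtains F where "finite F" "F \<subseteq> B"
    "real (card (grid_bars \<epsilon>)) \<le> (\<Sum>\<beta>\<in>F. (clipped_length f \<beta> / \<epsilon>) powr p)"
proof -
  obtain N where N: "\<And>k. k \<ge> N \<Longrightarrow> alive (grid \<epsilon> k) (grid \<epsilon> (Suc k)) = {}"
    by (rule grid_bounded[OF assms(2)]) (rule that)
  define Q where "Q k \<beta> \<longleftrightarrow> \<beta> \<in> B \<and> grid \<epsilon> k \<in> fst \<beta> \<and> grid \<epsilon> (Suc k) \<in> fst \<beta>" for k \<beta>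
  have Q: "finite {\<beta>. Q k \<beta>}" "card {\<beta>. Q k \<beta>} = card (alive (grid \<epsilon> k) (grid \<epsilon> (Suc k)))" for k
    using barcode_alive[OF B grid_less[OF assms(2)], of k] by (simp_all add: Q_def)
  define F where "F = (\<Union>k<N. {\<beta>. Q k \<beta>})"
  have fin: "finite F" "F \<subseteq> B"
    using Q(1) by (auto simp: F_def Q_def)
  have "grid_bars \<epsilon> = (SIGMA k:{..<N}. alive (grid \<epsilon> k) (grid \<epsilon> (Suc k)))"
    using N by (auto simp: grid_bars_def) (metis not_less empty_iff)
  then have "card (grid_bars \<epsilon>) = (\<Sum>k<N. card {\<beta>. Q k \<beta>})"
    using finite_alive[OF grid_less[OF assms(2)]] Q(2) by (simp add: card_SigmaI)
  also have "\<dots> = (\<Sum>k<N. \<Sum>\<beta>\<in>F. if Q k \<beta> then 1 else 0)"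
  proof (rule sum.cong)
    fix k assume "k \<in> {..<N}"
    then have "{\<beta>. Q k \<beta>} = {\<beta>\<in>F. Q k \<beta>}"
      by (auto simp: F_def)
    then show "card {\<beta>. Q k \<beta>} = (\<Sum>\<beta>\<in>F. if Q k \<beta> then 1 else 0)"
      using fin(1) by (simp add: sum.If_cases Int_def)
  qed simp
  also have "\<dots> = (\<Sum>\<beta>\<in>F. card {k. k < N \<and> Q k \<beta>})"
    by (subst sum.swap) (simp add: sum.If_cases Int_def)
  finally have "real (card (grid_bars \<epsilon>)) = (\<Sum>\<beta>\<in>F. real (card {k. k < N \<and> Q k \<beta>}))"
    by simp
  also have "\<dots> \<le> (\<Sum>\<beta>\<in>F. (clipped_length f \<beta> / \<epsilon>) powr p)"
  proof (rule sum_mono)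
    fix \<beta> assume \<beta>: "\<beta> \<in> F"
    define ks where "ks = {k. k < N \<and> Q k \<beta>}"
    have ks: "finite ks" "ks \<noteq> {}"
      using \<beta> by (auto simp: ks_def F_def)
    define a b where "a = Min ks" and "b = Max ks"
    have ab: "a \<in> ks" "b \<in> ks" "ks \<subseteq> {a..b}" "a \<le> b"
      using ks by (auto simp: a_def b_def)
    have card: "real (card ks) \<le> real (Suc b) - real a"
      using card_mono[OF _ ab(3)] ab(4) by (simp add: of_nat_diff)
    have int: "is_interval (fst \<beta>)"
      using barcode_interval[OF B] \<beta> fin(2) by blast
    have "{grid \<epsilon> a..grid \<epsilon> (Suc b)} \<subseteq> fst \<beta> \<inter> {Inf (range f)..Sup (range f)}"
    proof -
      have "grid \<epsilon> a \<in> fst \<beta>" "grid \<epsilon> (Suc b) \<in> fst \<beta>"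
        using ab by (auto simp: ks_def Q_def)
      then have "{grid \<epsilon> a..grid \<epsilon> (Suc b)} \<subseteq> fst \<beta>"
        by (rule interval_Icc_subset[OF int])
      \<comment> \<open>B is an arbitrary barcode, so points of the space are reached only through
        the equality of counts: a bar of B across cell b forces a point at least as high as its
        top.\<close>
      moreover have "grid \<epsilon> (Suc b) \<le> Sup (range f)"
      proof -
        have "\<beta> \<in> {\<beta>. Q b \<beta>}" using ab(2) by (simp add: ks_def)
        then have "{\<beta>. Q b \<beta>} \<noteq> {}" by blast
        then have "alive (grid \<epsilon> b) (grid \<epsilon> (Suc b)) \<noteq> {}"
          using Q[of b] by (metis (no_types) card_0_eq card.empty)
        then obtain x where "grid \<epsilon> (Suc b) \<le> f x"
          by (auto simp: alive_def bar_at_def)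
        then show ?thesis using le_Sup[of x] by simp
      qed
      moreover have "Inf (range f) \<le> grid \<epsilon> a"
        using assms(2) by (simp add: grid_def)
      ultimately show ?thesis by auto
    qed
    then have "measure lborel {grid \<epsilon> a..grid \<epsilon> (Suc b)} \<le> clipped_length f \<beta>"
      by (intro measure_mono_fmeasurable interval_Int_fmeasurable[OF int]) auto
    moreover have "measure lborel {grid \<epsilon> a..grid \<epsilon> (Suc b)} = (real (Suc b) - real a) * \<epsilon>"
    proof -
      have "real a * \<epsilon> \<le> real (Suc b) * \<epsilon>"
        using ab(4) assms(2) by (intro mult_right_mono) auto
      then show ?thesis by (simp add: grid_def algebra_simps)
    qed
    ultimately have "(real (Suc b) - real a) * \<epsilon> \<le> clipped_length f \<beta>"
      by simp
    then have le: "real (card ks) \<le> clipped_length f \<beta> / \<epsilon>"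
      using card assms(2) by (simp add: le_divide_eq) (meson mult_right_mono less_imp_le order_trans)
    moreover have "1 \<le> real (card ks)"
      using ks by (simp add: Suc_le_eq card_gt_0_iff)
    ultimately have "(clipped_length f \<beta> / \<epsilon>) powr 1 \<le> (clipped_length f \<beta> / \<epsilon>) powr p"
      using assms(3) by (intro powr_mono) auto
    then show "real (card {k. k < N \<and> Q k \<beta>}) \<le> (clipped_length f \<beta> / \<epsilon>) powr p"
      using le \<open>1 \<le> real (card ks)\<close> assms(2) unfolding ks_def[symmetric] by simp
  qed
  finally show ?thesis
    using that fin by blast
qed

text \<open>Length 3 \<epsilon> yields two points of the bar more than 2 \<epsilon> apart, with two
  consecutive grid levels between them. Clipping keeps the lower point above the minimum of f, where
  the grid starts.\<close>

lemma long_bars_le: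
  assumes B: "is_H0_barcode TYPE('k::field) f B" and "0 < \<epsilon>"
  shows "finite {\<beta>\<in>B. 3 * \<epsilon> \<le> clipped_length f \<beta>}"
    "card {\<beta>\<in>B. 3 * \<epsilon> \<le> clipped_length f \<beta>} \<le> card (grid_bars \<epsilon>)"
proof -
  define Q where "Q k = {\<beta>\<in>B. grid \<epsilon> k \<in> fst \<beta> \<and> grid \<epsilon> (Suc k) \<in> fst \<beta>}" for k
  have Q: "finite (Q k)" "card (Q k) = card (alive (grid \<epsilon> k) (grid \<epsilon> (Suc k)))" for k
    using barcode_alive[OF B grid_less[OF assms(2)], of k] by (simp_all add: Q_def)
  obtain N where N: "\<And>k. k \<ge> N \<Longrightarrow> alive (grid \<epsilon> k) (grid \<epsilon> (Suc k)) = {}"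
    by (rule grid_bounded[OF assms(2)]) (rule that)
  have Q0: "Q k = {}" if "k \<ge> N" for k
    using Q[of k] N[OF that] by simp
  have sub: "{\<beta>\<in>B. 3 * \<epsilon> \<le> clipped_length f \<beta>} \<subseteq> (\<Union>k<N. Q k)"
  proof
    fix \<beta> assume "\<beta> \<in> {\<beta>\<in>B. 3 * \<epsilon> \<le> clipped_length f \<beta>}"
    then have \<beta>: "\<beta> \<in> B" "2 * \<epsilon> < clipped_length f \<beta>" using assms(2) by auto
    have int: "is_interval (fst \<beta>)" by (rule barcode_interval[OF B \<beta>(1)])
    obtain u v where uv: "u \<in> fst \<beta>" "v \<in> fst \<beta>" "Inf (range f) \<le> u" "2 * \<epsilon> < v - u"
      using interval_long_gap[OF int \<beta>(2)] assms(2) by auto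
    define k where "k = nat \<lceil>(u - Inf (range f)) / \<epsilon>\<rceil>"
    have "0 \<le> (u - Inf (range f)) / \<epsilon>" using uv assms(2) by simp
    then have "(u - Inf (range f)) / \<epsilon> \<le> real k" "real k < (u - Inf (range f)) / \<epsilon> + 1"
      unfolding k_def by linarith+
    then have "u \<le> grid \<epsilon> k" "grid \<epsilon> k < u + \<epsilon>"
      using assms(2) by (simp_all add: grid_def field_simps)
    moreover from this have "u \<le> grid \<epsilon> (Suc k)" "grid \<epsilon> (Suc k) \<le> v"
      using uv(4) assms(2) by (simp_all add: grid_def algebra_simps)
    ultimately have "grid \<epsilon> k \<in> {u..v}" "grid \<epsilon> (Suc k) \<in> {u..v}"
      using grid_less[OF assms(2), of k] by auto
    then have "\<beta> \<in> Q k"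
      using interval_Icc_subset[OF int uv(1,2)] \<beta>(1) by (auto simp: Q_def)
    then show "\<beta> \<in> (\<Union>k<N. Q k)"
      using Q0[of k] by (cases "k < N") auto
  qed
  then show "finite {\<beta>\<in>B. 3 * \<epsilon> \<le> clipped_length f \<beta>}"
    by (rule finite_subset) (use Q(1) in auto)
  have "card {\<beta>\<in>B. 3 * \<epsilon> \<le> clipped_length f \<beta>} \<le> card (\<Union>k<N. Q k)"
    using sub Q(1) by (intro card_mono) auto
  also have "\<dots> \<le> (\<Sum>k<N. card (Q k))"
    by (rule card_UN_le) simp
  also have "\<dots> = card (SIGMA k:{..<N}. alive (grid \<epsilon> k) (grid \<epsilon> (Suc k)))"
    using finite_alive[OF grid_less[OF assms(2)]] Q(2) by (simp add: card_SigmaI)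
  also have "\<dots> \<le> card (grid_bars \<epsilon>)"
    by (intro card_mono finite_grid_bars[OF assms(2)]) (auto simp: grid_bars_def)
  finally show "card {\<beta>\<in>B. 3 * \<epsilon> \<le> clipped_length f \<beta>} \<le> card (grid_bars \<epsilon>)" .
qed

lemma bar_sums_bounded:
  assumes B: "is_H0_barcode TYPE('k::field) f B" and "upper_box_dim UNIV merge_dist < ereal q" "q < p"
  obtains S where "\<And>F. finite F \<Longrightarrow> F \<subseteq> B \<Longrightarrow> (\<Sum>\<beta>\<in>F. clipped_length f \<beta> powr p) \<le> S"
proof -
  obtain \<epsilon>0 where \<epsilon>0: "0 < \<epsilon>0" "\<And>\<epsilon>. 0 < \<epsilon> \<Longrightarrow> \<epsilon> < \<epsilon>0 \<Longrightarrow>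
     \<exists>C. finite C \<and> C \<subseteq> UNIV \<and> UNIV \<subseteq> (\<Union>c\<in>C. {y. merge_dist c y \<le> \<epsilon>}) \<and> real (card C) \<le> \<epsilon> powr (- q)"
    by (rule upper_box_dim_less[OF assms(2)]) (rule that)
  have q: "0 \<le> q"
    using upper_box_dim_nonneg[of UNIV merge_dist] assms(2) by (meson ereal_less_eq(5) less_imp_le order_trans)
  \<comment> \<open>Bars of length at least \<eta> are counted on the grid of mesh \<eta> / 3, and
    packing there uses a net of radius one third of the mesh, that is \<eta> / 9.\<close>
  have long: "finite {\<beta>\<in>B. \<eta> \<le> clipped_length f \<beta>} \<and>
      real (card {\<beta>\<in>B. \<eta> \<le> clipped_length f \<beta>}) \<le> 9 powr q * \<eta> powr (- q)" if \<eta>: "0 < \<eta>" "\<eta> \<le> \<epsilon>0" for \<eta>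
  proof -
    obtain C where C: "finite C" "UNIV \<subseteq> (\<Union>c\<in>C. {y. merge_dist c y \<le> \<eta> / 9})" "real (card C) \<le> (\<eta> / 9) powr (- q)"
      using \<epsilon>0(2)[of "\<eta> / 9"] \<eta> by auto
    have "card (grid_bars (\<eta> / 3)) \<le> card C"
      by (rule grid_bars_packing) (use \<eta> C in auto)
    moreover have "(\<eta> / 9) powr (- q) = 9 powr q * \<eta> powr (- q)"
      using \<eta> by (simp add: powr_divide powr_minus divide_simps)
    ultimately show ?thesis
      using long_bars_le[OF B, of "\<eta> / 3"] \<eta> C(3) by auto
  qed
  show ?thesis
  proof (rule sum_powr_bounded[of q p \<epsilon>0 B "clipped_length f" "Sup (range f) - Inf (range f)" "9 powr q"])
    fix \<beta> assume "\<beta> \<in> B"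
    then have "fst \<beta> \<inter> {Inf (range f)..Sup (range f)} \<in> sets lborel"
      using fmeasurableD[OF interval_Int_fmeasurable[OF barcode_interval[OF B]]] by simp
    then have "clipped_length f \<beta> \<le> measure lborel {Inf (range f)..Sup (range f)}"
      by (intro measure_mono_fmeasurable fmeasurable_compact) auto
    then show "clipped_length f \<beta> \<le> Sup (range f) - Inf (range f)"
      using order_trans[OF Inf_le le_Sup] by simp
  qed (use q assms(3) \<epsilon>0(1) long that in auto)
qed

lemma dim_le_of_bar_sums:
  assumes B: "is_H0_barcode TYPE('k::field) f B" and "1 \<le> p"
    and S: "\<And>F. finite F \<Longrightarrow> F \<subseteq> B \<Longrightarrow> (\<Sum>\<beta>\<in>F. clipped_length f \<beta> powr p) \<le> S"
  shows "upper_box_dim UNIV merge_dist \<le> ereal p"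
proof (rule upper_box_dim_le[of p "1 + 6 powr p * S" 1])
  have S0: "0 \<le> S" using S[of "{}"] by simp
  then show "1 \<le> 1 + 6 powr p * S" by simp
  fix \<epsilon> :: real assume \<epsilon>: "0 < \<epsilon>" "\<epsilon> < 1"
  \<comment> \<open>The cover from the grid has radius six times the mesh. Its extra centre is
    absorbed later by 1 \<le> \<epsilon> powr (- p).\<close>
  obtain C where C: "finite C" "\<And>x. \<exists>c\<in>C. merge_dist c x \<le> 6 * (\<epsilon> / 6)" "card C \<le> Suc (card (grid_bars (\<epsilon> / 6)))"
    using grid_bars_cover[of "\<epsilon> / 6"] \<epsilon> by auto
  obtain F where F: "finite F" "F \<subseteq> B"
    "real (card (grid_bars (\<epsilon> / 6))) \<le> (\<Sum>\<beta>\<in>F. (clipped_length f \<beta> / (\<epsilon> / 6)) powr p)"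
    using grid_bars_le_sum[OF B _ assms(2), of "\<epsilon> / 6"] \<epsilon> by auto
  have "(clipped_length f \<beta> / (\<epsilon> / 6)) powr p = 6 powr p * \<epsilon> powr (- p) * clipped_length f \<beta> powr p" for \<beta>
    using \<epsilon> by (simp add: powr_divide powr_mult powr_minus divide_simps)
  then have "real (card (grid_bars (\<epsilon> / 6))) \<le> 6 powr p * \<epsilon> powr (- p) * (\<Sum>\<beta>\<in>F. clipped_length f \<beta> powr p)"
    using F(3) by (simp add: sum_distrib_left)
  also have "\<dots> \<le> 6 powr p * \<epsilon> powr (- p) * S"
    using S[OF F(1,2)] by (intro mult_left_mono) auto
  finally have "real (card C) \<le> 1 + 6 powr p * \<epsilon> powr (- p) * S"
    using C(3) by linarith
  moreover have "1 \<le> \<epsilon> powr (- p)"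
    using \<epsilon> assms(2) by (simp add: powr_minus one_le_inverse_iff powr_le_one_le powr_le1)
  ultimately have "real (card C) \<le> (1 + 6 powr p * S) * \<epsilon> powr (- p)"
    by (simp add: algebra_simps)
  then show "\<exists>C. finite C \<and> C \<subseteq> UNIV \<and> UNIV \<subseteq> (\<Union>c\<in>C. {y. merge_dist c y \<le> \<epsilon>}) \<and>
      real (card C) \<le> (1 + 6 powr p * S) * \<epsilon> powr (- p)"
    using C(1,2) by (intro exI[of _ C]) auto
qed (use assms(2) in auto)

text \<open>For nonnegative terms the infinite sum is the supremum of the finite partial sums, and
  the p-th root does not affect finiteness. The rest of the argument needs only bounds on finite
  real sums.\<close>

lemma Pers_finite_iff:
  "Pers TYPE('k::field) p f < \<infinity> \<longleftrightarrow>
     (\<exists>S. \<forall>F. finite F \<and> F \<subseteq> H0_barcode TYPE('k) f \<longrightarrow> (\<Sum>\<beta>\<in>F. clipped_length f \<beta> powr p) \<le> S)"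
proof -
  let ?B = "H0_barcode TYPE('k) f"
  let ?\<Sigma> = "\<Sum>\<^sub>\<infinity>\<beta>\<in>?B. ennreal (clipped_length f \<beta> powr p)"
  have SUP: "?\<Sigma> = (SUP F\<in>{F. finite F \<and> F \<subseteq> ?B}. ennreal (\<Sum>\<beta>\<in>F. clipped_length f \<beta> powr p))"
    by (subst nonneg_infsum_complete) (auto simp: sum_ennreal)
  have "Pers TYPE('k) p f < \<infinity> \<longleftrightarrow> ?\<Sigma> < \<infinity>"
    by (auto simp: Pers_def Let_def less_top)
  also have "\<dots> \<longleftrightarrow> (\<exists>S. \<forall>F. finite F \<and> F \<subseteq> ?B \<longrightarrow> (\<Sum>\<beta>\<in>F. clipped_length f \<beta> powr p) \<le> S)"
  proof
    assume fin: "?\<Sigma> < \<infinity>"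
    have "(\<Sum>\<beta>\<in>F. clipped_length f \<beta> powr p) \<le> enn2real ?\<Sigma>" if "finite F \<and> F \<subseteq> ?B" for F
    proof -
      have "ennreal (\<Sum>\<beta>\<in>F. clipped_length f \<beta> powr p) \<le> ?\<Sigma>"
        unfolding SUP using that by (intro SUP_upper) simp
      then show ?thesis
        using fin enn2real_mono[of "ennreal (\<Sum>\<beta>\<in>F. clipped_length f \<beta> powr p)" ?\<Sigma>]
        by (simp add: sum_nonneg)
    qed
    then show "\<exists>S. \<forall>F. finite F \<and> F \<subseteq> ?B \<longrightarrow> (\<Sum>\<beta>\<in>F. clipped_length f \<beta> powr p) \<le> S" by blast
  next
    assume "\<exists>S. \<forall>F. finite F \<and> F \<subseteq> ?B \<longrightarrow> (\<Sum>\<beta>\<in>F. clipped_length f \<beta> powr p) \<le> S"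
    then obtain S where S: "\<And>F. finite F \<and> F \<subseteq> ?B \<Longrightarrow> (\<Sum>\<beta>\<in>F. clipped_length f \<beta> powr p) \<le> S" by blast
    have "?\<Sigma> \<le> ennreal S"
      unfolding SUP using S by (intro SUP_least ennreal_leI) auto
    then show "?\<Sigma> < \<infinity>"
      using ennreal_less_top[of S] by (simp add: le_less_trans)
  qed
  finally show ?thesis .
qed

lemma is_H0_barcode_H0_barcode: "is_H0_barcode TYPE('k::field) f (H0_barcode TYPE('k) f)"
  unfolding H0_barcode_def by (rule someI[of _ elder_barcode]) (rule is_H0_barcode_elder)

text \<open>The index ranges over p \<ge> 1 only; the hypothesis makes every p above the dimension
  admissible. The intermediate q leaves the gap q < p needed for the geometric series.\<close>

lemma persistence_index_eq_dim:
  assumes "1 \<le> upper_box_dim UNIV merge_dist"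
  shows "persistence_index TYPE('k::field) f = upper_box_dim UNIV merge_dist"
proof (rule antisym)
  let ?B = "H0_barcode TYPE('k) f"
  note B = is_H0_barcode_H0_barcode[where 'k = 'k]
  show "persistence_index TYPE('k) f \<le> upper_box_dim UNIV merge_dist"
  proof (rule dense_ge)
    fix e assume e: "upper_box_dim UNIV merge_dist < e"
    then obtain q where q: "upper_box_dim UNIV merge_dist < ereal q" "ereal q < e"
      using ereal_dense2 by blast
    then obtain p where p: "ereal q < ereal p" "ereal p < e"
      using ereal_dense2 by blast
    have "1 \<le> p"
      using assms q(1) p(1) by (metis ereal_less_eq(3) less_imp_le one_ereal_def order_trans)
    obtain S where "\<And>F. finite F \<Longrightarrow> F \<subseteq> ?B \<Longrightarrow> (\<Sum>\<beta>\<in>F. clipped_length f \<beta> powr p) \<le> S"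
      by (rule bar_sums_bounded[OF B q(1), of p]) (use p that in auto)
    then have "Pers TYPE('k) p f < \<infinity>"
      unfolding Pers_finite_iff by blast
    then have "persistence_index TYPE('k) f \<le> ereal p"
      unfolding persistence_index_def using \<open>1 \<le> p\<close> by (intro Inf_lower) blast
    then show "persistence_index TYPE('k) f \<le> e"
      using p(2) by simp
  qed
  show "upper_box_dim UNIV merge_dist \<le> persistence_index TYPE('k) f"
    unfolding persistence_index_def
  proof (rule Inf_greatest)
    fix x assume "x \<in> {ereal p |p. 1 \<le> p \<and> Pers TYPE('k) p f < \<infinity>}"
    then obtain p where p: "x = ereal p" "1 \<le> p" "Pers TYPE('k) p f < \<infinity>" by blast
    then obtain S where "\<And>F. finite F \<Longrightarrow> F \<subseteq> ?B \<Longrightarrow> (\<Sum>\<beta>\<in>F. clipped_length f \<beta> powr p) \<le> S"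
      unfolding Pers_finite_iff by blast
    then show "upper_box_dim UNIV merge_dist \<le> x"
      unfolding p(1) by (rule dim_le_of_bar_sums[OF B p(2)])
  qed
qed

end

section \<open>The tree of a function and Hoelder regularity\<close>

context llc_function
begin

interpretation M: merge_tree f "merge f"
  by (rule merge_tree_merge)

section \<open>Passing to the quotient tree\<close>

lemma tree_pdist_eq: "tree_pdist f = M.merge_dist"
  by (simp add: fun_eq_iff tree_pdist_merge M.merge_dist_def)

lemma merge_dist_self: "M.merge_dist x x = 0"
  by (simp add: M.merge_dist_def M.m_self)

lemma merge_dist_nonneg: "0 \<le> M.merge_dist x y"
  using M.merge_dist_lipschitz[of x y] by linarith

lemma merge_dist_zero_cong:
  assumes "M.merge_dist x x' = 0" "M.merge_dist y y' = 0"
  shows "M.merge_dist x y = M.merge_dist x' y'"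
  using assms M.merge_dist_triangle[of x y x'] M.merge_dist_triangle[of x' y y'] M.merge_dist_triangle[of x' y' x] M.merge_dist_triangle[of x y' y]
    M.merge_dist_sym[of x x'] M.merge_dist_sym[of y y'] by linarith

definition tree_class :: "'a \<Rightarrow> 'a set" where
  "tree_class x = {y. M.merge_dist x y = 0}"

lemma tree_eq: "tree f = range tree_class"
  by (auto simp: tree_def quotient_def tree_pdist_eq tree_class_def)

lemma some_in_tree:
  assumes "A \<in> tree f"
  shows "(SOME x. x \<in> A) \<in> A" "tree_class (SOME x. x \<in> A) = A"
proof -
  obtain x where x: "A = tree_class x" using assms by (auto simp: tree_eq)
  define w where "w = (SOME x. x \<in> A)"
  have "x \<in> A" by (simp add: x tree_class_def merge_dist_self)
  then have w: "w \<in> A" unfolding w_def by (rule someI)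
  then have "M.merge_dist x w = 0" by (simp add: x tree_class_def)
  then have "M.merge_dist x y = M.merge_dist w y" for y
    by (rule merge_dist_zero_cong) (rule merge_dist_self)
  then have "tree_class w = A"
    by (simp add: tree_class_def x)
  with w show "(SOME x. x \<in> A) \<in> A" "tree_class (SOME x. x \<in> A) = A"
    by (simp_all add: w_def)
qed

lemma tree_dist_class: "tree_dist f (tree_class x) (tree_class y) = M.merge_dist x y"
proof -
  have "M.merge_dist x (SOME z. z \<in> tree_class x) = 0" for x
  proof -
    have "(SOME z. z \<in> tree_class x) \<in> tree_class x"
      by (rule some_in_tree(1)) (simp add: tree_eq)
    moreover have "M.merge_dist x w = 0" if "w \<in> tree_class x" for w
      using that by (simp add: tree_class_def)
    ultimately show ?thesis by blast
  qed
  then show ?thesis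
    unfolding tree_dist_def tree_pdist_eq by (intro merge_dist_zero_cong[symmetric])
qed

lemma upper_box_dim_tree: "upper_box_dim (tree f) (tree_dist f) = upper_box_dim UNIV M.merge_dist"
proof -
  have "covering_number (tree f) (tree_dist f) \<epsilon> = covering_number UNIV M.merge_dist \<epsilon>" for \<epsilon>
  proof (rule antisym)
    show "covering_number (tree f) (tree_dist f) \<epsilon> \<le> covering_number UNIV M.merge_dist \<epsilon>"
      by (rule covering_number_mono_map[where h = tree_class]) (auto simp: tree_eq tree_dist_class)
    show "covering_number UNIV M.merge_dist \<epsilon> \<le> covering_number (tree f) (tree_dist f) \<epsilon>"
    proof (rule covering_number_mono_map[where h = "\<lambda>A. SOME x. x \<in> A"])
      fix y
      have "M.merge_dist (SOME x. x \<in> A) y = tree_dist f A (tree_class y)" if "A \<in> tree f" for A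
        using tree_dist_class[of "SOME x. x \<in> A" y] some_in_tree(2)[OF that] by simp
      then show "\<exists>x\<in>tree f. \<forall>A\<in>tree f. M.merge_dist (SOME x. x \<in> A) y = tree_dist f A x"
        by (intro bexI[of _ "tree_class y"]) (auto simp: tree_eq)
    qed simp
  qed
  then show ?thesis
    by (simp add: upper_box_dim_def)
qed

section \<open>Connectedness and lower bounds for the dimensions\<close>

lemma range_contains_Icc:
  assumes "continuous_on UNIV g" "g x \<le> (g y :: real)"
  shows "{g x..g y} \<subseteq> range (g :: 'a \<Rightarrow> real)"
proof -
  have "connected (range g)"
    using llc connected_continuous_image[OF assms(1)] by (simp add: LLC_def)
  then show ?thesis
    by (rule connected_contains_Icc) auto
qed

lemma merge_dist_dim_ge_1:
  assumes "f x < f y"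
  shows "1 \<le> upper_box_dim UNIV M.merge_dist"
  by (rule upper_box_dim_ge_1[OF M.merge_dist_lipschitz assms]) (use range_contains_Icc[OF cont] assms in auto)

lemma space_dim_ge_1:
  assumes "x \<noteq> (y :: 'a)"
  shows "1 \<le> upper_box_dim (UNIV :: 'a set) dist"
proof (rule upper_box_dim_ge_1[of UNIV "dist x"])
  show "dist x x < dist x y" using assms by simp
  show "{dist x x..dist x y} \<subseteq> range (dist x)"
    by (rule range_contains_Icc) (auto intro: continuous_intros)
  fix u v
  show "\<bar>dist x u - dist x v\<bar> \<le> dist u v"
    using dist_triangle[of x u v] dist_triangle[of x v u] by (simp add: dist_commute abs_le_iff)
qed

section \<open>Hoelder regularity and the upper bound\<close>

lemma holder_norm_finite:
  fixes g :: "'a \<Rightarrow> real"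
  assumes "holder_norm \<alpha> g < \<infinity>"
  obtains K where "1 \<le> K" "\<And>x y. \<bar>g x - g y\<bar> \<le> K * dist x y powr \<alpha>"
proof -
  let ?S = "SUP (x, y)\<in>{(x, y). x \<noteq> y}. ennreal (\<bar>g x - g y\<bar> / dist x y powr \<alpha>)"
  have fin: "?S < \<infinity>"
    using assms by (auto simp: holder_norm_def less_top)
  define K where "K = max 1 (enn2real ?S)"
  have "\<bar>g x - g y\<bar> \<le> K * dist x y powr \<alpha>" for x y
  proof (cases "x = y")
    case False
    have "ennreal (\<bar>g x - g y\<bar> / dist x y powr \<alpha>) \<le> ?S"
      by (rule SUP_upper2[of "(x, y)"]) (use False in auto)
    then have "\<bar>g x - g y\<bar> / dist x y powr \<alpha> \<le> enn2real ?S"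
      using fin enn2real_mono[of "ennreal (\<bar>g x - g y\<bar> / dist x y powr \<alpha>)" ?S] by simp
    then have "\<bar>g x - g y\<bar> / dist x y powr \<alpha> \<le> K" by (simp add: K_def)
    then show ?thesis
      using False by (simp add: divide_le_eq)
  qed (simp add: K_def)
  then show ?thesis
    using that[of K] by (simp add: K_def)
qed

text \<open>A short path g from x to y is carried by h to a path from h x to h y, along which f
  stays within K (C dist x y) powr \<alpha> of its values at both ends. This bounds the tree
  distance of h x and h y by twice that amount, so the h-image of a net of the space is a net of the
  tree.\<close>

lemma dim_le_holder:
  fixes h h' :: "'a \<Rightarrow> 'a"
  assumes "0 < \<alpha>" "homeomorphism UNIV UNIV h h'" "holder_norm \<alpha> (f \<circ> h) < \<infinity>"
  shows "upper_box_dim UNIV M.merge_dist \<le> ereal (1 / \<alpha>) * upper_box_dim (UNIV :: 'a set) dist"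
proof -
  obtain K where K: "1 \<le> K" "\<And>x y. \<bar>f (h x) - f (h y)\<bar> \<le> K * dist x y powr \<alpha>"
    using holder_norm_finite[OF assms(3)] unfolding comp_apply by metis
  obtain C where C: "C > 0" "\<And>x y::'a. \<exists>g. path g \<and> pathstart g = x \<and> pathfinish g = y \<and>
     (\<forall>u\<in>path_image g. \<forall>v\<in>path_image g. dist u v \<le> C * dist x y)"
    by (rule small_path) (rule that)
  have cont_h: "continuous_on UNIV h" and surj: "range h = UNIV"
    using assms(2) by (auto simp: homeomorphism_def)
  have merge_dist_le: "M.merge_dist (h x) (h y) \<le> 2 * (K * (C * dist x y) powr \<alpha>)" for x y
  proof -
    let ?b = "K * (C * dist x y) powr \<alpha>"
    obtain g where g: "path g" "pathstart g = x" "pathfinish g = y"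
      "\<And>u v. u \<in> path_image g \<Longrightarrow> v \<in> path_image g \<Longrightarrow> dist u v \<le> C * dist x y"
      using C(2)[of x y] by metis
    have low: "f (h u) - ?b \<le> f (h w)" if "u \<in> path_image g" "w \<in> path_image g" for u w
    proof -
      have "\<bar>f (h u) - f (h w)\<bar> \<le> K * dist u w powr \<alpha>" by (rule K(2))
      also have "\<dots> \<le> ?b"
        using K(1) g(4)[OF that] assms(1) by (intro mult_left_mono powr_mono2) auto
      finally show ?thesis by linarith
    qed
    have "t < merge f (h x) (h y)" if t: "t < max (f (h x)) (f (h y)) - ?b" for t
      unfolding merge_gt_iff
    proof (intro exI[of _ "h \<circ> g"] conjI ballI)
      show "path (h \<circ> g)"
        using g(1) cont_h by (intro path_continuous_image) (auto intro: continuous_on_subset)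
      show "pathstart (h \<circ> g) = h x" "pathfinish (h \<circ> g) = h y"
        using g by (simp_all add: pathstart_def pathfinish_def)
      fix z assume "z \<in> path_image (h \<circ> g)"
      then obtain w where w: "w \<in> path_image g" "z = h w" by (auto simp: path_image_def)
      then show "t < f z"
        using t low[of x w] low[of y w] g(2,3) pathstart_in_path_image[of g] pathfinish_in_path_image[of g]
        by auto
    qed
    then have "max (f (h x)) (f (h y)) - ?b \<le> merge f (h x) (h y)"
      by (meson dense_le less_imp_le)
    then show ?thesis
      unfolding M.merge_dist_def by linarith
  qed
  have step: "upper_box_dim UNIV M.merge_dist \<le> ereal (q / \<alpha>)"
    if q: "upper_box_dim (UNIV :: 'a set) dist < ereal q" for q
  proof -
    obtain b where b: "0 < b" "\<And>\<epsilon>. 0 < \<epsilon> \<Longrightarrow> \<epsilon> < b \<Longrightarrow>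
       \<exists>D. finite D \<and> D \<subseteq> UNIV \<and> (UNIV :: 'a set) \<subseteq> (\<Union>c\<in>D. {y. dist c y \<le> \<epsilon>}) \<and> real (card D) \<le> \<epsilon> powr (- q)"
      by (rule upper_box_dim_less[OF q]) (rule that)
    have "ereal 0 \<le> ereal q"
      using upper_box_dim_nonneg[of "UNIV :: 'a set" dist] q by (metis less_imp_le order_trans zero_ereal_def)
    then have q0: "0 \<le> q" by simp
    let ?L = "max 1 (C powr q * (2 * K) powr (q / \<alpha>))"
    let ?e = "2 * (K * (C * b) powr \<alpha>)"
    show ?thesis
    proof (rule upper_box_dim_le[of "q / \<alpha>" ?L ?e])
      show "0 < ?e" using K C b by simp
      fix \<epsilon> :: real assume \<epsilon>: "0 < \<epsilon>" "\<epsilon> < ?e"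
      \<comment> \<open>The radius at which the bound of \<open>merge_dist_le\<close> equals
        \<epsilon>. Since \<open>?e\<close> is that bound at radius b, \<epsilon> <
        \<open>?e\<close> gives \<delta> < b.\<close>
      define \<delta> where "\<delta> = (\<epsilon> / (2 * K)) powr (1 / \<alpha>) / C"
      have \<delta>pos: "0 < \<delta>"
        using \<epsilon> K C by (simp add: \<delta>_def)
      have C\<delta>: "2 * (K * (C * \<delta>) powr \<alpha>) = \<epsilon>"
        using \<epsilon> K C assms(1) by (simp add: \<delta>_def powr_powr)
      have "\<delta> < b"
      proof (rule ccontr)
        assume "\<not> \<delta> < b"
        then have "(C * b) powr \<alpha> \<le> (C * \<delta>) powr \<alpha>"
          using C b assms(1) by (intro powr_mono2) auto
        then have "?e \<le> \<epsilon>"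
          unfolding C\<delta>[symmetric] using K by simp
        then show False using \<epsilon> by simp
      qed
      then obtain D where D: "finite D" "(UNIV :: 'a set) \<subseteq> (\<Union>c\<in>D. {y. dist c y \<le> \<delta>})" "real (card D) \<le> \<delta> powr (- q)"
        using b(2)[OF \<delta>pos] by blast
      have "UNIV \<subseteq> (\<Union>c\<in>h ` D. {y. M.merge_dist c y \<le> \<epsilon>})"
      proof
        fix y :: 'a
        obtain x where x: "y = h x" using surj by blast
        obtain c where c: "c \<in> D" "dist c x \<le> \<delta>" using D(2) by blast
        have "M.merge_dist (h c) y \<le> 2 * (K * (C * dist c x) powr \<alpha>)"
          unfolding x by (rule merge_dist_le)
        also have "\<dots> \<le> 2 * (K * (C * \<delta>) powr \<alpha>)"
          using K C c assms(1) by (intro mult_left_mono powr_mono2) auto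
        finally show "y \<in> (\<Union>c\<in>h ` D. {y. M.merge_dist c y \<le> \<epsilon>})"
          unfolding C\<delta> using c(1) by blast
      qed
      moreover have "real (card (h ` D)) \<le> ?L * \<epsilon> powr (- (q / \<alpha>))"
      proof -
        have "real (card (h ` D)) \<le> \<delta> powr (- q)"
          using card_image_le[OF D(1), of h] D(3) by linarith
        also have "\<dots> = C powr q * (2 * K) powr (q / \<alpha>) * \<epsilon> powr (- (q / \<alpha>))"
          using \<epsilon> K C by (simp add: \<delta>_def powr_divide powr_powr powr_minus divide_simps)
            (simp add: powr_mult powr_powr)
        also have "\<dots> \<le> ?L * \<epsilon> powr (- (q / \<alpha>))"
          by (intro mult_right_mono) auto
        finally show ?thesis .
      qed
      ultimately show "\<exists>D. finite D \<and> D \<subseteq> UNIV \<and> UNIV \<subseteq> (\<Union>c\<in>D. {y. M.merge_dist c y \<le> \<epsilon>}) \<and>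
          real (card D) \<le> ?L * \<epsilon> powr (- (q / \<alpha>))"
        using D(1) by blast
    qed (use q0 assms(1) in auto)
  qed
  show ?thesis
  proof (cases "upper_box_dim (UNIV :: 'a set) dist")
    case (real d)
    show ?thesis
      unfolding real
    proof (rule dense_ge)
      fix e assume e: "ereal (1 / \<alpha>) * ereal d < e"
      then obtain e' where e': "ereal (d / \<alpha>) < ereal e'" "ereal e' < e"
        using ereal_dense2[of "ereal (d / \<alpha>)" e] by auto
      then have "ereal d < ereal (e' * \<alpha>)"
        using assms(1) by (simp add: divide_less_eq)
      then have "upper_box_dim UNIV M.merge_dist \<le> ereal (e' * \<alpha> / \<alpha>)"
        by (intro step) (simp add: real)
      then show "upper_box_dim UNIV M.merge_dist \<le> e"
        using e'(2) assms(1) by simp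
    qed
  next
    case PInf
    then show ?thesis using assms(1) by simp
  next
    case MInf
    then show ?thesis using upper_box_dim_nonneg[of "UNIV :: 'a set" dist] by simp
  qed
qed

lemma holder_index_ge_1: "1 \<le> holder_index f"
  unfolding holder_index_def
proof (rule Inf_greatest)
  fix e assume "e \<in> {ereal (1 / \<alpha>) | \<alpha>. 0 < \<alpha> \<and> \<alpha> \<le> 1 \<and>
            (\<exists>h h' :: 'a \<Rightarrow> 'a. homeomorphism UNIV UNIV h h' \<and> holder_norm \<alpha> (f \<circ> h) < \<infinity>)}"
  then obtain \<alpha> where "e = ereal (1 / \<alpha>)" "0 < \<alpha>" "\<alpha> \<le> 1" by blast
  then show "1 \<le> e" by (simp add: one_ereal_def)
qed

text \<open>The infimum is handled by dividing by the dimension of the space, which is at least 1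
  because a nonconstant f needs two points of a connected space. If it is infinite, so is the
  product, as \<open>holder_index f\<close> is at least 1.\<close>

lemma dim_le_holder_index:
  assumes "f x < f y"
  shows "upper_box_dim UNIV M.merge_dist \<le> holder_index f * upper_box_dim (UNIV :: 'a set) dist"
proof -
  let ?D = "upper_box_dim (UNIV :: 'a set) dist"
  have D: "1 \<le> ?D"
    using space_dim_ge_1[of x y] assms by auto
  show ?thesis
  proof (cases "?D")
    case (real d)
    then have d: "0 < d" using D by (simp add: one_ereal_def)
    have "upper_box_dim UNIV M.merge_dist / ?D \<le> holder_index f"
      unfolding holder_index_def
    proof (rule Inf_greatest)
      fix e assume "e \<in> {ereal (1 / \<alpha>) | \<alpha>. 0 < \<alpha> \<and> \<alpha> \<le> 1 \<and>
            (\<exists>h h' :: 'a \<Rightarrow> 'a. homeomorphism UNIV UNIV h h' \<and> holder_norm \<alpha> (f \<circ> h) < \<infinity>)}"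
      then obtain \<alpha> and h h' :: "'a \<Rightarrow> 'a" where \<alpha>: "e = ereal (1 / \<alpha>)" "0 < \<alpha>" "homeomorphism UNIV UNIV h h'"
        "holder_norm \<alpha> (f \<circ> h) < \<infinity>" by blast
      show "upper_box_dim UNIV M.merge_dist / ?D \<le> e"
        using dim_le_holder[OF \<alpha>(2-4)] d unfolding \<alpha>(1) real
        by (subst ereal_divide_le_pos) (auto simp: mult.commute)
    qed
    then show ?thesis
      using d unfolding real by (subst (asm) ereal_divide_le_pos) (auto simp: mult.commute)
  next
    case PInf
    have "0 < holder_index f"
      using holder_index_ge_1 by (rule less_le_trans[rotated]) simp
    then show ?thesis
      unfolding PInf by (cases "holder_index f") auto
  next
    case MInf
    then show ?thesis using D by simp
  qed
qed

lemma constant_dim: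
  assumes "\<And>x y. f x = f y"
  shows "upper_box_dim UNIV M.merge_dist = 0"
proof (rule antisym)
  obtain z :: 'a where True by simp
  have "M.merge_dist z y = 0" for y
  proof -
    have "f z \<le> merge f z y"
    proof (rule M.m_lower)
      show "f z \<le> f w" for w using assms[of z w] by simp
    qed
    then show ?thesis
      using merge_dist_nonneg[of z y] assms[of y z] by (simp add: M.merge_dist_def)
  qed
  then have "upper_box_dim UNIV M.merge_dist \<le> ereal 0"
    by (intro upper_box_dim_le[of 0 1 1]) (auto intro!: exI[of _ "{z}"])
  then show "upper_box_dim UNIV M.merge_dist \<le> 0"
    by (simp add: zero_ereal_def)
qed (rule upper_box_dim_nonneg)

text \<open>The equality excludes constant f: there the tree has dimension 0, while the index is at
  least 1 by its definition. The inequality survives because its right-hand side is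
  nonnegative.\<close>

lemma persistence_index_dim_holder:
  "(\<not> f constant_on UNIV \<longrightarrow>
      persistence_index TYPE('k::field) f = upper_box_dim (tree f) (tree_dist f)) \<and>
    upper_box_dim (tree f) (tree_dist f) \<le> holder_index f * upper_box_dim (UNIV :: 'a set) dist"
proof (cases "f constant_on UNIV")
  case True
  then have "upper_box_dim UNIV M.merge_dist = 0"
    by (intro constant_dim) (auto simp: constant_on_def)
  moreover have "0 \<le> holder_index f * upper_box_dim (UNIV :: 'a set) dist"
    using upper_box_dim_nonneg[of "UNIV :: 'a set" dist] order_trans[OF _ holder_index_ge_1, of 0]
    by (simp add: ereal_0_le_mult)
  ultimately show ?thesis
    using True by (simp add: upper_box_dim_tree)
next
  case False
  then obtain x where "f x \<noteq> f undefined"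
    unfolding constant_on_def by blast
  then obtain x y where "f x < f y"
    by (metis linorder_neqE_linordered_idom)
  then show ?thesis
    unfolding upper_box_dim_tree
    using M.persistence_index_eq_dim[OF merge_dist_dim_ge_1, where 'k = 'k] dim_le_holder_index by blast
qed

end

theorem lemma3p13:
  fixes f :: "'a::metric_space \<Rightarrow> real"
  assumes "compact (UNIV :: 'a set)"
    and "LLC (UNIV :: 'a set)"
    and "continuous_on UNIV f"
  shows "(\<not> f constant_on UNIV \<longrightarrow>
            persistence_index TYPE('k::field) f = upper_box_dim (tree f) (tree_dist f)) \<and>
         upper_box_dim (tree f) (tree_dist f)
           \<le> holder_index f * upper_box_dim (UNIV :: 'a set) dist"
  by (intro llc_function.persistence_index_dim_holder llc_function.intro assms)

end
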